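(* Let $\mathcal I$ be either of the spaces $\mathcal B$ or $\mathcal P_\infty$, and for a separable infinite-dimensional Banach space $X$ let $\langle X\rangle_{\simeq}=\{\mu\in\mathcal I: X_\mu\text{ is linearly isomorphic to }X\}$. Then the Hilbert space $\ell_2$ is characterized as the unique, up to isomorphism, separable infinite-dimensional Banach space $X$ such that $\langle X\rangle_\simeq$ is an $F_\sigma$-set in $\mathcal I$. Moreover, $\langle\ell_2\rangle_\simeq$ is $F_\sigma$-complete in $\mathcal I$.
   Context: All Banach spaces are real. Let $V$ be the vector space over $\mathbb Q$ of all finitely supported sequences of rational numbers. $\mathcal P$ denotes the space of all pseudonorms on $V$, a closed subset of $\mathbb R^V$ with the inherited (Polish) topology of pointwise convergence. Each $\mu\in\mathcal P$ is identified with its unique extension to a pseudonorm on the real vector space $c_{00}$ of finitely supported real sequences, and $X_\mu$ denotes the completion of the quotient of $(c_{00},\mu)$ by $\{x\in c_{00}:\mu(x)=0\}$. $\mathcal P_\infty$ is the set of $\mu\in\mathcal P$ for which $X_\mu$ is infinite-dimensional, and $\mathcal B$ is the set of $\mu\in\mathcal P_\infty$ whose extension to $c_{00}$ is a norm; both carry the (Polish) subspace topology. A subset $A$ of a Polish space $Y$ is $F_\sigma$-complete if it is $F_\sigma$ in $Y$ and for every zero-dimensional Polish space $Z$ and every $F_\sigma$-set $C\subseteq Z$ there is a continuous $f:Z\to Y$ with $C=f^{-1}(A)$. *)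

theory Defs
  imports "HOL-Analysis.Analysis" "HOL-Analysis.Finite_Function_Topology"
    "HOL-Algebra.Module" "HOL-Algebra.AbelCoset"
begin

section \<open>Real normed spaces with a carrier\<close>

text \<open>
  The space \<open>X\<^sub>\<mu>\<close> depends on the value \<open>\<mu>\<close>, so it cannot be a type of class
  \<^class>\<open>banach\<close>. Normed spaces are therefore modules over the reals in the sense of
  HOL-Algebra, with one additional field for the norm. The ring multiplication and unit that the
  \<open>module\<close> record inherits play no role; the spaces below leave them undefined.
\<close>

record 'a nspace = "(real, 'a) module" +
  nrm :: "'a \<Rightarrow> real"

definition real_ring :: "real ring" where
  "real_ring = \<lparr>carrier = UNIV, mult = (*), one = 1, zero = 0, add = (+)\<rparr>"

locale pseudonormed_space = module real_ring X for X :: "'a nspace" (structure) +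
  assumes nrm_nonneg: "x \<in> carrier X \<Longrightarrow> 0 \<le> nrm X x"
    and nrm_smult: "x \<in> carrier X \<Longrightarrow> nrm X (c \<odot> x) = \<bar>c\<bar> * nrm X x"
    and nrm_triangle: "x \<in> carrier X \<Longrightarrow> y \<in> carrier X \<Longrightarrow> nrm X (x \<oplus> y) \<le> nrm X x + nrm X y"

locale normed_space = pseudonormed_space +
  assumes nrm_eq_0: "x \<in> carrier X \<Longrightarrow> nrm X x = 0 \<Longrightarrow> x = \<zero>"

text \<open>The case distinction is there because \<^locale>\<open>Metric_space\<close> asks for nonnegativity and
  symmetry of the distance also outside the carrier.\<close>

definition ndist :: "'a nspace \<Rightarrow> 'a \<Rightarrow> 'a \<Rightarrow> real" where
  "ndist X x y = (if x \<in> carrier X \<and> y \<in> carrier X then nrm X (x \<ominus>\<^bsub>X\<^esub> y) else 0)"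

definition ntop :: "'a nspace \<Rightarrow> 'a topology" where
  "ntop X = Metric_space.mtopology (carrier X) (ndist X)"

definition banach_space :: "'a nspace \<Rightarrow> bool" where
  "banach_space X \<longleftrightarrow> normed_space X \<and> Metric_space.mcomplete (carrier X) (ndist X)"

definition finite_dimensional :: "'a nspace \<Rightarrow> bool" where
  "finite_dimensional X \<longleftrightarrow>
     (\<exists>B. finite B \<and> B \<subseteq> carrier X \<and>
       (\<forall>x\<in>carrier X. \<exists>c. x = (\<Oplus>\<^bsub>X\<^esub>b\<in>B. c b \<odot>\<^bsub>X\<^esub> b)))"

definition separable_infinite_dimensional_banach :: "'a nspace \<Rightarrow> bool" where
  "separable_infinite_dimensional_banach X \<longleftrightarrow>
     banach_space X \<and> separable_space (ntop X) \<and> \<not> finite_dimensional X"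

definition linear_map :: "'a nspace \<Rightarrow> 'b nspace \<Rightarrow> ('a \<Rightarrow> 'b) \<Rightarrow> bool" where
  "linear_map X Y T \<longleftrightarrow>
     T \<in> carrier X \<rightarrow> carrier Y \<and>
     (\<forall>x\<in>carrier X. \<forall>y\<in>carrier X. T (x \<oplus>\<^bsub>X\<^esub> y) = T x \<oplus>\<^bsub>Y\<^esub> T y) \<and>
     (\<forall>c. \<forall>x\<in>carrier X. T (c \<odot>\<^bsub>X\<^esub> x) = c \<odot>\<^bsub>Y\<^esub> T x)"

definition linearly_isomorphic :: "'a nspace \<Rightarrow> 'b nspace \<Rightarrow> bool" (infix \<open>\<simeq>\<^sub>l\<close> 50) where
  "X \<simeq>\<^sub>l Y \<longleftrightarrow> (\<exists>T. linear_map X Y T \<and> homeomorphic_map (ntop X) (ntop Y) T)"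

definition ell2 :: "(nat \<Rightarrow> real) nspace" where
  "ell2 = \<lparr>carrier = {x. summable (\<lambda>n. (x n)\<^sup>2)}, mult = undefined, one = undefined,
     zero = (\<lambda>n. 0), add = (\<lambda>x y n. x n + y n), smult = (\<lambda>c x n. c * x n),
     nrm = (\<lambda>x. sqrt (suminf (\<lambda>n. (x n)\<^sup>2)))\<rparr>"


section \<open>Quotient and completion\<close>

definition null_space :: "'a nspace \<Rightarrow> 'a set" where
  "null_space X = {x \<in> carrier X. nrm X x = 0}"

text \<open>The norm is constant on each coset of the null space, so \<open>the_elem\<close> picks that constant.\<close>

definition quotient_by_null :: "'a nspace \<Rightarrow> 'a set nspace" where
  "quotient_by_null X =
     \<lparr>carrier = a_rcosets\<^bsub>X\<^esub> (null_space X), mult = undefined, one = undefined,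
      zero = null_space X, add = (\<lambda>A B. A <+>\<^bsub>X\<^esub> B),
      smult = (\<lambda>c A. \<Union>a\<in>A. null_space X +>\<^bsub>X\<^esub> (c \<odot>\<^bsub>X\<^esub> a)),
      nrm = (\<lambda>A. the_elem (nrm X ` A))\<rparr>"

text \<open>The completion is the space of Cauchy sequences, pseudonormed by the limit of the norms,
  modulo the sequences converging to \<open>0\<close>.\<close>

definition cauchy_sequences :: "'a nspace \<Rightarrow> (nat \<Rightarrow> 'a) nspace" where
  "cauchy_sequences X =
     \<lparr>carrier = {s. Metric_space.MCauchy (carrier X) (ndist X) s}, mult = undefined, one = undefined,
      zero = (\<lambda>n. \<zero>\<^bsub>X\<^esub>), add = (\<lambda>s t n. s n \<oplus>\<^bsub>X\<^esub> t n), smult = (\<lambda>c s n. c \<odot>\<^bsub>X\<^esub> s n),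
      nrm = (\<lambda>s. lim (\<lambda>n. nrm X (s n)))\<rparr>"

definition completion :: "'a nspace \<Rightarrow> (nat \<Rightarrow> 'a) set nspace" where
  "completion X = quotient_by_null (cauchy_sequences X)"


section \<open>Pseudonorms on finitely supported sequences\<close>

type_synonym V = "nat \<Rightarrow>\<^sub>0 rat"
type_synonym c00 = "nat \<Rightarrow>\<^sub>0 real"

text \<open>The topology of \<open>\<real>\<^sup>V\<close> is the product topology, which is the topology of the function
  type \<^typ>\<open>V \<Rightarrow> real\<close>.\<close>

definition pseudonorms :: "(V \<Rightarrow> real) set" where
  "pseudonorms = {\<mu>. (\<forall>x. 0 \<le> \<mu> x) \<and>
     (\<forall>q x. \<mu> (Poly_Mapping.map ((*) q) x) = \<bar>real_of_rat q\<bar> * \<mu> x) \<and>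
     (\<forall>x y. \<mu> (x + y) \<le> \<mu> x + \<mu> y)}"

definition pseudonorm_c00 :: "(c00 \<Rightarrow> real) \<Rightarrow> bool" where
  "pseudonorm_c00 \<nu> \<longleftrightarrow> (\<forall>x. 0 \<le> \<nu> x) \<and> (\<forall>c x. \<nu> (c *\<^sub>R x) = \<bar>c\<bar> * \<nu> x) \<and>
     (\<forall>x y. \<nu> (x + y) \<le> \<nu> x + \<nu> y)"

definition extension :: "(V \<Rightarrow> real) \<Rightarrow> c00 \<Rightarrow> real" where
  "extension \<mu> = (THE \<nu>. pseudonorm_c00 \<nu> \<and> (\<forall>x. \<nu> (Poly_Mapping.map real_of_rat x) = \<mu> x))"

definition c00_space :: "(V \<Rightarrow> real) \<Rightarrow> c00 nspace" where
  "c00_space \<mu> = \<lparr>carrier = UNIV, mult = undefined, one = undefined, zero = 0, add = (+),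
     smult = (*\<^sub>R), nrm = extension \<mu>\<rparr>"

definition X_space :: "(V \<Rightarrow> real) \<Rightarrow> (nat \<Rightarrow> c00 set) set nspace" where
  "X_space \<mu> = completion (quotient_by_null (c00_space \<mu>))"

definition P_inf :: "(V \<Rightarrow> real) set" where
  "P_inf = {\<mu> \<in> pseudonorms. \<not> finite_dimensional (X_space \<mu>)}"

definition B_norms :: "(V \<Rightarrow> real) set" where
  "B_norms = {\<mu> \<in> P_inf. \<forall>x. extension \<mu> x = 0 \<longrightarrow> x = 0}"

definition iso_class :: "(V \<Rightarrow> real) set \<Rightarrow> 'a nspace \<Rightarrow> (V \<Rightarrow> real) set" where
  "iso_class I X = {\<mu> \<in> I. X_space \<mu> \<simeq>\<^sub>l X}"


section \<open>Completeness for \<open>F\<^sub>\<sigma>\<close>-sets\<close>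

definition polish_top :: "'a topology \<Rightarrow> bool" where
  "polish_top Z \<longleftrightarrow> completely_metrizable_space Z \<and> separable_space Z"

text \<open>Zero-dimensional means small inductive dimension at most \<open>0\<close>, that is, the clopen sets form
  a base (see \<open>dimension_le_0_neighbourhood_base_of_clopen\<close>). A definition cannot quantify over the
  type of the points of \<open>Z\<close>, so that type is a parameter, to be left as a type variable.\<close>

definition fsigma_complete :: "'z itself \<Rightarrow> 'y topology \<Rightarrow> 'y set \<Rightarrow> bool" where
  "fsigma_complete (_ :: 'z itself) Y A \<longleftrightarrow>
     fsigma_in Y A \<and>
     (\<forall>(Z :: 'z topology) C. polish_top Z \<and> Z dim_le 0 \<and> fsigma_in Z C \<longrightarrow>
       (\<exists>f. continuous_map Z Y f \<and> C = {z \<in> topspace Z. f z \<in> A}))"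

end

theory Submission
  imports Defs
begin

text \<open>
  Call a pseudonorm on \<open>c\<^sub>0\<^sub>0\<close> Hilbertian if it is equivalent to the pseudonorm of a
  semi-inner product. For infinite-dimensional \<open>X\<^sub>\<mu>\<close> this means \<open>X\<^sub>\<mu> \<simeq> \<ell>\<^sub>2\<close>
  (Gram--Schmidt), and for a fixed constant of equivalence it is a closed condition on \<open>\<mu>\<close>, because
  semi-inner products form a compact family. Hence the class of \<open>\<ell>\<^sub>2\<close> is \<open>F\<^sub>\<sigma>\<close>.

  Conversely let the class of \<open>X\<close> be the union of closed sets \<open>F\<^sub>n\<close> and suppose that \<open>X\<close> is not
  isomorphic to \<open>\<ell>\<^sub>2\<close>. By Dvoretzky's theorem (only up to a constant), every finite-dimensional
  subspace \<open>E\<close> of \<open>X\<close> extends to a Hilbertian space \<open>E + \<ell>\<^sub>2\<close> that is finitely representable in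
  \<open>X\<close> over \<open>E\<close>. This space is not in \<open>F\<^sub>n\<close>, so a finite part of its norm, realised in \<open>X\<close> by a
  finite-dimensional space containing \<open>E\<close>, already forces a norm out of \<open>F\<^sub>n\<close>. Alternating this with
  adding vectors of a dense sequence produces a presentation of \<open>X\<close> itself that lies in no \<open>F\<^sub>n\<close>.

  For completeness, write an \<open>F\<^sub>\<sigma>\<close>-set as an increasing union of closed sets \<open>C\<^sub>n\<close> and perturb the
  norm of \<open>\<ell>\<^sub>2\<close> by \<open>l\<^sub>1\<^sup>n\<close>-norms on disjoint blocks, with weights that are continuous
  functions vanishing exactly on \<open>C\<^sub>n\<close>.
\<close>

section \<open>Filters with limits of bounded functions\<close>

text \<open>Every space is handled through a linear map from \<open>c00\<close> with dense range:
  \<open>X_space \<mu>\<close> has one by construction, a separable space gets one from a dense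
  sequence, and two spaces are isomorphic once the pulled back seminorms are equivalent. Isomorphism
  questions thus become inequalities between seminorms on \<open>c00\<close> in which constants do
  not matter, and this is why Dvoretzky's theorem with an unspecified constant is enough. One
  constant must serve all dimensions, however: the Euclidean subspaces found for different
  dimensions are not nested and have to be glued by a further limit. They are found in a spreading
  model defined by iterated limits, which takes the place of a Ramsey argument. All limits are taken
  along a \<open>limit_filter\<close>, which has the one property of ultrafilters that is used:
  bounded real functions converge. The same device provides compactness for semi-inner products and
  for coefficient vectors. Both choices of \<open>I\<close> are treated at once because every
  pseudonorm constructed on the way is a norm on \<open>c00\<close>.\<close>

definition limit_filter :: "'i filter \<Rightarrow> bool" where
  "limit_filter U \<longleftrightarrow> U \<noteq> bot \<and>
     (\<forall>f :: 'i \<Rightarrow> real. (\<exists>B. \<forall>\<^sub>F i in U. \<bar>f i\<bar> \<le> B) \<longrightarrow> (\<exists>l. (f \<longlongrightarrow> l) U))"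

lemma limit_filter_nonbot: "limit_filter U \<Longrightarrow> U \<noteq> bot"
  by (simp add: limit_filter_def)

lemma limit_filter_tendsto_Lim:
  fixes f :: "'i \<Rightarrow> real"
  assumes "limit_filter U" "\<forall>\<^sub>F i in U. \<bar>f i\<bar> \<le> B"
  shows "(f \<longlongrightarrow> Lim U f) U"
  using assms tendsto_Lim[of U f] by (auto simp: limit_filter_def)

text \<open>Evaluating all functions bounded by \<open>1\<close> maps the index set into a compact cube; a
  cluster point there of the image of \<open>F\<close> prescribes all the limits at once.\<close>

lemma ex_limit_filter:
  fixes F :: "'i filter"
  assumes "F \<noteq> bot"
  obtains U where "U \<le> F" "limit_filter U"
proof -
  define e :: "'i \<Rightarrow> ('i \<Rightarrow> real) \<Rightarrow> real" where "e i f = max (-1) (min 1 (f i))" for i f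
  define K :: "(('i \<Rightarrow> real) \<Rightarrow> real) set" where "K = (\<Pi>\<^sub>E f\<in>UNIV. {-1..1})"
  have "compactin (product_topology (\<lambda>_. euclidean) UNIV) K"
    unfolding K_def compactin_PiE by auto
  then have "compact K"
    by (simp add: euclidean_product_topology compactin_euclidean_iff)
  moreover have "eventually (\<lambda>x. x \<in> K) (filtermap e F)"
    by (auto simp: eventually_filtermap K_def e_def PiE_def)
  moreover have "filtermap e F \<noteq> bot"
    using assms by (simp add: filtermap_bot_iff)
  ultimately obtain l where l: "inf (nhds l) (filtermap e F) \<noteq> bot"
    unfolding compact_filter by blast
  define U where "U = inf F (filtercomap e (nhds l))"
  have nonbot: "U \<noteq> bot"
  proof
    assume "U = bot"
    then have "eventually (\<lambda>_. False) U" by simp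
    then obtain P Q where P: "eventually P F" and Q: "eventually Q (nhds l)"
      and PQ: "\<And>i. P i \<Longrightarrow> Q (e i) \<Longrightarrow> False"
      unfolding U_def eventually_inf eventually_filtercomap by blast
    have "eventually (\<lambda>y. \<not> Q y) (filtermap e F)"
      unfolding eventually_filtermap using PQ by (intro eventually_mono[OF P]) blast
    with Q have "eventually (\<lambda>_. False) (inf (nhds l) (filtermap e F))"
      unfolding eventually_inf by blast
    with l show False by (simp add: trivial_limit_def)
  qed
  have "filterlim e (nhds l) U"
    unfolding U_def filterlim_iff_le_filtercomap by simp
  then have lim_e: "((\<lambda>i. e i f) \<longlongrightarrow> l f) U" for f
        by (rule continuous_on_tendsto_compose[OF continuous_on_product_coordinates]) auto
  have "\<exists>l. (f \<longlongrightarrow> l) U" if f: "\<forall>\<^sub>F i in U. \<bar>f i\<bar> \<le> B" for f :: "'i \<Rightarrow> real" and B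
  proof -
    \<comment> \<open>The cube records only functions with values in \<open>{-1..1}\<close>, so
      \<open>f\<close> is scaled down first; the maximum with 1 makes the factor invertible.\<close>
    let ?B = "max 1 B"
    have "((\<lambda>i. ?B * e i (\<lambda>i. f i / ?B)) \<longlongrightarrow> ?B * l (\<lambda>i. f i / ?B)) U"
      by (intro tendsto_intros lim_e)
    moreover have "\<forall>\<^sub>F i in U. ?B * e i (\<lambda>i. f i / ?B) = f i"
      using f
    proof eventually_elim
      fix i assume "\<bar>f i\<bar> \<le> B"
      then have "\<bar>f i / ?B\<bar> \<le> 1"
        by (simp add: abs_divide divide_le_eq le_max_iff_disj)
      then have "-1 \<le> f i / ?B" "f i / ?B \<le> 1"
        by linarith+
      then show "?B * e i (\<lambda>i. f i / ?B) = f i"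
        by (simp add: e_def)
    qed
    ultimately show ?thesis
      by (blast intro: Lim_transform_eventually)
  qed
  with nonbot have "limit_filter U" by (auto simp: limit_filter_def)
  moreover have "U \<le> F" by (simp add: U_def)
  ultimately show ?thesis using that by blast
qed

section \<open>Seminorms and spreading models\<close>

locale seminorm =
  fixes p :: "'v::real_vector \<Rightarrow> real"
  assumes scale: "p (c *\<^sub>R x) = \<bar>c\<bar> * p x"
    and triangle: "p (x + y) \<le> p x + p y"
begin

lemma zero [simp]: "p 0 = 0"
  using scale[of 0 0] by simp

lemma minus: "p (- x) = p x"
  using scale[of "-1" x] by simp

lemma nonneg [simp]: "0 \<le> p x"
  using triangle[of x "- x"] by (simp add: minus)

lemma diff: "p (x - y) = p (y - x)"
  using minus[of "x - y"] by simp

lemma abs_diff_le: "\<bar>p x - p y\<bar> \<le> p (x - y)"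
  using triangle[of "x - y" y] triangle[of "y - x" x] by (simp add: diff[of y x])

lemma sum_le: "p (\<Sum>i\<in>A. c i *\<^sub>R f i) \<le> (\<Sum>i\<in>A. \<bar>c i\<bar> * p (f i))"
proof (induction A rule: infinite_finite_induct)
  case (insert a A)
  then show ?case
    using triangle[of "c a *\<^sub>R f a" "\<Sum>i\<in>A. c i *\<^sub>R f i"] by (simp add: scale)
qed simp_all

lemma subspace_null: "subspace {x. p x = 0}"
proof (rule subspaceI)
  fix x y assume "x \<in> {x. p x = 0}" "y \<in> {x. p x = 0}"
  then show "x + y \<in> {x. p x = 0}"
    using triangle[of x y] nonneg[of "x + y"] by simp
qed (simp_all add: scale)

end

lemma seminorm_compose:
  assumes "seminorm p" "linear S"
  shows "seminorm (\<lambda>x. p (S x))"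
proof -
  interpret seminorm p by fact
  show ?thesis
    by unfold_locales (simp_all add: assms(2) linear_scale linear_add scale triangle)
qed

lemma seminorm_Lim:
  assumes U: "limit_filter U" and p: "\<And>i. seminorm (p i)"
    and lim: "\<And>x. ((\<lambda>i. p i x) \<longlongrightarrow> q x) U"
  shows "seminorm q"
proof
  note nb = limit_filter_nonbot[OF U]
  fix c x y
  have "((\<lambda>i. p i (c *\<^sub>R x)) \<longlongrightarrow> \<bar>c\<bar> * q x) U"
    using tendsto_mult_left[OF lim[of x], of "\<bar>c\<bar>"] seminorm.scale[OF p] by simp
  with lim[of "c *\<^sub>R x"] show "q (c *\<^sub>R x) = \<bar>c\<bar> * q x"
    using tendsto_unique[OF nb] by blast
  show "q (x + y) \<le> q x + q y"
    by (rule tendsto_le[OF nb tendsto_add[OF lim lim] lim]) (simp add: seminorm.triangle[OF p])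
qed

text \<open>A bounded separated sequence exists whenever the space is infinite-dimensional.
  \<open>U \<le> sequentially\<close> places each further index of an iterated limit beyond the
  earlier ones, so that the separation survives in the limit.\<close>

locale spreading_model = seminorm p for p :: "'v::real_vector \<Rightarrow> real" +
  fixes U :: "nat filter" and y :: "nat \<Rightarrow> 'v" and d :: real
  assumes U: "limit_filter U" "U \<le> sequentially"
    and bounded: "p (y n) \<le> 1"
    and separated: "m < n \<Longrightarrow> d \<le> p (y m - y n)" and d_pos: "0 < d"
begin

text \<open>\<open>lam [c\<^sub>1, \<dots>, c\<^sub>r] v\<close> is the iterated limit over \<open>n\<^sub>1\<close>, \<open>n\<^sub>2\<close>, \<dots> of
  \<open>p (v + c\<^sub>1 y(n\<^sub>1) + \<dots> + c\<^sub>r y(n\<^sub>r))\<close>.\<close>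

fun lam :: "real list \<Rightarrow> 'v \<Rightarrow> real" where
  "lam [] v = p v"
| "lam (c # cs) v = Lim U (\<lambda>n. lam cs (v + c *\<^sub>R y n))"

declare lam.simps(2) [simp del]

text \<open>Bounds and convergence are proved together: the bounds for \<open>cs\<close> make the
  limit that defines \<open>lam (c # cs)\<close> exist, and its existence carries the bounds over to
  the longer list.\<close>

lemma lam_aux:
  "0 \<le> lam cs v \<and> lam cs v \<le> p v + sum_list (map abs cs) \<and>
   (\<forall>c. ((\<lambda>n. lam cs (v + c *\<^sub>R y n)) \<longlongrightarrow> lam (c # cs) v) U)"
proof (induction cs arbitrary: v)
  have le: "p (v + c *\<^sub>R y n) \<le> p v + \<bar>c\<bar>" for v c n
    using triangle[of v "c *\<^sub>R y n"] bounded[of n] mult_left_mono[of "p (y n)" 1 "\<bar>c\<bar>"]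
    by (simp add: scale)
  have lim: "((\<lambda>n. lam cs (v + c *\<^sub>R y n)) \<longlongrightarrow> lam (c # cs) v) U"
    if "\<And>v. 0 \<le> lam cs v \<and> lam cs v \<le> p v + sum_list (map abs cs)" for cs c v
  proof -
    have "\<bar>lam cs (v + c *\<^sub>R y n)\<bar> \<le> p v + \<bar>c\<bar> + sum_list (map abs cs)" for n
      using that[of "v + c *\<^sub>R y n"] le[of v c n] by linarith
    then show ?thesis
      unfolding lam.simps(2) by (intro limit_filter_tendsto_Lim[OF U(1)] always_eventually) blast
  qed
  {
    case Nil
    show ?case using lim[of "[]"] by auto
  next
    case (Cons c cs)
    have t: "((\<lambda>n. lam cs (v + c *\<^sub>R y n)) \<longlongrightarrow> lam (c # cs) v) U" for v
      using Cons by blast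
    have b: "0 \<le> lam (c # cs) v \<and> lam (c # cs) v \<le> p v + sum_list (map abs (c # cs))" for v
    proof
      show "0 \<le> lam (c # cs) v"
        by (rule tendsto_lowerbound[OF t]) (use Cons U in \<open>auto simp: limit_filter_nonbot\<close>)
      have "lam cs (v + c *\<^sub>R y n) \<le> p v + sum_list (map abs (c # cs))" for n
        using Cons[of "v + c *\<^sub>R y n"] le[of v c n] by simp
      then show "lam (c # cs) v \<le> p v + sum_list (map abs (c # cs))"
        by (intro tendsto_upperbound[OF t] always_eventually) (use U in \<open>auto simp: limit_filter_nonbot\<close>)
    qed
    then show ?case using lim[of "c # cs"] by blast
  }
qed

lemma lam_nonneg: "0 \<le> lam cs v"
  and lam_le: "lam cs v \<le> p v + sum_list (map abs cs)"
  and lam_tendsto: "((\<lambda>n. lam cs (v + c *\<^sub>R y n)) \<longlongrightarrow> lam (c # cs) v) U"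
  using lam_aux by blast+

lemma U_nonbot: "U \<noteq> bot"
  using U limit_filter_nonbot by blast

lemma lam_triangle:
  "length cs = length ds \<Longrightarrow> lam (map2 (+) cs ds) (v + w) \<le> lam cs v + lam ds w"
proof (induction cs ds arbitrary: v w rule: list_induct2)
  case (Cons c cs b ds)
  have "lam (map2 (+) cs ds) (v + w + (c + b) *\<^sub>R y n) \<le>
      lam cs (v + c *\<^sub>R y n) + lam ds (w + b *\<^sub>R y n)" for n
    using Cons.IH[of "v + c *\<^sub>R y n" "w + b *\<^sub>R y n"] by (simp add: algebra_simps)
  then show ?case
    using tendsto_le[OF U_nonbot tendsto_add[OF lam_tendsto lam_tendsto] lam_tendsto] by simp
qed (simp add: triangle)

lemma lam_scale: "lam (map ((*) c) cs) (c *\<^sub>R v) = \<bar>c\<bar> * lam cs v"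
proof (induction cs arbitrary: v)
  case (Cons b cs)
  have "lam (map ((*) c) cs) (c *\<^sub>R v + (c * b) *\<^sub>R y n) = \<bar>c\<bar> * lam cs (v + b *\<^sub>R y n)" for n
    using Cons[of "v + b *\<^sub>R y n"] by (simp add: scaleR_add_right)
  moreover have "((\<lambda>n. \<bar>c\<bar> * lam cs (v + b *\<^sub>R y n)) \<longlongrightarrow> \<bar>c\<bar> * lam (b # cs) v) U"
    by (rule tendsto_mult_left[OF lam_tendsto])
  ultimately show ?case
    using tendsto_unique[OF U_nonbot _ lam_tendsto[of "map ((*) c) cs" "c *\<^sub>R v" "c * b"]] by simp
qed (simp add: scale)

text \<open>A zero coefficient turns the limit into that of a constant. Hence zeros can be inserted
  and deleted freely, which is the spreading property.\<close>

lemma lam_0_Cons: "lam (0 # cs) v = lam cs v"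
  using tendsto_unique[OF U_nonbot lam_tendsto[of cs v 0]] tendsto_const by fastforce

lemma lam_filter: "lam (filter (\<lambda>c. c \<noteq> 0) cs) v = lam cs v"
proof (induction cs arbitrary: v)
  case (Cons c cs)
  have "(\<lambda>n. lam (filter (\<lambda>c. c \<noteq> 0) cs) (v + c *\<^sub>R y n)) = (\<lambda>n. lam cs (v + c *\<^sub>R y n))"
    using Cons by blast
  then show ?case
    using lam_0_Cons Cons by (cases "c = 0") (simp_all add: lam.simps(2)[of c])
qed simp

lemma lam_eq_filter:
  "filter (\<lambda>c. c \<noteq> 0) cs = filter (\<lambda>c. c \<noteq> 0) ds \<Longrightarrow> lam cs v = lam ds v"
  by (metis lam_filter)

text \<open>Finite representability of the spreading model. One choice of indices serves all pairs
  in \<open>S\<close>: the outermost limit is met up to \<open>e / 2\<close> by an index good for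
  all of them, and the other half of the error is left for the remaining limits. The common length
  \<open>r\<close> lets the pairs share these indices.\<close>

lemma lam_approx:
  assumes "finite S" "\<And>cs v. (cs, v) \<in> S \<Longrightarrow> length cs = r" "0 < e"
  shows "\<exists>ns. \<forall>(cs, v)\<in>S. \<bar>lam cs v - p (v + (\<Sum>l<r. (cs ! l) *\<^sub>R y (ns l)))\<bar> < e"
  using assms
proof (induction r arbitrary: S e)
  case 0
  then show ?case by fastforce
next
  case (Suc r)
  define step where "step n = (\<lambda>(cs, v). (tl cs, v + hd cs *\<^sub>R y n))" for n
  have ev: "\<forall>\<^sub>F n in U. \<forall>z\<in>S. \<bar>lam (fst z) (snd z) - lam (fst (step n z)) (snd (step n z))\<bar> < e / 2"
  proof (intro eventually_ball_finite ballI Suc.prems(1))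
    fix z assume z: "z \<in> S"
    obtain cs v where zcv: "z = (cs, v)" by force
    with z Suc.prems(2) have "length cs = Suc r" by blast
    then obtain c cs' where cs: "cs = c # cs'" by (cases cs) auto
    have "\<forall>\<^sub>F n in U. dist (lam cs' (v + c *\<^sub>R y n)) (lam (c # cs') v) < e / 2"
      using tendstoD[OF lam_tendsto] Suc.prems(3) half_gt_zero by blast
    then show "\<forall>\<^sub>F n in U. \<bar>lam (fst z) (snd z) - lam (fst (step n z)) (snd (step n z))\<bar> < e / 2"
      by (rule eventually_mono) (simp add: zcv cs step_def dist_real_def abs_minus_commute)
  qed
  then obtain n where n: "\<forall>z\<in>S. \<bar>lam (fst z) (snd z) - lam (fst (step n z)) (snd (step n z))\<bar> < e / 2"
    using eventually_happens[OF ev] U_nonbot by auto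
  have "\<exists>ns. \<forall>(cs, v)\<in>step n ` S. \<bar>lam cs v - p (v + (\<Sum>l<r. (cs ! l) *\<^sub>R y (ns l)))\<bar> < e / 2"
  proof (rule Suc.IH)
    fix cs v assume "(cs, v) \<in> step n ` S"
    then show "length cs = r"
      using Suc.prems(2) by (force simp: step_def)
  qed (use Suc.prems in auto)
  then obtain ns where ns: "\<And>z. z \<in> S \<Longrightarrow>
      \<bar>lam (fst (step n z)) (snd (step n z)) -
        p (snd (step n z) + (\<Sum>l<r. (fst (step n z) ! l) *\<^sub>R y (ns l)))\<bar> < e / 2"
    by fastforce
  have "\<bar>lam cs v - p (v + (\<Sum>l<Suc r. (cs ! l) *\<^sub>R y (case_nat n ns l)))\<bar> < e" if z: "(cs, v) \<in> S" for cs v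
  proof -
    have "length cs = Suc r" using z Suc.prems(2) by blast
    then obtain c cs' where cs: "cs = c # cs'" by (cases cs) auto
    have eq: "v + (\<Sum>l<Suc r. (cs ! l) *\<^sub>R y (case_nat n ns l)) =
        v + c *\<^sub>R y n + (\<Sum>l<r. (cs' ! l) *\<^sub>R y (ns l))"
      by (simp add: cs sum.lessThan_Suc_shift del: sum.lessThan_Suc)
    have "\<bar>lam cs v - lam cs' (v + c *\<^sub>R y n)\<bar> < e / 2"
      using n z by (fastforce simp: step_def cs)
    moreover have "\<bar>lam cs' (v + c *\<^sub>R y n) - p (v + c *\<^sub>R y n + (\<Sum>l<r. (cs' ! l) *\<^sub>R y (ns l)))\<bar> < e / 2"
      using ns[OF z] by (simp add: step_def cs)
    ultimately show ?thesis unfolding eq by linarith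
  qed
  then show ?case by blast
qed

lemma map2_add_self: "map2 (+) cs cs = map ((*) (2::real)) cs"
  by (induction cs) auto

text \<open>By spreading, \<open>[b, - b, 0]\<close> and \<open>[0, b, - b]\<close> give the same
  value, and their mean is \<open>[b / 2, 0, - b / 2]\<close>, the middle entries
  cancelling.\<close>

lemma lam_halve: "lam (A @ [b / 2, - b / 2] @ C) v \<le> lam (A @ [b, - b] @ C) v"
proof -
  let ?L = "A @ [b, - b, 0] @ C" and ?R = "A @ [0, b, - b] @ C"
  have "map2 (+) ?L ?R = map ((*) 2) (A @ [b / 2, 0, - b / 2] @ C)"
    by (simp add: map2_add_self)
  moreover have "lam (map2 (+) ?L ?R) (v + v) \<le> lam ?L v + lam ?R v"
    by (rule lam_triangle) simp
  moreover have "v + v = 2 *\<^sub>R v" by (simp add: scaleR_2)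
  ultimately have "2 * lam (A @ [b / 2, 0, - b / 2] @ C) v \<le> lam ?L v + lam ?R v"
    using lam_scale[of 2 "A @ [b / 2, 0, - b / 2] @ C" v] by simp
  moreover have "lam ?L v = lam (A @ [b, - b] @ C) v" "lam ?R v = lam (A @ [b, - b] @ C) v"
    "lam (A @ [b / 2, 0, - b / 2] @ C) v = lam (A @ [b / 2, - b / 2] @ C) v"
    by (rule lam_eq_filter; simp)+
  ultimately show ?thesis by simp
qed

text \<open>Repeated halving replaces \<open>b\<close> by \<open>b / 2 ^ k\<close> without
  increasing the value, and deleting a pair that small costs at most
  \<open>2 * \<bar>b\<bar> / 2 ^ k\<close>.\<close>

lemma lam_suppress: "lam (A @ [0, 0] @ C) v \<le> lam (A @ [b, - b] @ C) v"
proof -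
  have h: "lam (A @ [b / 2 ^ k, - (b / 2 ^ k)] @ C) v \<le> lam (A @ [b, - b] @ C) v" for k
  proof (induction k)
    case (Suc k)
    show ?case
      using lam_halve[of A "b / 2 ^ k" C v] Suc by (simp add: field_simps)
  qed simp
  have "lam (A @ [0, 0] @ C) v \<le> lam (A @ [b, - b] @ C) v + 2 * \<bar>b\<bar> / 2 ^ k" for k
  proof -
    let ?t = "b / 2 ^ k"
    let ?Z = "replicate (length A) 0 @ [- ?t, ?t] @ replicate (length C) 0"
    have z: "map2 (+) xs (replicate (length xs) 0) = xs" for xs :: "real list"
      by (induction xs) auto
    have "map2 (+) (A @ [?t, - ?t] @ C) ?Z = A @ [0, 0] @ C"
      by (simp add: z)
    moreover have "lam (map2 (+) (A @ [?t, - ?t] @ C) ?Z) (v + 0) \<le> lam (A @ [?t, - ?t] @ C) v + lam ?Z 0"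
      by (rule lam_triangle) simp
    moreover have "lam ?Z 0 \<le> 2 * \<bar>b\<bar> / 2 ^ k"
      using lam_le[of ?Z 0] by (simp add: sum_list_replicate abs_divide)
    ultimately show ?thesis using h[of k] by simp
  qed
  moreover have "(\<lambda>k. lam (A @ [b, - b] @ C) v + 2 * \<bar>b\<bar> / 2 ^ k) \<longlonglongrightarrow> lam (A @ [b, - b] @ C) v + 0"
    by (intro tendsto_intros LIMSEQ_divide_realpow_zero) simp
  ultimately show ?thesis
    using tendsto_lowerbound[of _ _ sequentially] by (metis (no_types, lifting) add.right_neutral always_eventually sequentially_bot)
qed

text \<open>By convexity: the shrunken pair is a convex combination of \<open>[b, - b]\<close> and
  \<open>[0, 0]\<close>, and neither end exceeds the right-hand side.\<close>

lemma lam_shrink: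
  assumes "0 \<le> t" "t \<le> 1"
  shows "lam (A @ [t * b, - (t * b)] @ C) v \<le> lam (A @ [b, - b] @ C) v"
proof -
  let ?L = "map ((*) t) (A @ [b, - b] @ C)" and ?R = "map ((*) (1 - t)) (A @ [0, 0] @ C)"
  have z: "map2 (+) (map ((*) t) xs) (map ((*) (1 - t)) xs) = xs" for xs :: "real list"
    by (induction xs) (auto simp: algebra_simps)
  have "map2 (+) ?L ?R = A @ [t * b, - (t * b)] @ C"
    by (simp add: z)
  moreover have "lam (map2 (+) ?L ?R) (t *\<^sub>R v + (1 - t) *\<^sub>R v) \<le> lam ?L (t *\<^sub>R v) + lam ?R ((1 - t) *\<^sub>R v)"
    by (rule lam_triangle) simp
  moreover have "t *\<^sub>R v + (1 - t) *\<^sub>R v = v"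
    by (simp flip: scaleR_add_left)
  ultimately have "lam (A @ [t * b, - (t * b)] @ C) v \<le>
      t * lam (A @ [b, - b] @ C) v + (1 - t) * lam (A @ [0, 0] @ C) v"
    using assms unfolding lam_scale by simp
  also have "\<dots> \<le> t * lam (A @ [b, - b] @ C) v + (1 - t) * lam (A @ [b, - b] @ C) v"
    using assms by (intro add_left_mono mult_left_mono lam_suppress) auto
  finally show ?thesis by (simp add: algebra_simps)
qed

text \<open>\<open>D n a\<close> is the norm of \<open>\<Sum>i<n. a i * u i\<close> for the differences \<open>u i\<close> of consecutive
  basis vectors of the spreading model; these form an unconditional spreading sequence.\<close>

definition dbl :: "(nat \<Rightarrow> real) \<Rightarrow> nat list \<Rightarrow> real list" where
  "dbl a is = concat (map (\<lambda>i. [a i, - a i]) is)"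

definition D :: "nat \<Rightarrow> (nat \<Rightarrow> real) \<Rightarrow> real" where
  "D n a = lam (dbl a [0..<n]) 0"

lemma dbl_simps [simp]: "dbl a [] = []" "dbl a (i # is) = a i # - a i # dbl a is"
  "dbl a (is @ js) = dbl a is @ dbl a js"
  by (simp_all add: dbl_def)

lemma length_dbl [simp]: "length (dbl a is) = 2 * length is"
  by (induction "is") auto

lemma dbl_add: "dbl (\<lambda>i. a i + b i) is = map2 (+) (dbl a is) (dbl b is)"
  by (induction "is") auto

lemma dbl_scale: "dbl (\<lambda>i. c * a i) is = map ((*) c) (dbl a is)"
  by (induction "is") auto

lemma D_cong: "(\<And>i. i < n \<Longrightarrow> a i = b i) \<Longrightarrow> D n a = D n b"
  unfolding D_def dbl_def by (intro arg_cong2[of _ _ _ _ lam] arg_cong[of _ _ concat] map_cong) auto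

lemma D_nonneg: "0 \<le> D n a"
  by (simp add: D_def lam_nonneg)

lemma D_triangle: "D n (\<lambda>i. a i + b i) \<le> D n a + D n b"
  unfolding D_def dbl_add using lam_triangle[of "dbl a [0..<n]" "dbl b [0..<n]" 0 0] by simp

lemma D_scale: "D n (\<lambda>i. c * a i) = \<bar>c\<bar> * D n a"
  unfolding D_def dbl_scale using lam_scale[of c "dbl a [0..<n]" 0] by simp

lemma D_sum_le: "D n (\<lambda>i. \<Sum>k\<in>A. f k i) \<le> (\<Sum>k\<in>A. D n (f k))"
proof (induction A rule: infinite_finite_induct)
  case (insert k A)
  then show ?case using D_triangle[of n "f k" "\<lambda>i. \<Sum>k\<in>A. f k i"] by simp
qed (use D_scale[of n 0 "\<lambda>_. 0"] in simp_all)

lemma D_shrink_one: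
  assumes "0 \<le> t" "t \<le> 1" "i < n"
  shows "D n (a(i := t * a i)) \<le> D n a"
proof -
  have split: "[0..<n] = [0..<i] @ [i] @ [Suc i..<n]"
    using assms(3) by (metis append_Cons append_Nil less_imp_le_nat upt_add_eq_append upt_conv_Cons le0 le_Suc_ex)
  have c: "dbl (a(i := x)) is = dbl a is" if "i \<notin> set is" for "is" x
    using that by (induction "is") auto
  show ?thesis
    unfolding D_def split using lam_shrink[OF assms(1,2), of "dbl a [0..<i]" "a i" "dbl a [Suc i..<n]" 0]
    by (simp add: c)
qed

lemma D_shrink:
  assumes "\<And>i. i < n \<Longrightarrow> 0 \<le> t i \<and> t i \<le> 1"
  shows "D n (\<lambda>i. t i * a i) \<le> D n a"
proof -
  have "D n (\<lambda>i. if i < k then t i * a i else a i) \<le> D n a" if "k \<le> n" for k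
    using that
  proof (induction k)
    case (Suc k)
    let ?f = "\<lambda>i. if i < k then t i * a i else a i"
    have "(\<lambda>i. if i < Suc k then t i * a i else a i) = ?f(k := t k * ?f k)"
      by (auto simp: fun_eq_iff less_Suc_eq)
    then show ?case
      using D_shrink_one[of "t k" k n ?f] Suc assms by auto
  qed simp
  from this[of n] have "D n (\<lambda>i. if i < n then t i * a i else a i) \<le> D n a"
    by simp
  moreover have "D n (\<lambda>i. if i < n then t i * a i else a i) = D n (\<lambda>i. t i * a i)"
    by (rule D_cong) simp
  ultimately show ?thesis by simp
qed

text \<open>Splitting the ratio \<open>a i / b i\<close> by its sign gives two families of
  multipliers in \<open>[0, 1]\<close>, each handled by \<open>D_shrink\<close>; the factor 2 is the
  price of the signs.\<close>

lemma D_mono2: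
  assumes "\<And>i. i < n \<Longrightarrow> \<bar>a i\<bar> \<le> \<bar>b i\<bar>"
  shows "D n a \<le> 2 * D n b"
proof -
  define t where "t i = \<bar>a i\<bar> / \<bar>b i\<bar>" for i
  define a1 where "a1 i = (if a i * b i \<ge> 0 then t i else 0)" for i
  define a2 where "a2 i = (if a i * b i \<ge> 0 then 0 else t i)" for i
  have t: "0 \<le> t i \<and> t i \<le> 1" if "i < n" for i
    using assms[OF that] by (auto simp: t_def divide_le_eq)
  have eq: "a i = a1 i * b i + (-1) * (a2 i * b i)" if "i < n" for i
  proof (cases "b i = 0")
    case True
    then show ?thesis using assms[OF that] by simp
  qed (simp add: a1_def a2_def t_def abs_if zero_le_mult_iff field_simps)
  have "D n a = D n (\<lambda>i. a1 i * b i + (-1) * (a2 i * b i))"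
    by (rule D_cong) (rule eq)
  also have "\<dots> \<le> D n (\<lambda>i. a1 i * b i) + D n (\<lambda>i. (-1) * (a2 i * b i))"
    by (rule D_triangle)
  also have "D n (\<lambda>i. (-1) * (a2 i * b i)) = D n (\<lambda>i. a2 i * b i)"
    unfolding D_scale by simp
  also have "D n (\<lambda>i. a1 i * b i) + D n (\<lambda>i. a2 i * b i) \<le> D n b + D n b"
    by (intro add_mono D_shrink) (use t in \<open>auto simp: a1_def a2_def\<close>)
  finally show ?thesis by simp
qed

text \<open>The fundamental function of the sequence of differences. Its growth decides how
  Euclidean subspaces are found.\<close>

definition fund :: "nat \<Rightarrow> real" where
  "fund n = D n (\<lambda>_. 1)"

text \<open>By spreading, the positions of the nonzero coefficients do not matter, only their
  number.\<close>

lemma D_indicator: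
  "D n (\<lambda>i. of_bool (P i)) = fund (card {i. i < n \<and> P i})"
proof -
  have f: "filter (\<lambda>c. c \<noteq> 0) (dbl (\<lambda>i. of_bool (P i)) is) =
      concat (replicate (length (filter P is)) [1, - 1])" for "is"
    by (induction "is") auto
  have one: "dbl (\<lambda>_. 1) is = concat (replicate (length is) [1, - 1])" for "is"
    by (induction "is") auto
  have "length (filter P [0..<n]) = card {i. i < n \<and> P i}"
    unfolding length_filter_conv_card by (intro arg_cong[of _ _ card]) auto
  then show ?thesis
    unfolding D_def fund_def one by (metis f lam_filter length_upt minus_nat.diff_0)
qed

lemma fund_mono: "m \<le> n \<Longrightarrow> fund m \<le> fund n"
proof -
  assume mn: "m \<le> n"
  have "{i. i < n \<and> i < m} = {..<m}" using mn by auto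
  then have "fund m = D n (\<lambda>i. of_bool (i < m) * 1)"
    using D_indicator[of n "\<lambda>i. i < m"] by simp
  also have "\<dots> \<le> D n (\<lambda>_. 1)" by (rule D_shrink) auto
  finally show ?thesis by (simp add: fund_def)
qed

lemma D_block:
  assumes "l < k"
  shows "D (k * n) (\<lambda>i. of_bool (i div n = l)) = fund n"
proof -
  have "{i. i < k * n \<and> i div n = l} = {l * n..<l * n + n}"
  proof (cases "n = 0")
    case False
    have "i < k * n" if "i < l * n + n" for i
    proof -
      have "l * n + n = Suc l * n" by simp
      also have "\<dots> \<le> k * n" using assms by (intro mult_right_mono) auto
      finally show ?thesis using that by linarith
    qed
    moreover have "i div n = l \<longleftrightarrow> l * n \<le> i \<and> i < l * n + n" for i
    proof
      assume "i div n = l"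
      then have "l * n + i mod n = i" using div_mult_mod_eq by blast
      moreover have "i mod n < n" using False by simp
      ultimately show "l * n \<le> i \<and> i < l * n + n" by linarith
    next
      assume "l * n \<le> i \<and> i < l * n + n"
      then show "i div n = l" by (intro div_nat_eqI) (auto simp: mult.commute)
    qed
    ultimately have "i < k * n \<and> i div n = l \<longleftrightarrow> l * n \<le> i \<and> i < l * n + n" for i
      by blast
    then show ?thesis
      by (simp add: set_eq_iff)
  qed auto
  then show ?thesis by (simp add: D_indicator)
qed

lemma fund_mult_le: "fund (k * n) \<le> k * fund n"
proof -
  have "D (k * n) (\<lambda>i. \<Sum>l<k. of_bool (i div n = l)) \<le> (\<Sum>l<k. D (k * n) (\<lambda>i. of_bool (i div n = l)))"
    by (rule D_sum_le)
  also have "\<dots> = k * fund n"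
    using D_block[of _ k n] by simp
  also have "D (k * n) (\<lambda>i. \<Sum>l<k. of_bool (i div n = l)) = fund (k * n)"
    unfolding fund_def
  proof (rule D_cong)
    fix i assume "i < k * n"
    then have "i div n < k" by (simp add: less_mult_imp_div_less)
    then show "(\<Sum>l<k. of_bool (i div n = l)) = (1::real)"
      by (simp add: of_bool_def)
  qed
  finally show ?thesis .
qed

text \<open>Passing twice to the limit in the separation inequality bounds \<open>fund 1\<close>
  from below; the inner index is eventually beyond the fixed outer one.\<close>

lemma fund_pos: "0 < n \<Longrightarrow> d \<le> fund n"
proof -
  assume "0 < n"
  have 1: "d \<le> lam [-1] (y m)" for m
  proof (rule tendsto_lowerbound[OF lam_tendsto])
    have "\<forall>\<^sub>F n in sequentially. m < n" by (rule eventually_gt_at_top)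
    then have "\<forall>\<^sub>F n in U. m < n" using U(2) by (simp add: le_filter_def)
    then show "\<forall>\<^sub>F n in U. d \<le> lam [] (y m + - 1 *\<^sub>R y n)"
      by (rule eventually_mono) (use separated in simp)
  qed (rule U_nonbot)
  have "d \<le> lam [1, -1] 0"
    by (rule tendsto_lowerbound[OF lam_tendsto]) (use 1 U_nonbot in auto)
  also have "\<dots> = fund 1" by (simp add: fund_def D_def)
  also have "\<dots> \<le> fund n" using \<open>0 < n\<close> by (intro fund_mono) simp
  finally show ?thesis .
qed

end

section \<open>Hilbert spaces in spreading models\<close>

definition signs :: "nat \<Rightarrow> (nat \<Rightarrow> real) set" where
  "signs m = (\<Pi>\<^sub>E i\<in>{..<m}. {-1, 1})"

lemma finite_signs [simp]: "finite (signs m)"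
  by (simp add: signs_def finite_PiE)

lemma card_signs: "card (signs m) = 2 ^ m"
  by (simp add: signs_def card_PiE numeral_2_eq_2)

lemma signs_abs: "s \<in> signs m \<Longrightarrow> i < m \<Longrightarrow> \<bar>s i\<bar> = 1"
  by (force simp: signs_def PiE_def Pi_def)

text \<open>Independence of the coordinates of a random sign vector, without the normalisation by
  \<open>2 ^ m\<close>.\<close>

lemma sum_signs_prod:
  "(\<Sum>s\<in>signs m. \<Prod>i<m. g i (s i)) = (\<Prod>i<m. g i (-1) + g i (1::real) :: real)"
  unfolding signs_def by (subst prod_sum_PiE[symmetric]) auto

lemma sum_signs_sq:
  "(\<Sum>s\<in>signs m. (\<Sum>i<m. b i * s i)\<^sup>2) = 2 ^ m * (\<Sum>i<m. (b i)\<^sup>2)"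
proof -
  have orth: "(\<Sum>s\<in>signs m. s i * s j) = (if i = j then 2 ^ m else 0)" if "i < m" "j < m" for i j
  proof (cases "i = j")
    case True
    have "(\<Sum>s\<in>signs m. s i * s j) = (\<Sum>s\<in>signs m. 1)"
      using signs_abs that True by (intro sum.cong refl) (metis abs_mult_self_eq mult.right_neutral)
    then show ?thesis by (simp add: True card_signs)
  next
    case False
    have "(\<Sum>s\<in>signs m. s i * s j) = (\<Sum>s\<in>signs m. \<Prod>k<m. if k = i \<or> k = j then s k else 1)"
    proof (intro sum.cong refl)
      fix s :: "nat \<Rightarrow> real"
      have "(\<Prod>k<m. if k = i \<or> k = j then s k else 1) = (\<Prod>k\<in>{i, j}. s k)"
        using that by (intro prod.mono_neutral_cong_right) auto
      then show "s i * s j = (\<Prod>k<m. if k = i \<or> k = j then s k else 1)"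
        using False by simp
    qed
    also have "\<dots> = (\<Prod>k<m. (if k = i \<or> k = j then - 1 else 1) + (if k = i \<or> k = j then 1 else 1))"
      by (rule sum_signs_prod)
    also have "\<dots> = 0"
      using that by (intro prod_zero) auto
    finally show ?thesis using False by simp
  qed
  have "(\<Sum>s\<in>signs m. (\<Sum>i<m. b i * s i)\<^sup>2) = (\<Sum>s\<in>signs m. \<Sum>i<m. \<Sum>j<m. b i * b j * (s i * s j))"
    by (simp add: power2_eq_square sum_product mult.assoc mult.left_commute)
  also have "\<dots> = (\<Sum>i<m. \<Sum>s\<in>signs m. \<Sum>j<m. b i * b j * (s i * s j))"
    by (rule sum.swap)
  also have "\<dots> = (\<Sum>i<m. \<Sum>j<m. \<Sum>s\<in>signs m. b i * b j * (s i * s j))"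
    by (intro sum.cong refl sum.swap)
  also have "\<dots> = (\<Sum>i<m. \<Sum>j<m. if i = j then b i * b j * 2 ^ m else 0)"
    by (intro sum.cong refl) (simp add: orth flip: sum_distrib_left)
  also have "\<dots> = 2 ^ m * (\<Sum>i<m. (b i)\<^sup>2)"
    by (simp add: sum.delta' power2_eq_square sum_distrib_left algebra_simps)
  finally show ?thesis .
qed

text \<open>A subgaussian estimate for a single sign. On \<open>[0, 1]\<close> it follows from
  \<open>exp x \<le> 1 + x + x\<^sup>2\<close> and \<open>exp (- x) \<le> 1 - x + x\<^sup>2\<close>,
  whose linear terms cancel in the sum.\<close>

lemma exp_pair_le:
  fixes x :: real
  assumes "\<bar>x\<bar> \<le> 1"
  shows "exp x + exp (- x) \<le> 2 * exp (x\<^sup>2)"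
proof -
  have *: "exp x + exp (- x) \<le> 2 * exp (x\<^sup>2)" if "0 \<le> x" "x \<le> 1" for x :: real
  proof -
    have "0 \<le> x ^ 2" "0 \<le> x ^ 3" "0 \<le> x ^ 4" using that by auto
    \<comment> \<open>The product exceeds 1 by half of \<open>x ^ 2 + x ^ 3 + x ^ 4\<close>.\<close>
    then have "1 \<le> (1 - x + x\<^sup>2) * (1 + x + x\<^sup>2 / 2)"
      by (simp add: field_simps power2_eq_square power3_eq_cube power4_eq_xxxx)
    also have "\<dots> \<le> (1 - x + x\<^sup>2) * exp x"
      using that by (intro mult_left_mono exp_lower_Taylor_quadratic) auto
    finally have "exp (- x) \<le> 1 - x + x\<^sup>2"
      by (simp add: exp_minus field_simps)
    moreover have "exp x \<le> 1 + x + x\<^sup>2" using that by (rule exp_bound)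
    moreover have "1 + x\<^sup>2 \<le> exp (x\<^sup>2)" by (rule exp_ge_add_one_self)
    ultimately show ?thesis by linarith
  qed
  show ?thesis
    using *[of x] *[of "- x"] assms by (cases "0 \<le> x") auto
qed

text \<open>\<open>exp \<bar>t\<bar> \<le> exp t + exp (- t)\<close> removes the absolute value.
  Each of the two exponential moments factors over the coordinates, and \<open>exp_pair_le\<close>
  bounds the product by \<open>2 ^ m * exp 1\<close>.\<close>

lemma sum_signs_exp_abs:
  assumes "(\<Sum>i<m. (b i)\<^sup>2) = 1"
  shows "(\<Sum>s\<in>signs m. exp \<bar>\<Sum>i<m. b i * s i\<bar>) \<le> 2 * exp 1 * 2 ^ m"
proof -
  have b1: "\<bar>b i\<bar> \<le> 1" if "i < m" for i
  proof -
    have "(b i)\<^sup>2 \<le> (\<Sum>i<m. (b i)\<^sup>2)" using that by (intro member_le_sum) auto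
    then show ?thesis using assms by (simp add: abs_square_le_1)
  qed
  have e: "(\<Sum>s\<in>signs m. exp (\<Sum>i<m. c i * s i)) \<le> exp 1 * 2 ^ m"
    if c: "\<And>i. \<bar>c i\<bar> = \<bar>b i\<bar>" for c :: "nat \<Rightarrow> real"
  proof -
    have "(\<Sum>s\<in>signs m. exp (\<Sum>i<m. c i * s i)) = (\<Prod>i<m. exp (c i * -1) + exp (c i * 1))"
      using sum_signs_prod[of "\<lambda>i t. exp (c i * t)" m] by (simp add: exp_sum)
    also have "\<dots> \<le> (\<Prod>i<m. 2 * exp ((c i)\<^sup>2))"
    proof (rule prod_mono)
      fix i assume "i \<in> {..<m}"
      then show "0 \<le> exp (c i * -1) + exp (c i * 1) \<and> exp (c i * -1) + exp (c i * 1) \<le> 2 * exp ((c i)\<^sup>2)"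
        using exp_pair_le[of "c i"] b1[of i] c[of i] by (auto intro: add_nonneg_nonneg)
    qed
    also have "\<dots> = 2 ^ m * exp (\<Sum>i<m. (c i)\<^sup>2)"
      by (simp add: prod.distrib exp_sum)
    also have "(\<Sum>i<m. (c i)\<^sup>2) = (\<Sum>i<m. (b i)\<^sup>2)"
      by (intro sum.cong refl) (metis c power2_abs)
    finally show ?thesis by (simp add: assms mult.commute)
  qed
  have "(\<Sum>s\<in>signs m. exp \<bar>\<Sum>i<m. b i * s i\<bar>) \<le>
      (\<Sum>s\<in>signs m. exp (\<Sum>i<m. b i * s i) + exp (\<Sum>i<m. (- b i) * s i))"
    by (intro sum_mono) (auto simp: abs_if sum_negf add_increasing add_increasing2)
  also have "\<dots> \<le> exp 1 * 2 ^ m + exp 1 * 2 ^ m"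
    unfolding sum.distrib by (intro add_mono e) auto
  finally show ?thesis by simp
qed

text \<open>Markov's inequality for the exponential moment.\<close>

lemma signs_tail:
  assumes "(\<Sum>i<m. (b i)\<^sup>2) = 1"
  shows "card {s \<in> signs m. t \<le> \<bar>\<Sum>i<m. b i * s i\<bar>} * exp t \<le> 2 * exp 1 * 2 ^ m"
proof -
  let ?A = "{s \<in> signs m. t \<le> \<bar>\<Sum>i<m. b i * s i\<bar>}"
  have "card ?A * exp t = (\<Sum>s\<in>?A. exp t)" by simp
  also have "\<dots> \<le> (\<Sum>s\<in>?A. exp \<bar>\<Sum>i<m. b i * s i\<bar>)"
    by (intro sum_mono) auto
  also have "\<dots> \<le> (\<Sum>s\<in>signs m. exp \<bar>\<Sum>i<m. b i * s i\<bar>)"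
    by (intro sum_mono2) auto
  also have "\<dots> \<le> 2 * exp 1 * 2 ^ m" by (rule sum_signs_exp_abs[OF assms])
  finally show ?thesis .
qed

text \<open>A Paley--Zygmund argument: the fourth moment is controlled by the exponential one.\<close>

lemma signs_large:
  assumes "(\<Sum>i<m. (b i)\<^sup>2) = 1"
  shows "2 ^ m \<le> 6144 * card {s \<in> signs m. 1 / 2 \<le> \<bar>\<Sum>i<m. b i * s i\<bar>}"
proof -
  let ?f = "\<lambda>s. \<Sum>i<m. b i * s i"
  let ?A = "{s \<in> signs m. 1 / 2 \<le> \<bar>?f s\<bar>}"
  \<comment> \<open>This is \<open>\<bar>x\<bar> / 4 \<le> exp (\<bar>x\<bar> / 4)\<close> raised to
    the fourth power, with \<open>256 = 4 ^ 4\<close>.\<close>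
  have x4: "x ^ 4 \<le> 256 * exp \<bar>x\<bar>" for x :: real
  proof -
    have "(\<bar>x\<bar> / 4) ^ 4 \<le> (exp (\<bar>x\<bar> / 4)) ^ 4"
      using exp_ge_add_one_self[of "\<bar>x\<bar> / 4"] by (intro power_mono) linarith+
    also have "\<dots> = exp \<bar>x\<bar>" by (simp flip: exp_of_nat_mult)
    finally show ?thesis by (simp add: power_divide)
  qed
  have pt: "(?f s)\<^sup>2 \<le> 1 / 4 + exp \<bar>?f s\<bar> / 24 + 1536 * of_bool (s \<in> ?A)" if "s \<in> signs m" for s
  proof (cases "s \<in> ?A")
    case True
    \<comment> \<open>As 6144 is 24 times 256, the exponential moment, at most
      \<open>6 * 2 ^ m\<close>, accounts for a quarter of the second moment. Values below 1/2
      account for at most another quarter, so half of it is left for \<open>?A\<close>.\<close>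
    have "0 \<le> ((?f s)\<^sup>2 - 3072)\<^sup>2" by simp
    then have "(?f s)\<^sup>2 \<le> (?f s) ^ 4 / 6144 + 1536"
      by (simp add: power2_diff flip: power_mult)
    also have "(?f s) ^ 4 / 6144 \<le> exp \<bar>?f s\<bar> / 24" using x4[of "?f s"] by simp
    finally show ?thesis using True by simp
  next
    case False
    then have "\<bar>?f s\<bar> \<le> 1 / 2" using that by simp
    then have "\<bar>?f s\<bar>\<^sup>2 \<le> (1 / 2)\<^sup>2" by (intro power_mono) auto
    then have "(?f s)\<^sup>2 \<le> 1 / 4" unfolding power2_abs by (simp add: power2_eq_square)
    also have "\<dots> \<le> 1 / 4 + exp \<bar>?f s\<bar> / 24 + 1536 * of_bool (s \<in> ?A)"
      by simp
    finally show ?thesis .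
  qed
  have "2 ^ m = (\<Sum>s\<in>signs m. (?f s)\<^sup>2)"
    by (simp add: sum_signs_sq assms)
  also have "\<dots> \<le> (\<Sum>s\<in>signs m. 1 / 4 + exp \<bar>?f s\<bar> / 24 + 1536 * of_bool (s \<in> ?A))"
    by (rule sum_mono) (rule pt)
  also have "\<dots> = 2 ^ m / 4 + (\<Sum>s\<in>signs m. exp \<bar>?f s\<bar>) / 24 + 1536 * card ?A"
    by (simp add: sum.distrib card_signs sum_divide_distrib flip: sum_distrib_left)
      (simp add: Int_def)
  also have "(\<Sum>s\<in>signs m. exp \<bar>?f s\<bar>) \<le> 2 * exp 1 * 2 ^ m"
    by (rule sum_signs_exp_abs[OF assms])
  also have "2 * exp 1 * 2 ^ m \<le> 2 * 3 * (2 ^ m :: real)"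
    by (intro mult_right_mono mult_left_mono exp_le) auto
  finally have "real (2 ^ m) \<le> real (3072 * card ?A)" by simp
  then have "2 ^ m \<le> 3072 * card ?A" by (simp only: of_nat_le_iff)
  then show ?thesis by linarith
qed

text \<open>A finite part of the Euclidean unit ball that norms up to the factor 1/2. It is found by
  rounding the coordinates of unit vectors towards 0, which does not leave the ball.\<close>

lemma L2_grid:
  obtains Y :: "(nat \<Rightarrow> real) set" where "finite Y" "\<And>y. y \<in> Y \<Longrightarrow> L2_set y {..<m} \<le> 1"
    "\<And>b. \<exists>y\<in>Y. L2_set b {..<m} / 2 \<le> (\<Sum>i<m. b i * y i)"
proof -
  \<comment> \<open>Rounding to multiples of \<open>1 / M\<close> lowers the inner product by at
    most \<open>m / M\<close>, which is less than 1/2.\<close>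
  define M where "M = 2 * real m + 1"
  have M: "1 \<le> M" by (simp add: M_def)
  define Y where "Y = {y \<in> (\<Pi>\<^sub>E i\<in>{..<m}. (\<lambda>z. of_int z / M) ` {- \<lceil>M\<rceil>..\<lceil>M\<rceil>}). L2_set y {..<m} \<le> 1}"
  have unit: "\<exists>y\<in>Y. 1 / 2 \<le> (\<Sum>i<m. b i * y i)" if b: "L2_set b {..<m} = 1" for b
  proof -
    define t where "t i = sgn (b i) * of_int \<lfloor>M * \<bar>b i\<bar>\<rfloor> / M" for i
    have b1: "\<bar>b i\<bar> \<le> 1" if "i < m" for i
      using member_le_L2_set[of "{..<m}" i "\<lambda>i. \<bar>b i\<bar>"] that b by (simp add: L2_set_def)
    have fl: "0 \<le> of_int \<lfloor>M * \<bar>b i\<bar>\<rfloor> / M" "of_int \<lfloor>M * \<bar>b i\<bar>\<rfloor> / M \<le> \<bar>b i\<bar>"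
      "\<bar>b i\<bar> - 1 / M \<le> of_int \<lfloor>M * \<bar>b i\<bar>\<rfloor> / M" for i
    proof -
      show "0 \<le> of_int \<lfloor>M * \<bar>b i\<bar>\<rfloor> / M" using M by simp
      show "of_int \<lfloor>M * \<bar>b i\<bar>\<rfloor> / M \<le> \<bar>b i\<bar>"
        using M of_int_floor_le[of "M * \<bar>b i\<bar>"] by (simp add: divide_le_eq mult.commute)
      have "(M * \<bar>b i\<bar> - 1) / M \<le> of_int \<lfloor>M * \<bar>b i\<bar>\<rfloor> / M"
        using M by (intro divide_right_mono) linarith+
      then show "\<bar>b i\<bar> - 1 / M \<le> of_int \<lfloor>M * \<bar>b i\<bar>\<rfloor> / M"
        using M by (simp add: diff_divide_distrib)
    qed
    have abst: "\<bar>t i\<bar> \<le> \<bar>b i\<bar>" for i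
      using fl[of i] by (cases "b i = 0") (auto simp: t_def abs_mult abs_sgn_eq abs_divide)
    have bt: "(b i)\<^sup>2 - \<bar>b i\<bar> / M \<le> b i * t i" for i
    proof -
      have "(b i)\<^sup>2 - \<bar>b i\<bar> / M = \<bar>b i\<bar> * (\<bar>b i\<bar> - 1 / M)"
        by (simp add: power2_eq_square algebra_simps flip: abs_mult)
      also have "\<dots> \<le> \<bar>b i\<bar> * (of_int \<lfloor>M * \<bar>b i\<bar>\<rfloor> / M)"
        by (intro mult_left_mono fl) simp
      also have "\<dots> = b i * t i" by (simp add: t_def abs_sgn)
      finally show ?thesis .
    qed
    let ?y = "restrict t {..<m}"
    have "L2_set ?y {..<m} \<le> L2_set (\<lambda>i. \<bar>b i\<bar>) {..<m}"
      unfolding L2_set_def using abst by (intro real_sqrt_le_mono sum_mono) (auto simp: abs_le_square_iff)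
    then have "L2_set ?y {..<m} \<le> 1" using b by (simp add: L2_set_def)
    moreover have "?y i \<in> (\<lambda>z. of_int z / M) ` {- \<lceil>M\<rceil>..\<lceil>M\<rceil>}" if "i < m" for i
    proof -
      define z where "z = \<lfloor>M * \<bar>b i\<bar>\<rfloor>"
      have "0 \<le> z" using M by (simp add: z_def)
      moreover have "M * \<bar>b i\<bar> \<le> M" using b1[OF that] M by (simp add: mult_left_le)
      then have "z \<le> \<lceil>M\<rceil>" unfolding z_def by linarith
      ultimately have "(if b i = 0 then 0 else if b i > 0 then z else - z) \<in> {- \<lceil>M\<rceil>..\<lceil>M\<rceil>}"
        using M by auto
      then show ?thesis
        by (rule rev_image_eqI) (auto simp: t_def that z_def)
    qed
    ultimately have "?y \<in> Y" by (auto simp: Y_def)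
    moreover have "1 / 2 \<le> (\<Sum>i<m. b i * ?y i)"
    proof -
      have "(\<Sum>i<m. \<bar>b i\<bar> / M) \<le> (\<Sum>i<m. 1 / M)"
        using b1 M by (intro sum_mono divide_right_mono) auto
      also have "\<dots> \<le> 1 / 2" using M by (simp add: M_def field_simps)
      finally have "1 - 1 / 2 \<le> (\<Sum>i<m. (b i)\<^sup>2) - (\<Sum>i<m. \<bar>b i\<bar> / M)"
        using b by (simp add: L2_set_def)
      also have "\<dots> \<le> (\<Sum>i<m. b i * t i)"
        unfolding sum_subtractf[symmetric] by (intro sum_mono bt)
      finally show ?thesis by simp
    qed
    ultimately show ?thesis by blast
  qed
  have fin: "finite Y" unfolding Y_def by (simp add: finite_PiE)
  have "\<exists>y\<in>Y. L2_set b {..<m} / 2 \<le> (\<Sum>i<m. b i * y i)" if b0: "L2_set b {..<m} \<noteq> 0" for b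
  proof -
    let ?l = "L2_set b {..<m}"
    have l: "0 < ?l" using b0 L2_set_nonneg[of b "{..<m}"] by linarith
    have "L2_set (\<lambda>i. inverse ?l * b i) {..<m} = inverse ?l * ?l"
      using l L2_set_left_distrib[of "inverse ?l" b "{..<m}"]
        L2_set_right_distrib[of "inverse ?l" b "{..<m}"] by simp
    then have "L2_set (\<lambda>i. inverse ?l * b i) {..<m} = 1" using l by simp
    then obtain y where y: "y \<in> Y" "1 / 2 \<le> (\<Sum>i<m. inverse ?l * b i * y i)" using unit by blast
    have "(\<Sum>i<m. inverse ?l * b i * y i) = inverse ?l * (\<Sum>i<m. b i * y i)"
      by (simp add: sum_distrib_left mult.assoc)
    then have "1 / 2 \<le> inverse ?l * (\<Sum>i<m. b i * y i)"
      using y(2) by simp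
    then have "?l / 2 \<le> (\<Sum>i<m. b i * y i)"
      using l by (simp only: inverse_eq_divide) (simp add: pos_le_divide_eq mult.commute)
    then show ?thesis using y(1) by blast
  qed
  then have "\<exists>y\<in>insert (\<lambda>i. 0) Y. L2_set b {..<m} / 2 \<le> (\<Sum>i<m. b i * y i)" for b
    by (cases "L2_set b {..<m} = 0") auto
  then show ?thesis
    using fin by (intro that[of "insert (\<lambda>i. 0) Y"]) (auto simp: Y_def L2_set_def)
qed

context spreading_model
begin

text \<open>If \<open>fund\<close> hardly grows from \<open>N\<close> to \<open>k * N\<close>, the
  indicators of \<open>k\<close> consecutive blocks of length \<open>N\<close> behave like the unit
  vectors of k-dimensional l_infinity, and Euclidean space embeds there by its inner products with a
  norming grid. The constant 4 is 2 from \<open>D_mono2\<close> times 2 from the grid (below) or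
  from the slow growth (above).\<close>

lemma D_l_infinity:
  fixes m :: nat
  assumes "\<And>k. 2 \<le> k \<Longrightarrow> \<exists>N>0. fund (k * N) < 2 * fund N"
  shows "\<exists>n r. \<forall>b. L2_set b {..<m} \<le> 4 * D n (\<lambda>j. \<Sum>i<m. b i * r i j) \<and>
    D n (\<lambda>j. \<Sum>i<m. b i * r i j) \<le> 4 * L2_set b {..<m}"
proof -
  obtain Y where Y: "finite Y" "\<And>y. y \<in> Y \<Longrightarrow> L2_set y {..<m} \<le> 1"
    "\<And>b. \<exists>y\<in>Y. L2_set b {..<m} / 2 \<le> (\<Sum>i<m. b i * y i)"
    by (rule L2_grid[where m = m], rule that)
  obtain e where e: "bij_betw e {..<card Y} Y"
    using ex_bij_betw_nat_finite[OF Y(1)] by (auto simp: atLeast0LessThan)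
  define f where "f l = (if l < card Y then e l else (\<lambda>_. 0))" for l
  \<comment> \<open>The summand 2 secures \<open>2 \<le> k\<close>; the blocks from
    \<open>card Y\<close> on carry the zero function.\<close>
  define k where "k = card Y + 2"
  obtain N where N: "0 < N" "fund (k * N) < 2 * fund N"
    using assms[of k] by (auto simp: k_def)
  have fN: "0 < fund N" using fund_pos[OF N(1)] d_pos by linarith
  define r where "r i j = f (j div N) i / fund N" for i j
  have g: "(\<Sum>i<m. b i * r i j) = (\<Sum>i<m. b i * f (j div N) i) / fund N" for b j
    by (simp add: r_def sum_divide_distrib)
  have upper: "\<bar>\<Sum>i<m. b i * f l i\<bar> \<le> L2_set b {..<m}" for b l
  proof -
    have "\<bar>\<Sum>i<m. b i * f l i\<bar> \<le> (\<Sum>i<m. \<bar>b i\<bar> * \<bar>f l i\<bar>)"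
      unfolding abs_mult[symmetric] by (rule sum_abs)
    also have "\<dots> \<le> L2_set b {..<m} * L2_set (f l) {..<m}"
      by (rule L2_set_mult_ineq)
    also have "L2_set (f l) {..<m} \<le> 1"
      using Y(2) e by (auto simp: f_def bij_betw_def L2_set_def)
    finally show ?thesis by (simp add: mult_left_mono L2_set_nonneg)
  qed
  have "L2_set b {..<m} \<le> 4 * D (k * N) (\<lambda>j. \<Sum>i<m. b i * r i j)" for b
  proof -
    let ?l = "L2_set b {..<m}"
    obtain y where y: "y \<in> Y" "?l / 2 \<le> (\<Sum>i<m. b i * y i)" using Y(3) by blast
    obtain l where l: "l < card Y" "e l = y" using e y(1) by (force simp: bij_betw_def)
    have "?l / 2 = ?l / (2 * fund N) * D (k * N) (\<lambda>j. of_bool (j div N = l))"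
      using D_block[of l k N] l(1) fN by (simp add: k_def)
    also have "\<dots> = D (k * N) (\<lambda>j. ?l / (2 * fund N) * of_bool (j div N = l))"
      unfolding D_scale using fN by (simp add: L2_set_nonneg)
    also have "\<dots> \<le> 2 * D (k * N) (\<lambda>j. \<Sum>i<m. b i * r i j)"
    proof (rule D_mono2)
      fix j
      show "\<bar>?l / (2 * fund N) * of_bool (j div N = l)\<bar> \<le> \<bar>\<Sum>i<m. b i * r i j\<bar>"
        unfolding g using y(2) l fN L2_set_nonneg[of b "{..<m}"]
        by (auto simp: f_def abs_mult abs_divide field_simps)
    qed
    finally show ?thesis by simp
  qed
  moreover have "D (k * N) (\<lambda>j. \<Sum>i<m. b i * r i j) \<le> 4 * L2_set b {..<m}" for b
  proof -
    let ?l = "L2_set b {..<m}"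
    have "D (k * N) (\<lambda>j. \<Sum>i<m. b i * r i j) \<le> 2 * D (k * N) (\<lambda>j. ?l / fund N * 1)"
    proof (rule D_mono2)
      fix j
      show "\<bar>\<Sum>i<m. b i * r i j\<bar> \<le> \<bar>?l / fund N * 1\<bar>"
        unfolding g using upper[of b "j div N"] fN by (simp add: abs_divide divide_right_mono)
    qed
    also have "\<dots> = 2 * (?l / fund N) * fund (k * N)"
      unfolding D_scale using fN by (simp add: fund_def L2_set_nonneg)
    also have "\<dots> \<le> 2 * (?l / fund N) * (2 * fund N)"
      using N(2) fN by (intro mult_left_mono) (auto simp: L2_set_nonneg)
    finally show ?thesis using fN by simp
  qed
  ultimately show ?thesis by (intro exI allI conjI)
qed

text \<open>The coordinates are indexed by the \<open>2 ^ m\<close> sign vectors, and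
  \<open>b\<close> is sent to its Rademacher sum. For unit \<open>b\<close> a fixed proportion of
  the values is at least 1/2, which bounds the norm from below. For the upper bound the values are
  sliced at multiples of \<open>K\<close>: exponential tails make the slices so thin that the growth
  of \<open>fund\<close> turns their norms into a geometric series.\<close>

lemma D_rademacher:
  fixes m :: nat
  assumes K: "2 \<le> K" and growth: "\<And>N. 0 < N \<Longrightarrow> 2 * fund N \<le> fund (K * N)"
  shows "\<exists>n r. \<forall>b. L2_set b {..<m} \<le> 24576 * D n (\<lambda>j. \<Sum>i<m. b i * r i j) \<and>
    D n (\<lambda>j. \<Sum>i<m. b i * r i j) \<le> 10 * real K * L2_set b {..<m}"
proof -
  define n where "n = card (signs m)"
  have n: "n = 2 ^ m" by (simp add: n_def card_signs)
  obtain h where h: "bij_betw h {..<n} (signs m)"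
    using ex_bij_betw_nat_finite[OF finite_signs] by (auto simp: atLeast0LessThan n_def)
  have count: "card {j. j < n \<and> P (h j)} = card {s \<in> signs m. P s}" for P
  proof (rule bij_betw_same_card)
    show "bij_betw h {j. j < n \<and> P (h j)} {s \<in> signs m. P s}"
      using h by (auto simp: bij_betw_def inj_on_def image_iff set_eq_iff) blast
  qed
  have fn: "0 < fund n" using fund_pos[of n] d_pos by (simp add: n)
  have growth': "2 ^ s * fund N \<le> fund (K ^ s * N)" if "0 < N" for s N
  proof (induction s)
    case (Suc s)
    have "2 ^ Suc s * fund N \<le> 2 * fund (K ^ s * N)" using Suc by simp
    also have "\<dots> \<le> fund (K * (K ^ s * N))" using K that by (intro growth) auto
    finally show ?case by (simp add: mult.assoc)
  qed simp
  \<comment> \<open>The growth read backwards: a set smaller by the factor \<open>K ^ s\<close> has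
    an indicator smaller by the factor \<open>2 ^ s\<close>.\<close>
  have decay: "fund q \<le> fund n / 2 ^ s" if "real q * real K ^ s \<le> n" for q s
  proof (cases "q = 0")
    case True
    have "fund 0 = 0" using D_indicator[of 0 "\<lambda>_. True"] D_scale[of 0 0 "\<lambda>_. 1"] D_cong[of 0 "\<lambda>_. 1" "\<lambda>_. 0 * 1"]
      by (simp add: fund_def)
    then show ?thesis using fn True by simp
  next
    case False
    have "real (K ^ s * q) \<le> real n" using that by (simp add: mult.commute)
    then have "K ^ s * q \<le> n" by (simp only: of_nat_le_iff)
    then have "2 ^ s * fund q \<le> fund n"
      using growth'[of q s] fund_mono[of "K ^ s * q" n] False by simp
    then show ?thesis by (simp add: field_simps)
  qed
  define F where "F b j = (\<Sum>i<m. b i * h j i)" for b j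
  have norm1: "1 \<le> 24576 * (D n (F b) / fund n)" "D n (F b) / fund n \<le> 10 * K"
    if "L2_set b {..<m} = 1" for b
  proof -
    have b: "(\<Sum>i<m. (b i)\<^sup>2) = 1" using that by (simp add: L2_set_def)
    define q where "q t = card {j. j < n \<and> t \<le> \<bar>F b j\<bar>}" for t
    have q: "q t = card {s \<in> signs m. t \<le> \<bar>\<Sum>i<m. b i * s i\<bar>}" for t
      unfolding q_def F_def by (rule count)
    \<comment> \<open>The constant 24576 is 6144 times 2 for the height 1/2 and 2 for
      \<open>D_mono2\<close>.\<close>
    have "n \<le> 6144 * q (1 / 2)"
      using signs_large[OF b] by (simp add: n q)
    then have "fund n \<le> fund (6144 * q (1 / 2))" by (rule fund_mono)
    also have "\<dots> \<le> 6144 * fund (q (1 / 2))"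
      using fund_mult_le[of 6144 "q (1 / 2)"] by simp
    also have "fund (q (1 / 2)) = 2 * D n (\<lambda>j. 1 / 2 * of_bool (1 / 2 \<le> \<bar>F b j\<bar>))"
      unfolding D_scale q_def by (simp add: D_indicator)
    also have "D n (\<lambda>j. 1 / 2 * of_bool (1 / 2 \<le> \<bar>F b j\<bar>)) \<le> 2 * D n (F b)"
      by (rule D_mono2) auto
    finally show "1 \<le> 24576 * (D n (F b) / fund n)" using fn by (simp add: field_simps)
    \<comment> \<open>No value exceeds \<open>bound\<close>, so this many slices of height
      \<open>K\<close> suffice to majorise \<open>\<bar>F b j\<bar>\<close>.\<close>
    define bound where "bound = nat \<lceil>\<Sum>i<m. \<bar>b i\<bar>\<rceil>"
    define G where "G j = real K * (1 + (\<Sum>s<bound. of_bool (real K * (real s + 1) \<le> \<bar>F b j\<bar>)))" for j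
    have FG: "\<bar>F b j\<bar> \<le> G j" if "j < n" for j
    proof -
      have "h j \<in> signs m" using h that by (auto simp: bij_betw_def)
      then have "\<bar>F b j\<bar> \<le> (\<Sum>i<m. \<bar>b i\<bar>)"
        unfolding F_def by (intro order_trans[OF sum_abs] sum_mono) (auto simp: abs_mult signs_abs)
      then have Fb: "\<bar>F b j\<bar> \<le> real bound" unfolding bound_def by linarith
      define t where "t = nat \<lfloor>\<bar>F b j\<bar> / K\<rfloor>"
      have t: "real t \<le> \<bar>F b j\<bar> / K" "\<bar>F b j\<bar> / K < real t + 1"
        using K by (auto simp: t_def)
      have "\<bar>F b j\<bar> / K \<le> \<bar>F b j\<bar> / 1" using K by (intro divide_left_mono) auto
      then have tb: "t \<le> bound" using t Fb by linarith
      have "real t = (\<Sum>s<t. of_bool (real K * (real s + 1) \<le> \<bar>F b j\<bar>))"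
      proof -
        have "real K * (real s + 1) \<le> \<bar>F b j\<bar>" if "s < t" for s
        proof -
          have "real s + 1 \<le> \<bar>F b j\<bar> / K" using that t(1) by linarith
          then show ?thesis using K by (simp add: field_simps)
        qed
        then show ?thesis by simp
      qed
      also have "\<dots> \<le> (\<Sum>s<bound. of_bool (real K * (real s + 1) \<le> \<bar>F b j\<bar>))"
        using tb by (intro sum_mono2) auto
      finally have "\<bar>F b j\<bar> / K \<le> 1 + (\<Sum>s<bound. of_bool (real K * (real s + 1) \<le> \<bar>F b j\<bar>))"
        using t(2) by linarith
      then show ?thesis using K by (simp add: G_def field_simps)
    qed
    \<comment> \<open>Since \<open>2 \<le> K\<close>, one of the \<open>s + 1\<close> factors
      \<open>exp K\<close> absorbs the constant \<open>2 * exp 1\<close> of the tail estimate; the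
      other \<open>s\<close> dominate \<open>K ^ s\<close>, as \<open>decay\<close>
      requires.\<close>
    have qs: "fund (q (real K * (real s + 1))) \<le> fund n * (1 / 2) ^ s" for s
    proof -
      have "real (q (real K * (real s + 1))) * exp (real K * (real s + 1)) \<le> 2 * exp 1 * n"
        unfolding q n using signs_tail[OF b, of "real K * (real s + 1)"] by simp
      moreover have "exp (real K * (real s + 1)) = exp (real K) ^ s * exp (real K)"
        by (simp add: exp_of_nat_mult[symmetric] exp_add distrib_left mult.commute)
      moreover have "2 * exp 1 \<le> exp (real K)"
      proof -
        have "2 * exp 1 \<le> exp 1 * exp (1::real)"
          using exp_ge_add_one_self[of 1] by (intro mult_right_mono) auto
        also have "\<dots> \<le> exp (real K)"
          unfolding exp_add[symmetric] using K by simp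
        finally show ?thesis .
      qed
      ultimately have "real (q (real K * (real s + 1))) * exp (real K) ^ s * exp (real K) \<le> exp (real K) * n"
        by (smt (verit) mult.assoc mult_right_mono of_nat_0_le_iff)
      then have "real (q (real K * (real s + 1))) * exp (real K) ^ s \<le> n"
        by (simp add: mult.commute)
      moreover have "real K ^ s \<le> exp (real K) ^ s"
        using exp_ge_add_one_self[of "real K"] by (intro power_mono) linarith+
      ultimately have "real (q (real K * (real s + 1))) * real K ^ s \<le> n"
        by (meson mult_left_mono of_nat_0_le_iff order_trans)
      then show ?thesis using decay by (simp add: power_one_over)
    qed
    have "D n (F b) \<le> 2 * D n G"
      using FG by (intro D_mono2) fastforce
    also have "D n G = K * D n (\<lambda>j. 1 + (\<Sum>s<bound. of_bool (real K * (real s + 1) \<le> \<bar>F b j\<bar>)))"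
      unfolding G_def D_scale by simp
    also have "D n (\<lambda>j. 1 + (\<Sum>s<bound. of_bool (real K * (real s + 1) \<le> \<bar>F b j\<bar>))) \<le>
        fund n + (\<Sum>s<bound. D n (\<lambda>j. of_bool (real K * (real s + 1) \<le> \<bar>F b j\<bar>)))"
      unfolding fund_def by (intro order_trans[OF D_triangle] add_left_mono D_sum_le)
    also have "(\<Sum>s<bound. D n (\<lambda>j. of_bool (real K * (real s + 1) \<le> \<bar>F b j\<bar>))) \<le>
        (\<Sum>s<bound. fund n * (1 / 2) ^ s)"
      unfolding D_indicator q_def[symmetric] by (intro sum_mono qs)
    also have "\<dots> = fund n * (\<Sum>s<bound. (1 / 2) ^ s)"
      by (simp add: sum_distrib_left)
    also have "(\<Sum>s<bound. (1 / 2) ^ s) \<le> (2::real)"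
      by (simp add: sum_gp_strict)
    finally have "D n (F b) \<le> 2 * (K * (fund n + fund n * 2))"
      using fn by (simp add: mult_left_mono)
    also have "\<dots> \<le> 10 * K * fund n"
      using fn by (simp add: algebra_simps)
    finally show "D n (F b) / fund n \<le> 10 * K" using fn by (simp add: divide_le_eq)
  qed
  define r where "r i j = h j i / fund n" for i j
  have "L2_set b {..<m} \<le> 24576 * D n (\<lambda>j. \<Sum>i<m. b i * r i j) \<and>
    D n (\<lambda>j. \<Sum>i<m. b i * r i j) \<le> 10 * real K * L2_set b {..<m}" for b
  proof -
    let ?l = "L2_set b {..<m}"
    have l0: "0 \<le> ?l" by (rule L2_set_nonneg)
    have D: "D n (\<lambda>j. \<Sum>i<m. b i * r i j) = D n (F b) / fund n"
    proof -
      have "(\<lambda>j. \<Sum>i<m. b i * r i j) = (\<lambda>j. inverse (fund n) * F b j)"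
        by (simp add: r_def F_def sum_distrib_left divide_inverse mult_ac)
      then show ?thesis using fn by (simp only: D_scale) (simp add: divide_inverse)
    qed
    show ?thesis
    proof (cases "?l = 0")
      case True
      then have "b i = 0" if "i < m" for i
        using that by (simp add: L2_set_eq_0_iff)
      then have "F b = (\<lambda>_. 0)" by (auto simp: F_def)
      then have "D n (F b) = 0" using D_scale[of n 0 "\<lambda>_. 1"] by simp
      then show ?thesis using True by (simp add: D)
    next
      case False
      then have l: "0 < ?l" using l0 by linarith
      define c where "c = (\<lambda>i. inverse ?l * b i)"
      have "L2_set c {..<m} = inverse ?l * ?l"
        using l L2_set_right_distrib[of "inverse ?l" b "{..<m}"] by (simp add: c_def)
      then have c: "L2_set c {..<m} = 1" using l by simp
      have "F c = (\<lambda>j. inverse ?l * F b j)"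
        by (rule ext) (simp add: F_def c_def sum_distrib_left mult.assoc)
      then have "D n (F c) = D n (F b) / ?l"
        using l by (simp only: D_scale) (simp add: divide_inverse mult.commute)
      then have eq: "D n (F b) / fund n = ?l * (D n (F c) / fund n)"
        using l by simp
      show ?thesis
        unfolding D eq
        using mult_left_mono[OF norm1(1)[OF c] l0] mult_left_mono[OF norm1(2)[OF c] l0]
        by (simp add: mult_ac)
    qed
  qed
  then show ?thesis by (intro exI allI)
qed

text \<open>Dvoretzky's theorem up to a constant. Either the fundamental function grows so fast that
  Rademacher sums span copies of \<open>l\<^sub>2\<^sup>m\<close>, or so slowly that there are copies of all
  \<open>l\<^sub>\<infinity>\<^sup>k\<close>.\<close>

lemma D_euclidean:
  obtains C where "1 \<le> C"
    "\<And>m :: nat. \<exists>n r. \<forall>b. L2_set b {..<m} \<le> C * D n (\<lambda>j. \<Sum>i<m. b i * r i j) \<and>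
      D n (\<lambda>j. \<Sum>i<m. b i * r i j) \<le> C * L2_set b {..<m}"
proof (cases "\<exists>K\<ge>2. \<forall>N>0. 2 * fund N \<le> fund (K * N)")
  case True
  then obtain K where K: "2 \<le> K" "\<And>N. 0 < N \<Longrightarrow> 2 * fund N \<le> fund (K * N)" by blast
  let ?C = "24576 * real K"
  have "\<exists>n r. \<forall>b. L2_set b {..<m} \<le> ?C * D n (\<lambda>j. \<Sum>i<m. b i * r i j) \<and>
      D n (\<lambda>j. \<Sum>i<m. b i * r i j) \<le> ?C * L2_set b {..<m}" for m :: nat
  proof -
    obtain n r where nr: "\<forall>b. L2_set b {..<m} \<le> 24576 * D n (\<lambda>j. \<Sum>i<m. b i * r i j) \<and>
        D n (\<lambda>j. \<Sum>i<m. b i * r i j) \<le> 10 * real K * L2_set b {..<m}"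
    proof -
      have "\<exists>n r. \<forall>b. L2_set b {..<m} \<le> 24576 * D n (\<lambda>j. \<Sum>i<m. b i * r i j) \<and>
          D n (\<lambda>j. \<Sum>i<m. b i * r i j) \<le> 10 * real K * L2_set b {..<m}"
        by (rule D_rademacher[OF K(1)]) (rule K(2))
      then show ?thesis by (elim exE) (rule that)
    qed
    have "L2_set b {..<m} \<le> ?C * D n (\<lambda>j. \<Sum>i<m. b i * r i j)" for b
    proof -
      have "1 * D n (\<lambda>j. \<Sum>i<m. b i * r i j) \<le> real K * D n (\<lambda>j. \<Sum>i<m. b i * r i j)"
        using K(1) by (intro mult_right_mono D_nonneg) simp
      then show ?thesis using spec[OF nr, of b] by simp
    qed
    moreover have "D n (\<lambda>j. \<Sum>i<m. b i * r i j) \<le> ?C * L2_set b {..<m}" for b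
      using conjunct2[OF spec[OF nr, of b]] by (rule order_trans) (use K L2_set_nonneg in \<open>auto intro!: mult_right_mono\<close>)
    ultimately show ?thesis by (intro exI allI conjI)
  qed
  then show ?thesis using K(1) by (intro that[of ?C]) simp_all
next
  case False
  then have "\<exists>N>0. fund (K * N) < 2 * fund N" if "2 \<le> K" for K
    using that by (meson not_le)
  then have "\<exists>n r. \<forall>b. L2_set b {..<m} \<le> 4 * D n (\<lambda>j. \<Sum>i<m. b i * r i j) \<and>
      D n (\<lambda>j. \<Sum>i<m. b i * r i j) \<le> 4 * L2_set b {..<m}" for m :: nat
    by (rule D_l_infinity)
  then show ?thesis by (intro that[of 4]) simp_all
qed

end

section \<open>Finitely supported sequences and the Euclidean extension\<close>

lemma lookup_scaleR [simp]: "Poly_Mapping.lookup (c *\<^sub>R x) i = c *\<^sub>R Poly_Mapping.lookup x i"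
proof -
  have "finite {i. c *\<^sub>R Poly_Mapping.lookup x i \<noteq> 0}"
    by (rule finite_subset[OF _ finite_keys[of x]]) (auto simp: in_keys_iff)
  then show ?thesis by (simp add: scaleR_poly_mapping_def)
qed

lemma keys_scaleR: "Poly_Mapping.keys (c *\<^sub>R x) \<subseteq> Poly_Mapping.keys (x :: 'a \<Rightarrow>\<^sub>0 'b::real_vector)"
  by (auto simp: in_keys_iff)

lemma scaleR_single: "c *\<^sub>R Poly_Mapping.single i d = Poly_Mapping.single i (c * d :: real)"
  by (rule poly_mapping_eqI) (simp add: lookup_single when_def)

lemma sum_single_lookup:
  "(\<Sum>i\<in>Poly_Mapping.keys x. Poly_Mapping.single i (Poly_Mapping.lookup x i)) = x"
proof (rule poly_mapping_eqI)
  fix j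
  have "Poly_Mapping.lookup (\<Sum>i\<in>Poly_Mapping.keys x. Poly_Mapping.single i (Poly_Mapping.lookup x i)) j =
      (\<Sum>i\<in>Poly_Mapping.keys x. if i = j then Poly_Mapping.lookup x j else 0)"
    unfolding lookup_sum by (intro sum.cong refl) (simp add: lookup_single when_def)
  then show "Poly_Mapping.lookup (\<Sum>i\<in>Poly_Mapping.keys x. Poly_Mapping.single i (Poly_Mapping.lookup x i)) j =
      Poly_Mapping.lookup x j"
    by (simp add: in_keys_iff)
qed

section \<open>Linear maps on \<open>c00\<close> given by the images of the unit vectors\<close>

definition comb :: "(nat \<Rightarrow> 'v::real_vector) \<Rightarrow> c00 \<Rightarrow> 'v" where
  "comb w x = (\<Sum>i\<in>Poly_Mapping.keys x. Poly_Mapping.lookup x i *\<^sub>R w i)"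

lemma comb_superset:
  "finite A \<Longrightarrow> Poly_Mapping.keys x \<subseteq> A \<Longrightarrow> comb w x = (\<Sum>i\<in>A. Poly_Mapping.lookup x i *\<^sub>R w i)"
  unfolding comb_def by (rule sum.mono_neutral_left) (auto simp: in_keys_iff)

lemma linear_comb: "linear (comb w)"
proof
  fix x y :: c00 and c :: real
  let ?A = "Poly_Mapping.keys x \<union> Poly_Mapping.keys y"
  show "comb w (x + y) = comb w x + comb w y"
    using Poly_Mapping.keys_add[of x y]
    by (simp add: comb_superset[of ?A] lookup_add scaleR_add_left sum.distrib)
  show "comb w (c *\<^sub>R x) = c *\<^sub>R comb w x"
    using keys_scaleR[of c x] by (simp add: comb_superset[of "Poly_Mapping.keys x"] scaleR_sum_right)
qed

lemma comb_single [simp]: "comb w (Poly_Mapping.single i c) = c *\<^sub>R w i"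
  using comb_superset[of "{i}" "Poly_Mapping.single i c" w] by simp

lemma comb_cong: "(\<And>i. i \<in> Poly_Mapping.keys x \<Longrightarrow> v i = w i) \<Longrightarrow> comb v x = comb w x"
  by (simp add: comb_def)

lemma comb_units: "comb (\<lambda>i. Poly_Mapping.single i 1) x = x"
  by (simp add: comb_def scaleR_single sum_single_lookup)

lemma linear_eq_comb:
  assumes "linear T"
  shows "T x = comb (\<lambda>i. T (Poly_Mapping.single i 1)) x"
proof -
  have "T x = T (comb (\<lambda>i. Poly_Mapping.single i 1) x)"
    by (simp add: comb_units)
  also have "\<dots> = comb (\<lambda>i. T (Poly_Mapping.single i 1)) x"
    using assms by (simp add: comb_def linear_sum linear_scale)
  finally show ?thesis .
qed

lemma comb_comb: "comb w (comb v x) = comb (\<lambda>i. comb w (v i)) x"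
  using linear_compose[OF linear_comb[of v] linear_comb[of w]] linear_eq_comb[of "\<lambda>x. comb w (comb v x)"]
  by (simp add: o_def)

definition l2 :: "c00 \<Rightarrow> real" where
  "l2 x = L2_set (Poly_Mapping.lookup x) (Poly_Mapping.keys x)"

lemma l2_superset:
  "finite A \<Longrightarrow> Poly_Mapping.keys x \<subseteq> A \<Longrightarrow> l2 x = L2_set (Poly_Mapping.lookup x) A"
  unfolding l2_def L2_set_def
  by (intro arg_cong[of _ _ sqrt] sum.mono_neutral_left) (auto simp: in_keys_iff)

lemma L2_le_l2: "finite A \<Longrightarrow> L2_set (Poly_Mapping.lookup x) A \<le> l2 x"
  by (subst l2_superset[of "A \<union> Poly_Mapping.keys x"])
     (auto simp: L2_set_def intro!: sum_mono2)

lemma l2_nonneg [simp]: "0 \<le> l2 x"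
  by (simp add: l2_def L2_set_nonneg)

lemma l2_eq_0_iff [simp]: "l2 x = 0 \<longleftrightarrow> x = 0"
proof
  assume "l2 x = 0"
  then have "\<forall>i\<in>Poly_Mapping.keys x. Poly_Mapping.lookup x i = 0"
    by (simp add: l2_def L2_set_eq_0_iff)
  then show "x = 0" by (metis in_keys_iff poly_mapping_eqI lookup_zero)
qed (simp add: l2_def)

lemma seminorm_l2: "seminorm l2"
proof
  fix c :: real and x y :: c00
  let ?A = "Poly_Mapping.keys x \<union> Poly_Mapping.keys y"
  show "l2 (c *\<^sub>R x) = \<bar>c\<bar> * l2 x"
    using l2_superset[OF finite_keys keys_scaleR[of c x]]
    by (simp add: l2_def L2_set_def power_mult_distrib real_sqrt_mult flip: sum_distrib_left)
  show "l2 (x + y) \<le> l2 x + l2 y"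
    using L2_set_triangle_ineq[of "Poly_Mapping.lookup x" "Poly_Mapping.lookup y" ?A] Poly_Mapping.keys_add[of x y]
    by (simp add: l2_superset[of ?A] plus_poly_mapping.rep_eq)
qed

text \<open>No finite-dimensional subspace is dense for \<open>p\<close>, so the completed quotient
  is infinite-dimensional. Phrased by distances, the condition mentions neither quotient nor
  completion.\<close>

definition inf_dim :: "('v::real_vector \<Rightarrow> real) \<Rightarrow> bool" where
  "inf_dim p \<longleftrightarrow> (\<forall>B. finite B \<longrightarrow> (\<exists>x d. 0 < d \<and> (\<forall>u\<in>span B. d \<le> p (x - u))))"

text \<open>Riesz's lemma, applied at each stage to the span of the vectors already chosen.\<close>

lemma (in seminorm) separated_sequence:
  assumes "inf_dim p"
  obtains y :: "nat \<Rightarrow> 'v" where "\<And>n. p (y n) \<le> 1" "\<And>m n. m < n \<Longrightarrow> 1 / 2 \<le> p (y m - y n)"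
proof -
  have riesz: "\<exists>y. p y \<le> 1 \<and> (\<forall>u\<in>span B. 1 / 2 \<le> p (y - u))" if "finite B" for B
  proof -
    obtain x d where xd: "0 < d \<and> (\<forall>u\<in>span B. d \<le> p (x - u))"
      using assms \<open>finite B\<close> unfolding inf_dim_def by (elim allE impE exE)
    then have d: "0 < d" "\<And>u. u \<in> span B \<Longrightarrow> d \<le> p (x - u)"
      by simp_all
    define \<delta> where "\<delta> = (INF u\<in>span B. p (x - u))"
    have bdd: "bdd_below ((\<lambda>u. p (x - u)) ` span B)"
      using d(2) by (auto intro!: bdd_belowI)
    have ne: "span B \<noteq> {}" using span_zero by blast
    have "d \<le> \<delta>" unfolding \<delta>_def by (rule cINF_greatest[OF ne]) (rule d(2))
    then have \<delta>: "0 < \<delta>" using d(1) by linarith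
    then have "\<delta> < 2 * \<delta>" by simp
    \<comment> \<open>Once \<open>x - u\<close> is normalised, a distance of at least
      \<open>\<delta>\<close> becomes one of at least 1/2.\<close>
    then obtain u where u: "u \<in> span B" "p (x - u) < 2 * \<delta>"
      unfolding \<delta>_def using cINF_less_iff[OF ne bdd] by blast
    let ?c = "p (x - u)"
    have c: "0 < ?c" using d u(1) by fastforce
    have "1 / 2 \<le> p (inverse ?c *\<^sub>R (x - u) - w)" if "w \<in> span B" for w
    proof -
      have "u + ?c *\<^sub>R w \<in> span B" using u(1) that by (simp add: span_add span_scale)
      then have "\<delta> \<le> p (x - (u + ?c *\<^sub>R w))"
        unfolding \<delta>_def by (rule cINF_lower[OF bdd])
      also have "x - (u + ?c *\<^sub>R w) = ?c *\<^sub>R (inverse ?c *\<^sub>R (x - u) - w)"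
        using c by (simp add: scaleR_diff_right)
      finally have "\<delta> \<le> ?c * p (inverse ?c *\<^sub>R (x - u) - w)"
        using c by (simp add: scale)
      then have "\<delta> / ?c \<le> p (inverse ?c *\<^sub>R (x - u) - w)"
        using c by (simp add: divide_le_eq mult.commute)
      moreover have "1 / 2 \<le> \<delta> / ?c" using u(2) c by (simp add: field_simps)
      ultimately show ?thesis by linarith
    qed
    moreover have "p (inverse ?c *\<^sub>R (x - u)) \<le> 1" using c by (simp add: scale)
    ultimately show ?thesis by blast
  qed
  define P where "P f n r \<longleftrightarrow> p r \<le> 1 \<and> (\<forall>u\<in>span (f ` {..<n}). 1 / 2 \<le> p (r - u))"
    for f :: "nat \<Rightarrow> 'v" and n r
  have "\<exists>y. \<forall>n. P y n (y n)"
  proof (rule dependent_wellorder_choice)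
    fix r n and f g :: "nat \<Rightarrow> 'v"
    assume "\<And>m. m < n \<Longrightarrow> f m = g m"
    then have "f ` {..<n} = g ` {..<n}" by auto
    then show "P f n r = P g n r" by (simp add: P_def)
  qed (unfold P_def, rule riesz, simp)
  then obtain y where "\<And>n. P y n (y n)" by blast
  then have y: "\<And>n. p (y n) \<le> 1" "\<And>n u. u \<in> span (y ` {..<n}) \<Longrightarrow> 1 / 2 \<le> p (y n - u)"
    by (simp_all add: P_def)
  show ?thesis
  proof (rule that[OF y(1)])
    fix m n :: nat assume "m < n"
    then show "1 / 2 \<le> p (y m - y n)"
      using y(2)[of "y m" n] by (simp add: span_base diff[of "y m"])
  qed
qed

context spreading_model
begin

lemma dbl_nth:
  "l < 2 * n \<Longrightarrow> dbl a [0..<n] ! l = (if even l then a (l div 2) else - a (l div 2))"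
proof (induction n)
  case (Suc n)
  show ?case
  proof (cases "l < 2 * n")
    case True
    then show ?thesis using Suc by (simp add: nth_append)
  next
    case False
    then have "l = 2 * n \<or> l = Suc (2 * n)" using Suc.prems by arith
    then show ?thesis by (elim disjE) (simp_all add: nth_append)
  qed
qed simp

lemma lam_dbl_le: "lam (dbl a [0..<n]) v \<le> p v + D n a"
proof -
  have z: "filter (\<lambda>c. c \<noteq> 0) (dbl (\<lambda>_. 0) is) = []" for "is"
    by (induction "is") auto
  have "lam (map2 (+) (dbl (\<lambda>_. 0) [0..<n]) (dbl a [0..<n])) (v + 0) \<le>
      lam (dbl (\<lambda>_. 0) [0..<n]) v + lam (dbl a [0..<n]) 0"
    by (rule lam_triangle) simp
  also have "lam (dbl (\<lambda>_. 0) [0..<n]) v = p v"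
    using lam_filter[of "dbl (\<lambda>_. 0) [0..<n]" v] by (simp add: z)
  finally show ?thesis
    by (simp add: D_def flip: dbl_add)
qed

end

text \<open>For each \<open>m\<close> the Euclidean system of dimension \<open>m\<close> in the
  spreading model supplies images for the \<open>m\<close> unit vectors from \<open>k\<close> on,
  and thereby a seminorm \<open>M m\<close>. The systems for different \<open>m\<close> are
  unrelated, so \<open>N\<close> is taken as a limit of the \<open>M m\<close>; it inherits the
  two-sided estimate because \<open>C\<close> does not depend on \<open>m\<close>. The estimate
  concerns tails only: a tail may still cancel against a head, so \<open>N\<close> can have a
  kernel.\<close>

theorem (in seminorm) euclidean_extension:
  fixes v :: "nat \<Rightarrow> 'v" and k :: nat
  assumes "inf_dim p"
  obtains N C where "seminorm N" "0 < C"
    "\<And>x. Poly_Mapping.keys x \<subseteq> {k..} \<Longrightarrow> l2 x \<le> C * N x \<and> N x \<le> C * l2 x"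
    "\<And>S e. finite S \<Longrightarrow> 0 < e \<Longrightarrow> \<exists>w. (\<forall>i<k. w i = v i) \<and> (\<forall>x\<in>S. \<bar>N x - p (comb w x)\<bar> < e)"
proof -
  obtain U :: "nat filter" where U: "limit_filter U" "U \<le> sequentially"
    using ex_limit_filter[of sequentially] by auto
  obtain y :: "nat \<Rightarrow> 'v" where y: "\<And>n. p (y n) \<le> 1" "\<And>m n. m < n \<Longrightarrow> 1 / 2 \<le> p (y m - y n)"
    using separated_sequence[OF assms] by blast
  interpret spreading_model p U y "1 / 2"
    by unfold_locales (use U y in auto)
  obtain C where C: "1 \<le> C" and ex: "\<And>m :: nat. \<exists>n r. \<forall>b. L2_set b {..<m} \<le> C * D n (\<lambda>j. \<Sum>i<m. b i * r i j) \<and>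
      D n (\<lambda>j. \<Sum>i<m. b i * r i j) \<le> C * L2_set b {..<m}"
    by (rule D_euclidean, rule that)
  define Q where "Q m n r \<longleftrightarrow> (\<forall>b. L2_set b {..<m} \<le> C * D n (\<lambda>j. \<Sum>i<m. b i * r i j) \<and>
      D n (\<lambda>j. \<Sum>i<m. b i * r i j) \<le> C * L2_set b {..<m})" for m n :: nat and r
  have "\<exists>n r. \<forall>m. Q m (n m) (r m)"
    using ex unfolding Q_def[symmetric] by metis
  then obtain n r where nr: "\<And>m. Q m (n m) (r m)" by blast
  have nr: "L2_set b {..<m} \<le> C * D (n m) (\<lambda>j. \<Sum>i<m. b i * r m i j)"
    "D (n m) (\<lambda>j. \<Sum>i<m. b i * r m i j) \<le> C * L2_set b {..<m}" for m b
    using nr[of m] unfolding Q_def by blast+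
  define tail where "tail x i = Poly_Mapping.lookup x (k + i)" for x :: c00 and i
  define a where "a m x j = (\<Sum>i<m. tail x i * r m i j)" for m x j
  define hd where "hd x = (\<Sum>i<k. Poly_Mapping.lookup x i *\<^sub>R v i)" for x :: c00
  \<comment> \<open>The head of \<open>x\<close> is carried by the vectors \<open>v i\<close> and
    enters as the base point of \<open>lam\<close>; \<open>a m x\<close> holds the coordinates of
    its tail in the spreading model.\<close>
  define M where "M m x = lam (dbl (a m x) [0..<n m]) (hd x)" for m x
  have tail_le: "L2_set (tail x) {..<m} \<le> l2 x" for x m
  proof -
    have "L2_set (tail x) {..<m} = L2_set (Poly_Mapping.lookup x) ((+) k ` {..<m})"
      unfolding L2_set_def tail_def by (subst sum.reindex) auto
    then show ?thesis using L2_le_l2[of "(+) k ` {..<m}" x] by simp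
  qed
  have semi: "seminorm (M m)" for m
  proof
    fix c x z
    have "a m (c *\<^sub>R x) = (\<lambda>j. c * a m x j)"
      by (rule ext) (simp add: a_def tail_def sum_distrib_left mult.assoc)
    moreover have "hd (c *\<^sub>R x) = c *\<^sub>R hd x" by (simp add: hd_def scaleR_sum_right)
    ultimately show "M m (c *\<^sub>R x) = \<bar>c\<bar> * M m x"
      by (simp add: M_def dbl_scale lam_scale)
    have "a m (x + z) = (\<lambda>j. a m x j + a m z j)"
      by (rule ext) (simp add: a_def tail_def lookup_add algebra_simps sum.distrib)
    moreover have "hd (x + z) = hd x + hd z" by (simp add: hd_def lookup_add algebra_simps sum.distrib)
    ultimately show "M m (x + z) \<le> M m x + M m z"
      unfolding M_def by (simp only: dbl_add) (rule lam_triangle, simp)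
  qed
  have M_le: "M m x \<le> p (hd x) + C * l2 x" for m x
  proof -
    have "D (n m) (a m x) \<le> C * L2_set (tail x) {..<m}"
      unfolding a_def[abs_def] by (rule nr(2))
    also have "\<dots> \<le> C * l2 x" using C tail_le by (intro mult_left_mono) auto
    finally show ?thesis unfolding M_def using lam_dbl_le[of "a m x" "n m" "hd x"] by linarith
  qed
  define N where "N x = Lim U (\<lambda>m. M m x)" for x
  have lim: "((\<lambda>m. M m x) \<longlongrightarrow> N x) U" for x
    unfolding N_def
    by (rule limit_filter_tendsto_Lim[OF U(1), of _ "p (hd x) + C * l2 x"])
       (use M_le seminorm.nonneg[OF semi] in \<open>auto intro!: always_eventually\<close>)
  note nb = limit_filter_nonbot[OF U(1)]
  have supp: "\<exists>m0. Poly_Mapping.keys x \<subseteq> {..<m0}" for x :: c00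
    using finite_nat_bounded[OF finite_keys[of x]] by auto
  have evU: "eventually (\<lambda>m. m0 \<le> m) U" for m0
    using U(2) eventually_ge_at_top[of m0] by (auto simp: le_filter_def)
  have "l2 x \<le> C * N x \<and> N x \<le> C * l2 x" if x: "Poly_Mapping.keys x \<subseteq> {k..}" for x
  proof -
    have hd0: "hd x = 0"
      unfolding hd_def by (rule sum.neutral) (use x in \<open>auto simp: in_keys_iff subset_iff Ball_def\<close>)
    have MD: "M m x = D (n m) (a m x)" for m by (simp add: M_def D_def hd0)
    obtain m0 where m0: "Poly_Mapping.keys x \<subseteq> {..<m0}" using supp by blast
    have l2: "L2_set (tail x) {..<m} = l2 x" if "m0 \<le> m" for m
    proof -
      have "Poly_Mapping.keys x \<subseteq> (+) k ` {..<m}"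
      proof
        fix i assume i: "i \<in> Poly_Mapping.keys x"
        then have "k \<le> i" "i < m0" using x m0 by auto
        then show "i \<in> (+) k ` {..<m}" using that by (intro image_eqI[of _ _ "i - k"]) auto
      qed
      then have "l2 x = L2_set (Poly_Mapping.lookup x) ((+) k ` {..<m})"
        by (intro l2_superset) auto
      also have "\<dots> = L2_set (tail x) {..<m}"
        unfolding L2_set_def tail_def by (subst sum.reindex) auto
      finally show ?thesis by simp
    qed
    have le: "l2 x \<le> C * M m x" "M m x \<le> C * l2 x" if "m0 \<le> m" for m
      using nr[where m = m and b = "tail x"] unfolding l2[OF that] MD a_def[abs_def] .
    show ?thesis
    proof
      show "l2 x \<le> C * N x"
        by (rule tendsto_lowerbound[OF tendsto_mult_left[OF lim] _ nb]) (rule eventually_mono[OF evU le(1)])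
      show "N x \<le> C * l2 x"
        by (rule tendsto_upperbound[OF lim _ nb]) (rule eventually_mono[OF evU le(2)])
    qed
  qed
  moreover have "\<exists>w. (\<forall>i<k. w i = v i) \<and> (\<forall>x\<in>S. \<bar>N x - p (comb w x)\<bar> < e)"
    if S: "finite S" and e: "0 < e" for S e
  proof -
    have "finite (\<Union>x\<in>S. Poly_Mapping.keys x)" using S by simp
    from finite_nat_bounded[OF this]
    obtain m0 where m0: "(\<Union>x\<in>S. Poly_Mapping.keys x) \<subseteq> {..<m0}"
      by (elim exE)
    \<comment> \<open>Two approximations in turn: first an \<open>m\<close> that covers all supports
      and brings \<open>M m\<close> close to \<open>N\<close> on \<open>S\<close>, then actual
      vectors in place of the spreading model for this \<open>m\<close>.\<close>
    have "\<forall>\<^sub>F m in U. \<forall>x\<in>S. \<bar>M m x - N x\<bar> < e / 2"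
      using tendstoD[OF lim, of "e / 2"] e
      by (intro eventually_ball_finite S) (auto simp: dist_real_def)
    then have "\<forall>\<^sub>F m in U. m0 \<le> m \<and> (\<forall>x\<in>S. \<bar>M m x - N x\<bar> < e / 2)"
      by (rule eventually_conj[OF evU])
    from eventually_happens[OF this] nb
    obtain m where m': "m0 \<le> m \<and> (\<forall>x\<in>S. \<bar>M m x - N x\<bar> < e / 2)"
      by auto
    then have m: "m0 \<le> m" "\<And>x. x \<in> S \<Longrightarrow> \<bar>M m x - N x\<bar> < e / 2"
      by simp_all
    let ?S = "(\<lambda>x. (dbl (a m x) [0..<n m], hd x)) ` S"
    have "\<exists>ns. \<forall>(cs, v)\<in>?S. \<bar>lam cs v - p (v + (\<Sum>l<2 * n m. (cs ! l) *\<^sub>R y (ns l)))\<bar> < e / 2"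
      by (rule lam_approx) (use S e in auto)
    then obtain ns where ns: "\<And>x. x \<in> S \<Longrightarrow>
        \<bar>M m x - p (hd x + (\<Sum>l<2 * n m. (dbl (a m x) [0..<n m] ! l) *\<^sub>R y (ns l)))\<bar> < e / 2"
      by (fastforce simp: M_def)
    define g where "g i = (\<Sum>l<2 * n m. (dbl (r m i) [0..<n m] ! l) *\<^sub>R y (ns l))" for i
    define w where "w i = (if i < k then v i else g (i - k))" for i
    have wx: "comb w x = hd x + (\<Sum>l<2 * n m. (dbl (a m x) [0..<n m] ! l) *\<^sub>R y (ns l))" if "x \<in> S" for x
    proof -
      have "Poly_Mapping.keys x \<subseteq> {..<k + m}" using m0 m(1) that by fastforce
      then have "comb w x = (\<Sum>i<k + m. Poly_Mapping.lookup x i *\<^sub>R w i)"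
        by (intro comb_superset) auto
      also have "\<dots> = hd x + (\<Sum>i<m. tail x i *\<^sub>R g i)"
      proof -
        have "{..<k + m} = {..<k} \<union> (+) k ` {..<m}"
        proof -
          have "i \<in> (+) k ` {..<m}" if "i < k + m" "\<not> i < k" for i
            using that by (intro image_eqI[of _ _ "i - k"]) auto
          then show ?thesis by auto
        qed
        then have "(\<Sum>i<k + m. Poly_Mapping.lookup x i *\<^sub>R w i) =
            (\<Sum>i<k. Poly_Mapping.lookup x i *\<^sub>R w i) + (\<Sum>i\<in>(+) k ` {..<m}. Poly_Mapping.lookup x i *\<^sub>R w i)"
          by (simp only:) (rule sum.union_disjoint; auto)
        also have "(\<Sum>i\<in>(+) k ` {..<m}. Poly_Mapping.lookup x i *\<^sub>R w i) = (\<Sum>i<m. tail x i *\<^sub>R g i)"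
          by (subst sum.reindex) (auto simp: tail_def w_def)
        finally show ?thesis by (simp add: hd_def w_def)
      qed
      also have "(\<Sum>i<m. tail x i *\<^sub>R g i) =
          (\<Sum>l<2 * n m. (\<Sum>i<m. tail x i * (dbl (r m i) [0..<n m] ! l)) *\<^sub>R y (ns l))"
        unfolding g_def scaleR_sum_right scaleR_sum_left by (subst sum.swap) simp
      also have "\<dots> = (\<Sum>l<2 * n m. (dbl (a m x) [0..<n m] ! l) *\<^sub>R y (ns l))"
        by (intro sum.cong refl) (simp add: dbl_nth a_def sum_negf)
      finally show ?thesis .
    qed
    have "\<bar>N x - p (comb w x)\<bar> < e" if "x \<in> S" for x
      using m(2)[OF that] ns[OF that] unfolding wx[OF that] by linarith
    moreover have "\<forall>i<k. w i = v i" by (simp add: w_def)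
    ultimately show ?thesis by blast
  qed
  ultimately show ?thesis
    using that[of N C] seminorm_Lim[OF U(1) semi lim] C by auto
qed

section \<open>Banach spaces with a carrier\<close>

lemma real_ring_simps [simp]:
  "carrier real_ring = UNIV" "x \<oplus>\<^bsub>real_ring\<^esub> y = x + y" "x \<otimes>\<^bsub>real_ring\<^esub> y = x * y"
  "\<zero>\<^bsub>real_ring\<^esub> = 0" "\<one>\<^bsub>real_ring\<^esub> = 1"
  by (simp_all add: real_ring_def)

lemma cring_real_ring: "cring real_ring"
proof (rule cringI)
  show "abelian_group real_ring"
    by (rule abelian_groupI) (auto intro: exI[of _ "- x" for x])
  show "comm_monoid real_ring"
    by (rule comm_monoidI) auto
qed (simp add: algebra_simps)

context pseudonormed_space
begin

lemma sm_closed [simp]: "x \<in> carrier X \<Longrightarrow> c \<odot> x \<in> carrier X"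
  and sm_add: "x \<in> carrier X \<Longrightarrow> y \<in> carrier X \<Longrightarrow> c \<odot> (x \<oplus> y) = c \<odot> x \<oplus> c \<odot> y"
  and sm_add_left: "x \<in> carrier X \<Longrightarrow> (a + b) \<odot> x = a \<odot> x \<oplus> b \<odot> x"
  and sm_mult: "x \<in> carrier X \<Longrightarrow> (a * b) \<odot> x = a \<odot> (b \<odot> x)"
  and sm_one [simp]: "x \<in> carrier X \<Longrightarrow> 1 \<odot> x = x"
  and sm_zero [simp]: "x \<in> carrier X \<Longrightarrow> 0 \<odot> x = \<zero>"
  and sm_right_zero [simp]: "c \<odot> \<zero> = \<zero>"
  using smult_closed[of c x] smult_r_distr[of c x y] smult_l_distr[of a b x] smult_assoc1[of a b x]
    smult_one[of x] smult_l_null[of x] smult_r_null[of c]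
  by simp_all

lemma sm_minus_one: "x \<in> carrier X \<Longrightarrow> (- 1) \<odot> x = \<ominus> x"
  using sm_add_left[of x 1 "- 1"] M.minus_equality[of "(- 1) \<odot> x" x] M.a_comm[of x "(- 1) \<odot> x"] by simp

lemma sm_diff: "x \<in> carrier X \<Longrightarrow> y \<in> carrier X \<Longrightarrow> c \<odot> (x \<ominus> y) = c \<odot> x \<ominus> c \<odot> y"
  by (simp add: a_minus_def sm_add flip: sm_minus_one) (simp add: mult.commute flip: sm_mult)

lemma nrm_zero [simp]: "nrm X \<zero> = 0"
  using nrm_smult[of \<zero> 0] by simp

lemma nrm_minus [simp]: "x \<in> carrier X \<Longrightarrow> nrm X (\<ominus> x) = nrm X x"
  using nrm_smult[of x "- 1"] by (simp add: sm_minus_one)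

lemma nrm_diff: "x \<in> carrier X \<Longrightarrow> y \<in> carrier X \<Longrightarrow> nrm X (x \<ominus> y) = nrm X (y \<ominus> x)"
  using nrm_minus[of "x \<ominus> y"] by (simp add: a_minus_def M.minus_add M.a_comm)

lemma diff_add_diff:
  "\<lbrakk>x \<in> carrier X; y \<in> carrier X; z \<in> carrier X\<rbrakk> \<Longrightarrow> (x \<ominus> y) \<oplus> (y \<ominus> z) = x \<ominus> z"
  by (simp add: a_minus_def M.a_assoc M.r_neg1)

lemma nrm_triangle_diff:
  "\<lbrakk>x \<in> carrier X; y \<in> carrier X; z \<in> carrier X\<rbrakk> \<Longrightarrow> nrm X (x \<ominus> z) \<le> nrm X (x \<ominus> y) + nrm X (y \<ominus> z)"
  using nrm_triangle[of "x \<ominus> y" "y \<ominus> z"] by (simp add: diff_add_diff)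

lemma diff_zero_right [simp]: "x \<in> carrier X \<Longrightarrow> x \<ominus> \<zero> = x"
  by (simp add: a_minus_def)

lemma diff_self [simp]: "x \<in> carrier X \<Longrightarrow> x \<ominus> x = \<zero>"
  by (simp add: a_minus_def M.r_neg)

lemma add_diff_add:
  "\<lbrakk>x \<in> carrier X; y \<in> carrier X; u \<in> carrier X; v \<in> carrier X\<rbrakk> \<Longrightarrow>
    (x \<oplus> y) \<ominus> (u \<oplus> v) = (x \<ominus> u) \<oplus> (y \<ominus> v)"
  by (simp add: a_minus_def M.minus_add M.a_assoc M.a_lcomm)

lemma nrm_add_diff_add:
  "\<lbrakk>x \<in> carrier X; y \<in> carrier X; u \<in> carrier X; v \<in> carrier X\<rbrakk> \<Longrightarrow>
    nrm X ((x \<oplus> y) \<ominus> (u \<oplus> v)) \<le> nrm X (x \<ominus> u) + nrm X (y \<ominus> v)"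
  by (simp add: add_diff_add nrm_triangle)

lemma nrm_abs_diff:
  "x \<in> carrier X \<Longrightarrow> y \<in> carrier X \<Longrightarrow> \<bar>nrm X x - nrm X y\<bar> \<le> nrm X (x \<ominus> y)"
  using nrm_triangle_diff[of x y \<zero>] nrm_triangle_diff[of y x \<zero>] nrm_diff[of x y] by simp

end

context normed_space
begin

lemma diff_eq_zeroD: "x \<in> carrier X \<Longrightarrow> y \<in> carrier X \<Longrightarrow> nrm X (x \<ominus> y) = 0 \<Longrightarrow> x = y"
  using nrm_eq_0[of "x \<ominus> y"] diff_add_diff[of x y \<zero>] by simp

lemma eqI_small:
  assumes "x \<in> carrier X" "y \<in> carrier X" "\<And>e. 0 < e \<Longrightarrow> nrm X (x \<ominus> y) \<le> e"
  shows "x = y"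
proof (rule diff_eq_zeroD[OF assms(1,2)])
  have "nrm X (x \<ominus> y) \<le> 0"
    by (rule field_le_epsilon) (simp add: assms(3))
  then show "nrm X (x \<ominus> y) = 0"
    using nrm_nonneg[of "x \<ominus> y"] assms(1,2) by (simp add: M.minus_closed)
qed

lemma Metric_space: "Metric_space (carrier X) (ndist X)"
proof
  fix x y z
  show "0 \<le> ndist X x y" by (simp add: ndist_def nrm_nonneg)
  show "ndist X x y = ndist X y x" by (simp add: ndist_def nrm_diff)
  show "ndist X x y = 0 \<longleftrightarrow> x = y" if "x \<in> carrier X" "y \<in> carrier X"
    using that diff_eq_zeroD by (auto simp: ndist_def)
  show "ndist X x z \<le> ndist X x y + ndist X y z"
    if "x \<in> carrier X" "y \<in> carrier X" "z \<in> carrier X"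
    using that nrm_triangle_diff by (simp add: ndist_def)
qed

lemma topspace_ntop [simp]: "topspace (ntop X) = carrier X"
  unfolding ntop_def by (rule Metric_space.topspace_mtopology[OF Metric_space])

lemma MCauchy_iff:
  "Metric_space.MCauchy (carrier X) (ndist X) s \<longleftrightarrow>
    (\<forall>n. s n \<in> carrier X) \<and> (\<forall>e>0. \<exists>N. \<forall>m\<ge>N. \<forall>n\<ge>N. nrm X (s m \<ominus> s n) < e)"
  unfolding Metric_space.MCauchy_def[OF Metric_space]
  by (auto simp: ndist_def image_subset_iff)

lemma limitin_iff:
  assumes "\<And>n. s n \<in> carrier X"
  shows "limitin (Metric_space.mtopology (carrier X) (ndist X)) s x sequentially \<longleftrightarrow>
    x \<in> carrier X \<and> (\<lambda>n. nrm X (s n \<ominus> x)) \<longlonglongrightarrow> 0"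
  unfolding Metric_space.limitin_metric_dist_null[OF Metric_space]
  using assms by (auto simp: ndist_def)

end

lemma banach_spaceD:
  assumes "banach_space X" "\<And>n. s n \<in> carrier X"
    "\<And>e. 0 < e \<Longrightarrow> \<exists>N. \<forall>m\<ge>N. \<forall>n\<ge>N. nrm X (s m \<ominus>\<^bsub>X\<^esub> s n) < e"
  shows "\<exists>x\<in>carrier X. (\<lambda>n. nrm X (s n \<ominus>\<^bsub>X\<^esub> x)) \<longlonglongrightarrow> 0"
proof -
  interpret normed_space X using assms(1) by (simp add: banach_space_def)
  have "Metric_space.MCauchy (carrier X) (ndist X) s"
    unfolding MCauchy_iff using assms by auto
  then obtain x where "limitin (Metric_space.mtopology (carrier X) (ndist X)) s x sequentially"
    using assms(1) Metric_space.mcomplete_def[OF Metric_space] by (auto simp: banach_space_def)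
  then show ?thesis using assms(2) by (auto simp: limitin_iff)
qed

lemma banach_spaceI:
  assumes "normed_space X"
    "\<And>s. (\<And>n. s n \<in> carrier X) \<Longrightarrow>
      (\<And>e. 0 < e \<Longrightarrow> \<exists>N. \<forall>m\<ge>N. \<forall>n\<ge>N. nrm X (s m \<ominus>\<^bsub>X\<^esub> s n) < e) \<Longrightarrow>
      \<exists>x\<in>carrier X. (\<lambda>n. nrm X (s n \<ominus>\<^bsub>X\<^esub> x)) \<longlonglongrightarrow> 0"
  shows "banach_space X"
proof -
  interpret normed_space X by fact
  have "\<exists>x. limitin (Metric_space.mtopology (carrier X) (ndist X)) s x sequentially"
    if "Metric_space.MCauchy (carrier X) (ndist X) s" for s
    using that assms(2)[of s] unfolding MCauchy_iff by (metis limitin_iff)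
  then show ?thesis
    by (simp add: banach_space_def Metric_space.mcomplete_def[OF Metric_space] assms(1))
qed

lemma continuous_ntop_iff:
  assumes "normed_space X" "normed_space Y"
  shows "continuous_map (ntop X) (ntop Y) f \<longleftrightarrow> f \<in> carrier X \<rightarrow> carrier Y \<and>
    (\<forall>a\<in>carrier X. \<forall>e>0. \<exists>d>0. \<forall>x\<in>carrier X. nrm X (a \<ominus>\<^bsub>X\<^esub> x) < d \<longrightarrow> nrm Y (f a \<ominus>\<^bsub>Y\<^esub> f x) < e)"
proof -
  interpret X: normed_space X by fact
  interpret Y: normed_space Y by fact
  have "continuous_map (ntop X) (ntop Y) f \<longleftrightarrow> f \<in> carrier X \<rightarrow> carrier Y \<and>
    (\<forall>a\<in>carrier X. \<forall>e>0. \<exists>d>0. \<forall>x. x \<in> carrier X \<and> ndist X a x < d \<longrightarrow> ndist Y (f a) (f x) < e)"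
    unfolding ntop_def
    by (rule Metric_space.metric_continuous_map[OF X.Metric_space Y.Metric_space, THEN trans]) auto
  moreover have "ndist X a x = nrm X (a \<ominus>\<^bsub>X\<^esub> x)" if "a \<in> carrier X" "x \<in> carrier X" for a x
    using that by (simp add: ndist_def)
  moreover have "ndist Y (f a) (f x) = nrm Y (f a \<ominus>\<^bsub>Y\<^esub> f x)"
    if "a \<in> carrier X" "x \<in> carrier X" "f \<in> carrier X \<rightarrow> carrier Y" for a x
    using that by (auto simp: ndist_def)
  ultimately show ?thesis
    by (simp add: Ball_def imp_conjL cong: imp_cong conj_cong)
qed

section \<open>Linear maps from \<open>c00\<close> with dense range\<close>

definition lin_c00 :: "'a nspace \<Rightarrow> (c00 \<Rightarrow> 'a) \<Rightarrow> bool" where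
  "lin_c00 X T \<longleftrightarrow> (\<forall>x. T x \<in> carrier X) \<and> (\<forall>x y. T (x + y) = T x \<oplus>\<^bsub>X\<^esub> T y) \<and>
     (\<forall>c x. T (c *\<^sub>R x) = c \<odot>\<^bsub>X\<^esub> T x)"

definition dense_c00 :: "'a nspace \<Rightarrow> (c00 \<Rightarrow> 'a) \<Rightarrow> bool" where
  "dense_c00 X T \<longleftrightarrow> (\<forall>x\<in>carrier X. \<forall>e>0. \<exists>c. nrm X (x \<ominus>\<^bsub>X\<^esub> T c) < e)"

context pseudonormed_space
begin

lemma lin_c00D:
  assumes "lin_c00 X T"
  shows "T x \<in> carrier X" "T (x + y) = T x \<oplus> T y" "T (c *\<^sub>R x) = c \<odot> T x" "T 0 = \<zero>" "T (x - y) = T x \<ominus> T y"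
proof -
  show T: "T x \<in> carrier X" "T (x + y) = T x \<oplus> T y" "T (c *\<^sub>R x) = c \<odot> T x" for x y c
    using assms by (auto simp: lin_c00_def)
  show "T 0 = \<zero>" using T(3)[of 0 0] T(1)[of 0] by simp
  show "T (x - y) = T x \<ominus> T y"
    using T(2)[of x "(-1) *\<^sub>R y"] T(3)[of "-1" y] T(1)[of y] by (simp add: a_minus_def sm_minus_one)
qed

lemma seminorm_lin_c00:
  assumes "lin_c00 X T"
  shows "seminorm (\<lambda>x. nrm X (T x))"
  using lin_c00D[OF assms] by unfold_locales (simp_all add: nrm_smult nrm_triangle)

end

text \<open>Extension by continuity. \<open>T\<close> may have a kernel; the norm inequality ensures
  that \<open>S c\<close> depends on \<open>T c\<close> only. The value at \<open>x\<close> is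
  pinned down by its distances to all \<open>S c\<close>, and this makes linearity a matter of
  estimates rather than of chosen sequences.\<close>

lemma extend_lin_c00:
  assumes X: "normed_space X" and Y: "banach_space Y"
    and T: "lin_c00 X T" "dense_c00 X T" and S: "lin_c00 Y S"
    and C: "0 < C" "\<And>c. nrm Y (S c) \<le> C * nrm X (T c)"
  obtains f where "linear_map X Y f" "\<And>c. f (T c) = S c"
    "\<And>x. x \<in> carrier X \<Longrightarrow> nrm Y (f x) \<le> C * nrm X x"
proof -
  interpret X: normed_space X by fact
  interpret Y: normed_space Y using Y by (simp add: banach_space_def)
  note T' = X.lin_c00D[OF T(1)] and S' = Y.lin_c00D[OF S]
  note [simp] = T'(1) S'(1) X.M.minus_closed Y.M.minus_closed
  have SC: "nrm Y (S c \<ominus>\<^bsub>Y\<^esub> S d) \<le> C * nrm X (T c \<ominus>\<^bsub>X\<^esub> T d)" for c d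
    using C(2)[of "c - d"] by (simp add: T'(5) S'(5))
  have ex: "\<exists>y\<in>carrier Y. \<forall>c. nrm Y (y \<ominus>\<^bsub>Y\<^esub> S c) \<le> C * nrm X (x \<ominus>\<^bsub>X\<^esub> T c)" if x: "x \<in> carrier X" for x
  proof -
    have "\<exists>c. nrm X (x \<ominus>\<^bsub>X\<^esub> T c) < inverse (real (Suc n))" for n
      using T(2) x by (simp add: dense_c00_def)
    then obtain a where a: "\<And>n. nrm X (x \<ominus>\<^bsub>X\<^esub> T (a n)) < inverse (real (Suc n))" by metis
    have lim: "(\<lambda>n. nrm X (x \<ominus>\<^bsub>X\<^esub> T (a n))) \<longlonglongrightarrow> 0"
      by (rule tendsto_sandwich[OF _ _ tendsto_const LIMSEQ_inverse_real_of_nat])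
         (use a in \<open>auto intro!: always_eventually less_imp_le X.nrm_nonneg x simp del: of_nat_Suc\<close>)
    have "\<exists>N. \<forall>m\<ge>N. \<forall>n\<ge>N. nrm Y (S (a m) \<ominus>\<^bsub>Y\<^esub> S (a n)) < e" if "0 < e" for e
    proof -
      have "\<forall>\<^sub>F n in sequentially. nrm X (x \<ominus>\<^bsub>X\<^esub> T (a n)) < e / (2 * C)"
        using order_tendstoD(2)[OF lim, of "e / (2 * C)"] that C by simp
      then obtain N where N: "\<And>n. N \<le> n \<Longrightarrow> nrm X (x \<ominus>\<^bsub>X\<^esub> T (a n)) < e / (2 * C)"
        by (auto simp: eventually_sequentially)
      have "nrm Y (S (a m) \<ominus>\<^bsub>Y\<^esub> S (a n)) < e" if "N \<le> m" "N \<le> n" for m n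
      proof -
        have "nrm X (T (a m) \<ominus>\<^bsub>X\<^esub> T (a n)) \<le> nrm X (T (a m) \<ominus>\<^bsub>X\<^esub> x) + nrm X (x \<ominus>\<^bsub>X\<^esub> T (a n))"
          using x by (intro X.nrm_triangle_diff) auto
        also have "\<dots> < e / (2 * C) + e / (2 * C)"
          using N[OF that(1)] N[OF that(2)] x by (simp add: X.nrm_diff[of "T (a m)"])
        also have "\<dots> = e / C" by simp
        finally have "C * nrm X (T (a m) \<ominus>\<^bsub>X\<^esub> T (a n)) < e"
          using C(1) by (simp add: pos_less_divide_eq mult.commute)
        then show ?thesis using SC[of "a m" "a n"] by linarith
      qed
      then show ?thesis by blast
    qed
    then obtain y where y: "y \<in> carrier Y" "(\<lambda>n. nrm Y (S (a n) \<ominus>\<^bsub>Y\<^esub> y)) \<longlonglongrightarrow> 0"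
      using banach_spaceD[OF Y, of "\<lambda>n. S (a n)"] by auto
    have "nrm Y (y \<ominus>\<^bsub>Y\<^esub> S c) \<le> C * nrm X (x \<ominus>\<^bsub>X\<^esub> T c)" for c
    proof (rule LIMSEQ_le_const)
      show "(\<lambda>n. nrm Y (S (a n) \<ominus>\<^bsub>Y\<^esub> y) + C * (nrm X (x \<ominus>\<^bsub>X\<^esub> T (a n)) + nrm X (x \<ominus>\<^bsub>X\<^esub> T c)))
          \<longlonglongrightarrow> C * nrm X (x \<ominus>\<^bsub>X\<^esub> T c)"
        using tendsto_add[OF y(2) tendsto_mult_left[OF tendsto_add[OF lim tendsto_const[of "nrm X (x \<ominus>\<^bsub>X\<^esub> T c)"]], of C]]
        by simp
      have "nrm Y (y \<ominus>\<^bsub>Y\<^esub> S c) \<le> nrm Y (S (a n) \<ominus>\<^bsub>Y\<^esub> y) + C * (nrm X (x \<ominus>\<^bsub>X\<^esub> T (a n)) + nrm X (x \<ominus>\<^bsub>X\<^esub> T c))" for n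
      proof -
        have "nrm X (T (a n) \<ominus>\<^bsub>X\<^esub> T c) \<le> nrm X (x \<ominus>\<^bsub>X\<^esub> T (a n)) + nrm X (x \<ominus>\<^bsub>X\<^esub> T c)"
          using X.nrm_triangle_diff[of "T (a n)" x "T c"] x by (simp add: X.nrm_diff[of x "T (a n)"])
        then have "C * nrm X (T (a n) \<ominus>\<^bsub>X\<^esub> T c) \<le> C * (nrm X (x \<ominus>\<^bsub>X\<^esub> T (a n)) + nrm X (x \<ominus>\<^bsub>X\<^esub> T c))"
          using C(1) by (intro mult_left_mono) auto
        then show ?thesis
          using Y.nrm_triangle_diff[of y "S (a n)" "S c"] SC[of "a n" c] y(1)
          by (simp add: Y.nrm_diff[of y "S (a n)"])
      qed
      then show "\<exists>N. \<forall>n\<ge>N. nrm Y (y \<ominus>\<^bsub>Y\<^esub> S c) \<le>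
          nrm Y (S (a n) \<ominus>\<^bsub>Y\<^esub> y) + C * (nrm X (x \<ominus>\<^bsub>X\<^esub> T (a n)) + nrm X (x \<ominus>\<^bsub>X\<^esub> T c))" by blast
    qed
    then show ?thesis using y(1) by blast
  qed
  define f where "f x = (SOME y. y \<in> carrier Y \<and> (\<forall>c. nrm Y (y \<ominus>\<^bsub>Y\<^esub> S c) \<le> C * nrm X (x \<ominus>\<^bsub>X\<^esub> T c)))" for x
  have f: "f x \<in> carrier Y \<and> (\<forall>c. nrm Y (f x \<ominus>\<^bsub>Y\<^esub> S c) \<le> C * nrm X (x \<ominus>\<^bsub>X\<^esub> T c))" if "x \<in> carrier X" for x
    unfolding f_def by (rule someI_ex) (use ex[OF that] in blast)
  then have fc [simp]: "x \<in> carrier X \<Longrightarrow> f x \<in> carrier Y"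
    and fS: "x \<in> carrier X \<Longrightarrow> nrm Y (f x \<ominus>\<^bsub>Y\<^esub> S c) \<le> C * nrm X (x \<ominus>\<^bsub>X\<^esub> T c)" for x c
    by blast+
  have dense: "\<exists>c. C * nrm X (x \<ominus>\<^bsub>X\<^esub> T c) \<le> e" if "x \<in> carrier X" "0 < e" for x e
  proof -
    have "0 < e / C" using that C(1) by simp
    then obtain c where "nrm X (x \<ominus>\<^bsub>X\<^esub> T c) < e / C"
      using T(2) \<open>x \<in> carrier X\<close> unfolding dense_c00_def by blast
    then show ?thesis using C(1) by (intro exI[of _ c]) (simp add: pos_less_divide_eq mult.commute less_imp_le)
  qed
  have "f (x \<oplus>\<^bsub>X\<^esub> y) = f x \<oplus>\<^bsub>Y\<^esub> f y" if xy: "x \<in> carrier X" "y \<in> carrier X" for x y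
  proof (rule Y.eqI_small)
    fix e :: real assume e: "0 < e"
    obtain c d where c: "C * nrm X (x \<ominus>\<^bsub>X\<^esub> T c) \<le> e / 4" and d: "C * nrm X (y \<ominus>\<^bsub>X\<^esub> T d) \<le> e / 4"
      using dense[OF xy(1), of "e / 4"] dense[OF xy(2), of "e / 4"] e by auto
    have "nrm Y (f (x \<oplus>\<^bsub>X\<^esub> y) \<ominus>\<^bsub>Y\<^esub> (f x \<oplus>\<^bsub>Y\<^esub> f y)) \<le>
        nrm Y (f (x \<oplus>\<^bsub>X\<^esub> y) \<ominus>\<^bsub>Y\<^esub> S (c + d)) + nrm Y (S (c + d) \<ominus>\<^bsub>Y\<^esub> (f x \<oplus>\<^bsub>Y\<^esub> f y))"
      using xy by (intro Y.nrm_triangle_diff) auto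
    also have "nrm Y (f (x \<oplus>\<^bsub>X\<^esub> y) \<ominus>\<^bsub>Y\<^esub> S (c + d)) \<le> C * nrm X ((x \<oplus>\<^bsub>X\<^esub> y) \<ominus>\<^bsub>X\<^esub> (T c \<oplus>\<^bsub>X\<^esub> T d))"
      using fS[of "x \<oplus>\<^bsub>X\<^esub> y" "c + d"] xy by (simp add: T'(2))
    also have "\<dots> \<le> C * (nrm X (x \<ominus>\<^bsub>X\<^esub> T c) + nrm X (y \<ominus>\<^bsub>X\<^esub> T d))"
      using C(1) xy by (intro mult_left_mono X.nrm_add_diff_add) auto
    also have "nrm Y (S (c + d) \<ominus>\<^bsub>Y\<^esub> (f x \<oplus>\<^bsub>Y\<^esub> f y)) = nrm Y ((f x \<oplus>\<^bsub>Y\<^esub> f y) \<ominus>\<^bsub>Y\<^esub> (S c \<oplus>\<^bsub>Y\<^esub> S d))"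
      unfolding S'(2) using xy by (intro Y.nrm_diff) auto
    also have "\<dots> \<le> nrm Y (f x \<ominus>\<^bsub>Y\<^esub> S c) + nrm Y (f y \<ominus>\<^bsub>Y\<^esub> S d)"
      using xy by (intro Y.nrm_add_diff_add) auto
    also have "\<dots> \<le> e / 4 + e / 4"
      using fS[OF xy(1), of c] fS[OF xy(2), of d] c d by linarith
    finally show "nrm Y (f (x \<oplus>\<^bsub>X\<^esub> y) \<ominus>\<^bsub>Y\<^esub> (f x \<oplus>\<^bsub>Y\<^esub> f y)) \<le> e"
      using c d by (simp add: distrib_left)
  qed (use xy in auto)
  moreover have "f (r \<odot>\<^bsub>X\<^esub> x) = r \<odot>\<^bsub>Y\<^esub> f x" if x: "x \<in> carrier X" for r x
  proof (rule Y.eqI_small)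
    fix e :: real assume e: "0 < e"
    let ?r = "2 * \<bar>r\<bar> + 1"
    obtain c where c: "C * nrm X (x \<ominus>\<^bsub>X\<^esub> T c) \<le> e / ?r"
      using dense[OF x, of "e / ?r"] e by (auto simp: add_pos_nonneg)
    have "nrm Y (f (r \<odot>\<^bsub>X\<^esub> x) \<ominus>\<^bsub>Y\<^esub> r \<odot>\<^bsub>Y\<^esub> f x) \<le>
        nrm Y (f (r \<odot>\<^bsub>X\<^esub> x) \<ominus>\<^bsub>Y\<^esub> S (r *\<^sub>R c)) + nrm Y (S (r *\<^sub>R c) \<ominus>\<^bsub>Y\<^esub> r \<odot>\<^bsub>Y\<^esub> f x)"
      using x by (intro Y.nrm_triangle_diff) auto
    also have "nrm Y (f (r \<odot>\<^bsub>X\<^esub> x) \<ominus>\<^bsub>Y\<^esub> S (r *\<^sub>R c)) \<le> C * nrm X (r \<odot>\<^bsub>X\<^esub> x \<ominus>\<^bsub>X\<^esub> T (r *\<^sub>R c))"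
      using x by (intro fS) auto
    also have "\<dots> = \<bar>r\<bar> * (C * nrm X (x \<ominus>\<^bsub>X\<^esub> T c))"
      using x by (simp add: T'(3) X.nrm_smult flip: X.sm_diff)
    also have "nrm Y (S (r *\<^sub>R c) \<ominus>\<^bsub>Y\<^esub> r \<odot>\<^bsub>Y\<^esub> f x) = \<bar>r\<bar> * nrm Y (f x \<ominus>\<^bsub>Y\<^esub> S c)"
      using x by (simp add: S'(3) Y.nrm_smult Y.nrm_diff[of "f x"] flip: Y.sm_diff)
    also have "\<dots> \<le> \<bar>r\<bar> * (C * nrm X (x \<ominus>\<^bsub>X\<^esub> T c))"
      using x by (intro mult_left_mono fS) auto
    finally have "nrm Y (f (r \<odot>\<^bsub>X\<^esub> x) \<ominus>\<^bsub>Y\<^esub> r \<odot>\<^bsub>Y\<^esub> f x) \<le> (2 * \<bar>r\<bar>) * (C * nrm X (x \<ominus>\<^bsub>X\<^esub> T c))"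
      by (simp add: mult_ac)
    also have "\<dots> \<le> ?r * (e / ?r)"
      using c C(1) e x by (intro mult_mono) (auto simp: X.nrm_nonneg)
    also have "\<dots> = e" by (simp add: add_pos_nonneg)
    finally show "nrm Y (f (r \<odot>\<^bsub>X\<^esub> x) \<ominus>\<^bsub>Y\<^esub> r \<odot>\<^bsub>Y\<^esub> f x) \<le> e" .
  qed (use x in auto)
  ultimately have "linear_map X Y f" by (auto simp: linear_map_def)
  moreover have "f (T c) = S c" for c
    using fS[of "T c" c] Y.nrm_nonneg[of "f (T c) \<ominus>\<^bsub>Y\<^esub> S c"] by (intro Y.diff_eq_zeroD) auto
  moreover have "nrm Y (f x) \<le> C * nrm X x" if "x \<in> carrier X" for x
    using fS[OF that, of 0] that by (simp add: T'(4) S'(4))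
  ultimately show ?thesis using that by blast
qed

lemma continuous_ntop_bounded:
  assumes X: "normed_space X" and Y: "normed_space Y" and f: "linear_map X Y f"
    and C: "0 < C" "\<And>x. x \<in> carrier X \<Longrightarrow> nrm Y (f x) \<le> C * nrm X x"
  shows "continuous_map (ntop X) (ntop Y) f"
proof -
  interpret X: normed_space X by fact
  interpret Y: normed_space Y by fact
  have fc: "f \<in> carrier X \<rightarrow> carrier Y" using f by (simp add: linear_map_def)
  have "\<exists>d>0. \<forall>x\<in>carrier X. nrm X (a \<ominus>\<^bsub>X\<^esub> x) < d \<longrightarrow> nrm Y (f a \<ominus>\<^bsub>Y\<^esub> f x) < e"
    if a: "a \<in> carrier X" and e: "0 < e" for a e
  proof (intro exI[of _ "e / C"] conjI ballI impI)
    fix x assume x: "x \<in> carrier X" "nrm X (a \<ominus>\<^bsub>X\<^esub> x) < e / C"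
    have "f (a \<ominus>\<^bsub>X\<^esub> x) = f a \<ominus>\<^bsub>Y\<^esub> f x"
      using f a x(1) fc X.sm_closed[of x "- 1"]
      by (simp add: linear_map_def a_minus_def Pi_iff flip: X.sm_minus_one Y.sm_minus_one)
    then have "nrm Y (f a \<ominus>\<^bsub>Y\<^esub> f x) \<le> C * nrm X (a \<ominus>\<^bsub>X\<^esub> x)"
      using C(2)[of "a \<ominus>\<^bsub>X\<^esub> x"] a x(1) by (simp add: X.M.minus_closed)
    then show "nrm Y (f a \<ominus>\<^bsub>Y\<^esub> f x) < e"
      using x(2) C(1) by (simp add: pos_less_divide_eq mult.commute)
  qed (use e C in simp)
  then show ?thesis
    unfolding continuous_ntop_iff[OF X Y] using fc by blast
qed

text \<open>The correspondence between \<open>T c\<close> and \<open>S c\<close> extends to bounded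
  maps in both directions; their compositions are the identity on dense subspaces, hence
  everywhere.\<close>

theorem isomorphic_of_dense:
  assumes X: "banach_space X" and Y: "banach_space Y"
    and T: "lin_c00 X T" "dense_c00 X T" and S: "lin_c00 Y S" "dense_c00 Y S"
    and C: "0 < C" "\<And>c. nrm Y (S c) \<le> C * nrm X (T c)" "\<And>c. nrm X (T c) \<le> C * nrm Y (S c)"
  shows "X \<simeq>\<^sub>l Y"
proof -
  have nX: "normed_space X" and nY: "normed_space Y" using X Y by (auto simp: banach_space_def)
  interpret X: normed_space X by fact
  interpret Y: normed_space Y by fact
  obtain f where f: "linear_map X Y f" "\<And>c. f (T c) = S c"
    "\<And>x. x \<in> carrier X \<Longrightarrow> nrm Y (f x) \<le> C * nrm X x"
    by (rule extend_lin_c00[OF nX Y T S(1) C(1,2)], rule that)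
  obtain g where g: "linear_map Y X g" "\<And>c. g (S c) = T c"
    "\<And>y. y \<in> carrier Y \<Longrightarrow> nrm X (g y) \<le> C * nrm Y y"
    by (rule extend_lin_c00[OF nY X S T(1) C(1,3)], rule that)
  \<comment> \<open>Stated for arbitrary spaces so that it covers both compositions.\<close>
  have inv: "h' (h x) = x" if "x \<in> carrier A" "normed_space A" "normed_space B"
    "linear_map A B h" "linear_map B A h'" "dense_c00 A R" "\<And>c. h' (h (R c)) = R c" "\<And>c. R c \<in> carrier A"
    "\<And>x. x \<in> carrier A \<Longrightarrow> nrm B (h x) \<le> C * nrm A x"
    "\<And>y. y \<in> carrier B \<Longrightarrow> nrm A (h' y) \<le> C * nrm B y"
    for A :: "'x nspace" and B :: "'y nspace" and h h' R x
  proof -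
    note dense = that(1,6)
    interpret A: normed_space A by fact
    interpret B: normed_space B by fact
    have hc: "h z \<in> carrier B" if "z \<in> carrier A" for z
      using that \<open>linear_map A B h\<close> by (auto simp: linear_map_def)
    have hc': "h' z \<in> carrier A" if "z \<in> carrier B" for z
      using that \<open>linear_map B A h'\<close> by (auto simp: linear_map_def)
    have hd: "h' (h (a \<ominus>\<^bsub>A\<^esub> b)) = h' (h a) \<ominus>\<^bsub>A\<^esub> h' (h b)" if "a \<in> carrier A" "b \<in> carrier A" for a b
      using that \<open>linear_map A B h\<close> \<open>linear_map B A h'\<close> hc hc' A.sm_closed[of b "- 1"] B.sm_closed[of "h b" "- 1"]
      by (simp add: linear_map_def a_minus_def flip: A.sm_minus_one)
    show ?thesis
    proof (rule A.eqI_small)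
      fix e :: real assume e: "0 < e"
      have "0 < e / (C * C + 1)" using e C(1) by (simp add: add_pos_pos)
      then obtain c where c: "nrm A (x \<ominus>\<^bsub>A\<^esub> R c) < e / (C * C + 1)"
        using dense unfolding dense_c00_def by blast
      have x: "x \<ominus>\<^bsub>A\<^esub> R c \<in> carrier A" using that by (simp add: A.M.minus_closed)
      have "nrm A (h' (h x) \<ominus>\<^bsub>A\<^esub> x) \<le> nrm A (h' (h x) \<ominus>\<^bsub>A\<^esub> R c) + nrm A (R c \<ominus>\<^bsub>A\<^esub> x)"
        using that hc hc' by (intro A.nrm_triangle_diff) auto
      also have "nrm A (h' (h x) \<ominus>\<^bsub>A\<^esub> R c) = nrm A (h' (h (x \<ominus>\<^bsub>A\<^esub> R c)))"
        using that by (simp add: hd)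
      also have "\<dots> \<le> C * nrm B (h (x \<ominus>\<^bsub>A\<^esub> R c))"
        using x hc by (intro that(10)) auto
      also have "\<dots> \<le> C * (C * nrm A (x \<ominus>\<^bsub>A\<^esub> R c))"
        using x C(1) by (intro mult_left_mono that(9)) auto
      also have "nrm A (R c \<ominus>\<^bsub>A\<^esub> x) = nrm A (x \<ominus>\<^bsub>A\<^esub> R c)"
        using that by (intro A.nrm_diff) auto
      finally have "nrm A (h' (h x) \<ominus>\<^bsub>A\<^esub> x) \<le> nrm A (x \<ominus>\<^bsub>A\<^esub> R c) * (C * C + 1)"
        by (simp add: algebra_simps)
      also have "\<dots> \<le> e" using c C(1) by (simp add: pos_less_divide_eq add_pos_pos)
      finally show "nrm A (h' (h x) \<ominus>\<^bsub>A\<^esub> x) \<le> e" .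
    qed (use that hc hc' in auto)
  qed
  have "homeomorphic_maps (ntop X) (ntop Y) f g"
    unfolding homeomorphic_maps_def
  proof (intro conjI ballI)
    show "continuous_map (ntop X) (ntop Y) f"
      by (rule continuous_ntop_bounded[OF nX nY f(1) C(1) f(3)])
    show "continuous_map (ntop Y) (ntop X) g"
      by (rule continuous_ntop_bounded[OF nY nX g(1) C(1) g(3)])
    fix x assume "x \<in> topspace (ntop X)"
    then have "x \<in> carrier X" by simp
    then show "g (f x) = x"
      by (rule inv[OF _ nX nY f(1) g(1) T(2) _ _ f(3) g(3)]) (simp_all add: f(2) g(2) X.lin_c00D(1)[OF T(1)])
  next
    fix y assume "y \<in> topspace (ntop Y)"
    then have "y \<in> carrier Y" by simp
    then show "f (g y) = y"
      by (rule inv[OF _ nY nX g(1) f(1) S(2) _ _ g(3) f(3)]) (simp_all add: f(2) g(2) Y.lin_c00D(1)[OF S(1)])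
  qed
  then show ?thesis
    using f(1) unfolding linearly_isomorphic_def homeomorphic_map_maps by blast
qed

lemma continuous_linear_bounded:
  assumes X: "normed_space X" and Y: "normed_space Y" and f: "linear_map X Y f"
    and cont: "continuous_map (ntop X) (ntop Y) f"
  obtains C where "0 < C" "\<And>x. x \<in> carrier X \<Longrightarrow> nrm Y (f x) \<le> C * nrm X x"
proof -
  interpret X: normed_space X by fact
  interpret Y: normed_space Y by fact
  have fc: "f x \<in> carrier Y" if "x \<in> carrier X" for x
    using f that by (auto simp: linear_map_def)
  have fs: "f (c \<odot>\<^bsub>X\<^esub> x) = c \<odot>\<^bsub>Y\<^esub> f x" if "x \<in> carrier X" for c x
    using f that by (auto simp: linear_map_def)
  have f0: "f \<zero>\<^bsub>X\<^esub> = \<zero>\<^bsub>Y\<^esub>"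
    using fs[of "\<zero>\<^bsub>X\<^esub>" 0] fc[of "\<zero>\<^bsub>X\<^esub>"] by simp
  obtain d where d: "0 < d"
    "\<And>x. x \<in> carrier X \<Longrightarrow> nrm X (\<zero>\<^bsub>X\<^esub> \<ominus>\<^bsub>X\<^esub> x) < d \<Longrightarrow> nrm Y (f \<zero>\<^bsub>X\<^esub> \<ominus>\<^bsub>Y\<^esub> f x) < 1"
    using cont X.M.zero_closed unfolding continuous_ntop_iff[OF X Y] by (metis zero_less_one)
  have d2: "nrm Y (f x) < 1" if "x \<in> carrier X" "nrm X x < d" for x
    using d(2)[of x] that fc[of x] X.nrm_diff[of x "\<zero>\<^bsub>X\<^esub>"] Y.nrm_diff[of "f x" "\<zero>\<^bsub>Y\<^esub>"] by (simp add: f0)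
  have "nrm Y (f x) \<le> 2 / d * nrm X x" if x: "x \<in> carrier X" for x
  proof (rule ccontr)
    assume "\<not> ?thesis"
    then have less: "2 / d * nrm X x < nrm Y (f x)" by simp
    then have pos: "0 < nrm Y (f x)"
      using X.nrm_nonneg[OF x] d(1) by (meson divide_nonneg_pos le_less_trans mult_nonneg_nonneg zero_le_numeral)
    let ?c = "1 / nrm Y (f x)"
    have "nrm X (?c \<odot>\<^bsub>X\<^esub> x) = nrm X x / nrm Y (f x)"
      using pos x by (simp add: X.nrm_smult)
    also have "\<dots> < d"
      using less pos d(1) X.nrm_nonneg[OF x] by (simp add: field_simps)
    finally have "nrm Y (f (?c \<odot>\<^bsub>X\<^esub> x)) < 1" using x by (intro d2) auto
    then show False using pos x fc by (simp add: fs Y.nrm_smult)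
  qed
  then show ?thesis using d(1) by (intro that[of "2 / d"]) auto
qed

text \<open>Converse of \<open>isomorphic_of_dense\<close>: a dense map is transported along an
  isomorphism, at the cost of a constant.\<close>

lemma isomorphic_dense:
  assumes X: "normed_space X" and Y: "normed_space Y" and iso: "X \<simeq>\<^sub>l Y"
    and T: "lin_c00 X T" "dense_c00 X T"
  obtains S C where "lin_c00 Y S" "dense_c00 Y S" "0 < C"
    "\<And>c. nrm Y (S c) \<le> C * nrm X (T c)" "\<And>c. nrm X (T c) \<le> C * nrm Y (S c)"
proof -
  interpret X: normed_space X by fact
  interpret Y: normed_space Y by fact
  obtain f where f: "linear_map X Y f" "homeomorphic_map (ntop X) (ntop Y) f"
    using iso by (auto simp: linearly_isomorphic_def)
  then obtain g where fg: "homeomorphic_maps (ntop X) (ntop Y) f g"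
    by (auto simp: homeomorphic_map_maps)
  have gf: "g (f x) = x" if "x \<in> carrier X" for x
    using fg that by (simp add: homeomorphic_maps_def)
  have fg': "f (g y) = y" if "y \<in> carrier Y" for y
    using fg that by (simp add: homeomorphic_maps_def)
  have cont: "continuous_map (ntop X) (ntop Y) f" "continuous_map (ntop Y) (ntop X) g"
    using fg by (simp_all add: homeomorphic_maps_def)
  have gc: "g y \<in> carrier X" if "y \<in> carrier Y" for y
    using cont(2) that by (auto simp: continuous_ntop_iff[OF Y X])
  have fc: "f x \<in> carrier Y" if "x \<in> carrier X" for x
    using f(1) that by (auto simp: linear_map_def)
  have fa: "f (x \<oplus>\<^bsub>X\<^esub> y) = f x \<oplus>\<^bsub>Y\<^esub> f y" if "x \<in> carrier X" "y \<in> carrier X" for x y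
    using f(1) that by (auto simp: linear_map_def)
  have fs: "f (c \<odot>\<^bsub>X\<^esub> x) = c \<odot>\<^bsub>Y\<^esub> f x" if "x \<in> carrier X" for c x
    using f(1) that by (auto simp: linear_map_def)
  have "linear_map Y X g"
    unfolding linear_map_def
  proof (intro conjI ballI allI)
    show "g (x \<oplus>\<^bsub>Y\<^esub> y) = g x \<oplus>\<^bsub>X\<^esub> g y" if "x \<in> carrier Y" "y \<in> carrier Y" for x y
      using gf[of "g x \<oplus>\<^bsub>X\<^esub> g y"] fa[of "g x" "g y"] that by (simp add: gc fg')
    show "g (c \<odot>\<^bsub>Y\<^esub> x) = c \<odot>\<^bsub>X\<^esub> g x" if "x \<in> carrier Y" for c x
      using gf[of "c \<odot>\<^bsub>X\<^esub> g x"] fs[of "g x" c] that by (simp add: gc fg')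
  qed (use gc in auto)
  then obtain C' where C': "0 < C'" "\<And>y. y \<in> carrier Y \<Longrightarrow> nrm X (g y) \<le> C' * nrm Y y"
    using continuous_linear_bounded[OF Y X _ cont(2)] by blast
  obtain C where C: "0 < C" "\<And>x. x \<in> carrier X \<Longrightarrow> nrm Y (f x) \<le> C * nrm X x"
    using continuous_linear_bounded[OF X Y f(1) cont(1)] by blast
  note Tc = X.lin_c00D[OF T(1)]
  let ?C = "max C C'"
  show ?thesis
  proof (rule that[of "\<lambda>c. f (T c)" ?C])
    show "lin_c00 Y (\<lambda>c. f (T c))"
      using Tc fa fs fc by (simp add: lin_c00_def)
    show "0 < ?C" using C by simp
    show "nrm Y (f (T c)) \<le> ?C * nrm X (T c)" for c
      using C(2)[OF Tc(1), of c] X.nrm_nonneg[OF Tc(1), of c]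
      by (meson max.cobounded1 mult_right_mono order_trans)
    show "nrm X (T c) \<le> ?C * nrm Y (f (T c))" for c
      using C'(2)[OF fc[OF Tc(1)], of c] Y.nrm_nonneg[OF fc[OF Tc(1)], of c]
      by (simp add: gf[OF Tc(1)]) (meson max.cobounded2 mult_right_mono order_trans)
    show "dense_c00 Y (\<lambda>c. f (T c))"
      unfolding dense_c00_def
    proof (intro ballI allI impI)
      fix y and e :: real assume y: "y \<in> carrier Y" and e: "0 < e"
      obtain c where c: "nrm X (g y \<ominus>\<^bsub>X\<^esub> T c) < e / C"
        using T(2) gc[OF y] e C(1) unfolding dense_c00_def by (metis divide_pos_pos)
      have "f (g y \<ominus>\<^bsub>X\<^esub> T c) = y \<ominus>\<^bsub>Y\<^esub> f (T c)"
        using fa[of "g y" "(- 1) \<odot>\<^bsub>X\<^esub> T c"] fs[of "T c" "- 1"] gc[OF y] Tc(1)[of c] fc fg'[OF y]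
        by (simp add: a_minus_def X.sm_minus_one Y.sm_minus_one)
      then have "nrm Y (y \<ominus>\<^bsub>Y\<^esub> f (T c)) \<le> C * nrm X (g y \<ominus>\<^bsub>X\<^esub> T c)"
        using C(2)[of "g y \<ominus>\<^bsub>X\<^esub> T c"] gc[OF y] Tc(1)[of c] by (simp add: X.M.minus_closed)
      also have "\<dots> < e" using c C(1) by (simp add: pos_less_divide_eq mult.commute)
      finally show "\<exists>c. nrm Y (y \<ominus>\<^bsub>Y\<^esub> f (T c)) < e" by blast
    qed
  qed
qed

section \<open>Quotients and completions\<close>

text \<open>Transport of the axioms along a surjection that respects all operations, so that they
  need not be verified on cosets.\<close>

lemma pseudonormed_space_image:
  fixes Y :: "'a nspace" and Q :: "'b nspace"
  assumes Y: "pseudonormed_space Y" and car: "carrier Q = \<kappa> ` carrier Y"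
    and zero: "\<zero>\<^bsub>Q\<^esub> = \<kappa> \<zero>\<^bsub>Y\<^esub>"
    and add: "\<And>x y. x \<in> carrier Y \<Longrightarrow> y \<in> carrier Y \<Longrightarrow> \<kappa> x \<oplus>\<^bsub>Q\<^esub> \<kappa> y = \<kappa> (x \<oplus>\<^bsub>Y\<^esub> y)"
    and smult: "\<And>c x. x \<in> carrier Y \<Longrightarrow> c \<odot>\<^bsub>Q\<^esub> \<kappa> x = \<kappa> (c \<odot>\<^bsub>Y\<^esub> x)"
    and nrm: "\<And>x. x \<in> carrier Y \<Longrightarrow> nrm Q (\<kappa> x) = nrm Y x"
  shows "pseudonormed_space Q"
    and "\<And>x y. x \<in> carrier Y \<Longrightarrow> y \<in> carrier Y \<Longrightarrow> \<kappa> x \<ominus>\<^bsub>Q\<^esub> \<kappa> y = \<kappa> (x \<ominus>\<^bsub>Y\<^esub> y)"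
proof -
  interpret Y: pseudonormed_space Y by fact
  have group: "abelian_group Q"
  proof (rule abelian_groupI)
    fix x assume "x \<in> carrier Q"
    then obtain a where a: "a \<in> carrier Y" "x = \<kappa> a" using car by auto
    then have "\<kappa> (\<ominus>\<^bsub>Y\<^esub> a) \<oplus>\<^bsub>Q\<^esub> x = \<zero>\<^bsub>Q\<^esub>" by (simp add: add zero Y.M.l_neg)
    then show "\<exists>y\<in>carrier Q. y \<oplus>\<^bsub>Q\<^esub> x = \<zero>\<^bsub>Q\<^esub>" using a car by auto
  qed (auto simp: car zero add Y.M.a_ac)
  have "module real_ring Q"
    by (rule moduleI[OF cring_real_ring group])
       (auto simp: car smult add Y.sm_add Y.sm_add_left Y.sm_mult)
  then show Q: "pseudonormed_space Q"
    by (intro pseudonormed_space.intro pseudonormed_space_axioms.intro)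
       (auto simp: car smult add nrm Y.nrm_nonneg Y.nrm_smult Y.nrm_triangle)
  interpret Q: pseudonormed_space Q by fact
  fix x y assume xy: "x \<in> carrier Y" "y \<in> carrier Y"
  have "\<ominus>\<^bsub>Q\<^esub> \<kappa> y = \<kappa> (\<ominus>\<^bsub>Y\<^esub> y)"
    using smult[OF xy(2), of "- 1"] Q.sm_minus_one[of "\<kappa> y"] xy car by (simp add: Y.sm_minus_one)
  then show "\<kappa> x \<ominus>\<^bsub>Q\<^esub> \<kappa> y = \<kappa> (x \<ominus>\<^bsub>Y\<^esub> y)"
    using xy by (simp add: a_minus_def add)
qed

definition null_coset :: "'a nspace \<Rightarrow> 'a \<Rightarrow> 'a set" where
  "null_coset Y x = null_space Y +>\<^bsub>Y\<^esub> x"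

context pseudonormed_space
begin

lemma null_coset_eq:
  assumes x: "x \<in> carrier X"
  shows "null_coset X x = {z \<in> carrier X. nrm X (z \<ominus> x) = 0}"
proof -
  have "\<exists>h\<in>null_space X. z = h \<oplus> x" if z: "z \<in> carrier X" "nrm X (z \<ominus> x) = 0" for z
    using z x by (intro bexI[of _ "z \<ominus> x"])
      (auto simp: null_space_def a_minus_def M.a_assoc M.l_neg)
  moreover have "nrm X ((h \<oplus> x) \<ominus> x) = 0" if "h \<in> null_space X" for h
    using that x by (auto simp: null_space_def a_minus_def M.a_assoc M.r_neg)
  ultimately show ?thesis
    using x by (auto simp: null_coset_def a_r_coset_def' null_space_def)
qed

lemma nrm_cong_null:
  assumes "x \<in> carrier X" "z \<in> carrier X" "nrm X (z \<ominus> x) = 0"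
  shows "nrm X z = nrm X x"
  using nrm_abs_diff[OF assms(2,1)] assms(3) by simp

lemma null_coset_eq_iff:
  assumes "x \<in> carrier X" "y \<in> carrier X"
  shows "null_coset X x = null_coset X y \<longleftrightarrow> nrm X (x \<ominus> y) = 0"
proof
  assume "null_coset X x = null_coset X y"
  moreover have "x \<in> null_coset X x" using assms by (simp add: null_coset_eq)
  ultimately show "nrm X (x \<ominus> y) = 0" using assms by (simp add: null_coset_eq)
next
  assume 0: "nrm X (x \<ominus> y) = 0"
  have "nrm X (z \<ominus> x) = 0 \<longleftrightarrow> nrm X (z \<ominus> y) = 0" if z: "z \<in> carrier X" for z
    using nrm_triangle_diff[of z x y] nrm_triangle_diff[of z y x] 0 nrm_diff[of x y] assms z
      nrm_nonneg[of "z \<ominus> x"] nrm_nonneg[of "z \<ominus> y"] M.minus_closed by fastforce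
  then show "null_coset X x = null_coset X y"
    using assms by (auto simp: null_coset_eq)
qed

lemma null_coset_closed_diff:
  assumes "x \<in> carrier X" "y \<in> carrier X" "u \<in> null_coset X x" "v \<in> null_coset X y"
  shows "u \<oplus> v \<in> null_coset X (x \<oplus> y)" "c \<odot> u \<in> null_coset X (c \<odot> x)"
proof -
  have uv: "u \<in> carrier X" "v \<in> carrier X" "nrm X (u \<ominus> x) = 0" "nrm X (v \<ominus> y) = 0"
    using assms by (auto simp: null_coset_eq)
  then have "nrm X ((u \<oplus> v) \<ominus> (x \<oplus> y)) \<le> 0"
    using nrm_add_diff_add[of u v x y] assms by simp
  then show "u \<oplus> v \<in> null_coset X (x \<oplus> y)"
    using uv assms nrm_nonneg[of "(u \<oplus> v) \<ominus> (x \<oplus> y)"] by (simp add: null_coset_eq M.minus_closed)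
  have "nrm X (c \<odot> u \<ominus> c \<odot> x) = 0"
    using uv assms by (simp add: nrm_smult M.minus_closed flip: sm_diff)
  then show "c \<odot> u \<in> null_coset X (c \<odot> x)"
    using uv assms by (simp add: null_coset_eq)
qed

lemma quotient_simps:
  shows "carrier (quotient_by_null X) = null_coset X ` carrier X"
    and "\<zero>\<^bsub>quotient_by_null X\<^esub> = null_coset X \<zero>"
    and "\<And>x y. x \<in> carrier X \<Longrightarrow> y \<in> carrier X \<Longrightarrow>
      null_coset X x \<oplus>\<^bsub>quotient_by_null X\<^esub> null_coset X y = null_coset X (x \<oplus> y)"
    and "\<And>c x. x \<in> carrier X \<Longrightarrow> c \<odot>\<^bsub>quotient_by_null X\<^esub> null_coset X x = null_coset X (c \<odot> x)"
    and "\<And>x. x \<in> carrier X \<Longrightarrow> nrm (quotient_by_null X) (null_coset X x) = nrm X x"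
proof -
  show "carrier (quotient_by_null X) = null_coset X ` carrier X"
    by (auto simp: quotient_by_null_def A_RCOSETS_def' null_coset_def)
  show "\<zero>\<^bsub>quotient_by_null X\<^esub> = null_coset X \<zero>"
    by (auto simp: quotient_by_null_def null_coset_eq null_space_def)
next
  fix x y assume xy: "x \<in> carrier X" "y \<in> carrier X"
  have "z \<in> null_coset X x <+>\<^bsub>X\<^esub> null_coset X y" if z: "z \<in> null_coset X (x \<oplus> y)" for z
  proof -
    have zc: "z \<in> carrier X" "nrm X (z \<ominus> (x \<oplus> y)) = 0" using z xy by (simp_all add: null_coset_eq)
    have "z \<ominus> y \<ominus> x = z \<ominus> (x \<oplus> y)" using zc xy by (simp add: a_minus_def M.minus_add M.a_ac)
    then have "z \<ominus> y \<in> null_coset X x" using zc xy by (simp add: null_coset_eq M.minus_closed)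
    moreover have "y \<in> null_coset X y" using xy by (simp add: null_coset_eq)
    moreover have "z = (z \<ominus> y) \<oplus> y" using zc xy by (simp add: a_minus_def M.a_assoc M.l_neg)
    ultimately show ?thesis unfolding set_add_def' by blast
  qed
  then have "null_coset X x <+>\<^bsub>X\<^esub> null_coset X y = null_coset X (x \<oplus> y)"
    using null_coset_closed_diff(1)[OF xy] unfolding set_add_def' by blast
  then show "null_coset X x \<oplus>\<^bsub>quotient_by_null X\<^esub> null_coset X y = null_coset X (x \<oplus> y)"
    by (simp add: quotient_by_null_def)
next
  fix c x assume x: "x \<in> carrier X"
  have xx: "x \<in> null_coset X x" using x by (simp add: null_coset_eq)
  have "null_coset X (c \<odot> a) = null_coset X (c \<odot> x)" if a: "a \<in> null_coset X x" for a
  proof -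
    have "a \<in> carrier X" using a x by (simp add: null_coset_eq)
    moreover have "nrm X (c \<odot> a \<ominus> c \<odot> x) = 0"
      using null_coset_closed_diff(2)[OF x x a a, of c] x by (simp add: null_coset_eq)
    ultimately show ?thesis using x by (simp add: null_coset_eq_iff)
  qed
  moreover have "null_coset X x \<noteq> {}" using xx by blast
  ultimately have "(\<Union>a\<in>null_coset X x. null_coset X (c \<odot> a)) = null_coset X (c \<odot> x)"
    by (intro SUP_eq_const)
  then show "c \<odot>\<^bsub>quotient_by_null X\<^esub> null_coset X x = null_coset X (c \<odot> x)"
    by (simp add: quotient_by_null_def null_coset_def)
next
  fix x assume x: "x \<in> carrier X"
  have "nrm X z = nrm X x" if "z \<in> null_coset X x" for z
    using that x nrm_cong_null[OF x, of z] by (simp add: null_coset_eq)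
  moreover have "x \<in> null_coset X x" using x by (simp add: null_coset_eq)
  ultimately have "nrm X ` null_coset X x = {nrm X x}"
    using image_constant[of x "null_coset X x" "nrm X x"] image_cong[of "null_coset X x" _ "nrm X" "\<lambda>_. nrm X x"] by metis
  then show "nrm (quotient_by_null X) (null_coset X x) = nrm X x"
    by (simp add: quotient_by_null_def)
qed

lemma normed_quotient: "normed_space (quotient_by_null X)"
  and quotient_diff: "\<And>x y. x \<in> carrier X \<Longrightarrow> y \<in> carrier X \<Longrightarrow>
    null_coset X x \<ominus>\<^bsub>quotient_by_null X\<^esub> null_coset X y = null_coset X (x \<ominus> y)"
proof -
  note Q = pseudonormed_space_image[OF pseudonormed_space_axioms quotient_simps]
  show "normed_space (quotient_by_null X)"
  proof (intro normed_space.intro Q(1) normed_space_axioms.intro)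
    fix A assume "A \<in> carrier (quotient_by_null X)" "nrm (quotient_by_null X) A = 0"
    then obtain x where x: "x \<in> carrier X" "A = null_coset X x" "nrm X x = 0"
      by (auto simp: quotient_simps(1,5))
    then have "null_coset X x = null_coset X \<zero>"
      by (subst null_coset_eq_iff) simp_all
    then show "A = \<zero>\<^bsub>quotient_by_null X\<^esub>" using x by (simp add: quotient_simps(2))
  qed
  show "\<And>x y. x \<in> carrier X \<Longrightarrow> y \<in> carrier X \<Longrightarrow>
    null_coset X x \<ominus>\<^bsub>quotient_by_null X\<^esub> null_coset X y = null_coset X (x \<ominus> y)"
    by (rule Q(2))
qed

end

context normed_space
begin

lemma in_cauchy_sequences:
  "s \<in> carrier (cauchy_sequences X) \<longleftrightarrow>
    (\<forall>n. s n \<in> carrier X) \<and> (\<forall>e>0. \<exists>N. \<forall>m\<ge>N. \<forall>n\<ge>N. nrm X (s m \<ominus> s n) < e)"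
  by (simp add: cauchy_sequences_def MCauchy_iff)

lemma cauchy_sequencesD:
  "s \<in> carrier (cauchy_sequences X) \<Longrightarrow> 0 < e \<Longrightarrow> \<exists>N. \<forall>m\<ge>N. \<forall>n\<ge>N. nrm X (s m \<ominus> s n) < e"
  by (simp add: in_cauchy_sequences)

lemma cauchy_tendsto:
  assumes s: "s \<in> carrier (cauchy_sequences X)"
  shows "(\<lambda>n. nrm X (s n)) \<longlonglongrightarrow> nrm (cauchy_sequences X) s"
proof -
  have sc: "s n \<in> carrier X" for n using s by (simp add: in_cauchy_sequences)
  have "Cauchy (\<lambda>n. nrm X (s n))"
    unfolding Cauchy_def
  proof (intro allI impI)
    fix e :: real assume "0 < e"
    then obtain N where "\<forall>m\<ge>N. \<forall>n\<ge>N. nrm X (s m \<ominus> s n) < e"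
      using cauchy_sequencesD[OF s] by blast
    then have "\<forall>m\<ge>N. \<forall>n\<ge>N. dist (nrm X (s m)) (nrm X (s n)) < e"
      unfolding dist_real_def by (meson le_less_trans nrm_abs_diff[OF sc sc])
    then show "\<exists>N. \<forall>m\<ge>N. \<forall>n\<ge>N. dist (nrm X (s m)) (nrm X (s n)) < e"
      by blast
  qed
  then show ?thesis
    by (simp add: cauchy_sequences_def Cauchy_convergent_iff convergent_LIMSEQ_iff)
qed

lemma cauchy_sequences_add:
  assumes "s \<in> carrier (cauchy_sequences X)" "t \<in> carrier (cauchy_sequences X)"
  shows "(\<lambda>n. s n \<oplus> t n) \<in> carrier (cauchy_sequences X)"
proof -
  have c: "s n \<in> carrier X" "t n \<in> carrier X" for n using assms by (simp_all add: in_cauchy_sequences)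
  have "\<exists>N. \<forall>m\<ge>N. \<forall>n\<ge>N. nrm X ((s m \<oplus> t m) \<ominus> (s n \<oplus> t n)) < e" if "0 < e" for e
  proof -
    have e2: "0 < e / 2" using that by simp
    obtain N1 where N1: "\<forall>m\<ge>N1. \<forall>n\<ge>N1. nrm X (s m \<ominus> s n) < e / 2"
      using cauchy_sequencesD[OF assms(1) e2] by blast
    obtain N2 where N2: "\<forall>m\<ge>N2. \<forall>n\<ge>N2. nrm X (t m \<ominus> t n) < e / 2"
      using cauchy_sequencesD[OF assms(2) e2] by blast
    have "nrm X ((s m \<oplus> t m) \<ominus> (s n \<oplus> t n)) < e" if "max N1 N2 \<le> m" "max N1 N2 \<le> n" for m n
    proof -
      have "nrm X (s m \<ominus> s n) < e / 2" "nrm X (t m \<ominus> t n) < e / 2" using N1 N2 that by auto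
      then show ?thesis using nrm_add_diff_add[OF c(1)[of m] c(2)[of m] c(1)[of n] c(2)[of n]] by linarith
    qed
    then show ?thesis by blast
  qed
  then show ?thesis using c by (simp add: in_cauchy_sequences)
qed

lemma cauchy_sequences_smult:
  assumes "s \<in> carrier (cauchy_sequences X)"
  shows "(\<lambda>n. c \<odot> s n) \<in> carrier (cauchy_sequences X)"
proof -
  have sc: "s n \<in> carrier X" for n using assms by (simp add: in_cauchy_sequences)
  have "\<exists>N. \<forall>m\<ge>N. \<forall>n\<ge>N. nrm X (c \<odot> s m \<ominus> c \<odot> s n) < e" if e: "0 < e" for e
  proof -
    have "0 < e / (\<bar>c\<bar> + 1)" using e by (simp add: add_nonneg_pos)
    then obtain N where N: "\<forall>m\<ge>N. \<forall>n\<ge>N. nrm X (s m \<ominus> s n) < e / (\<bar>c\<bar> + 1)"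
      using cauchy_sequencesD[OF assms] by blast
    have "nrm X (c \<odot> s m \<ominus> c \<odot> s n) < e" if "N \<le> m" "N \<le> n" for m n
    proof -
      have "nrm X (c \<odot> s m \<ominus> c \<odot> s n) = \<bar>c\<bar> * nrm X (s m \<ominus> s n)"
        using sc by (simp add: nrm_smult M.minus_closed flip: sm_diff)
      also have "\<dots> \<le> (\<bar>c\<bar> + 1) * nrm X (s m \<ominus> s n)"
        using sc by (intro mult_right_mono) (auto simp: nrm_nonneg M.minus_closed)
      also have "\<dots> < e" using N that by (simp add: pos_less_divide_eq mult.commute add_nonneg_pos)
      finally show ?thesis .
    qed
    then show ?thesis by blast
  qed
  then show ?thesis using sc by (simp add: in_cauchy_sequences)
qed

lemma cauchy_sequences_const: "x \<in> carrier X \<Longrightarrow> (\<lambda>_. x) \<in> carrier (cauchy_sequences X)"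
  by (simp add: in_cauchy_sequences)

lemma cauchy_sequences_simps:
  "\<zero>\<^bsub>cauchy_sequences X\<^esub> = (\<lambda>n. \<zero>)" "s \<oplus>\<^bsub>cauchy_sequences X\<^esub> t = (\<lambda>n. s n \<oplus> t n)"
  "c \<odot>\<^bsub>cauchy_sequences X\<^esub> s = (\<lambda>n. c \<odot> s n)"
  by (simp_all add: cauchy_sequences_def)

lemma pseudonormed_cauchy_sequences: "pseudonormed_space (cauchy_sequences X)"
proof -
  let ?S = "cauchy_sequences X"
  have c: "s n \<in> carrier X" if "s \<in> carrier ?S" for s n using that by (simp add: in_cauchy_sequences)
  have group: "abelian_group ?S"
  proof (rule abelian_groupI)
    fix s assume s: "s \<in> carrier ?S"
    have "(\<lambda>n. (- 1) \<odot> s n) \<oplus>\<^bsub>?S\<^esub> s = \<zero>\<^bsub>?S\<^esub>"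
      using c[OF s] by (simp add: cauchy_sequences_simps sm_minus_one M.l_neg)
    then show "\<exists>t\<in>carrier ?S. t \<oplus>\<^bsub>?S\<^esub> s = \<zero>\<^bsub>?S\<^esub>"
      using cauchy_sequences_smult[OF s, of "- 1"] by blast
  qed (auto simp: cauchy_sequences_simps cauchy_sequences_add cauchy_sequences_const c M.a_ac)
  have "module real_ring ?S"
    by (rule moduleI[OF cring_real_ring group])
       (auto simp: cauchy_sequences_simps cauchy_sequences_smult c sm_add sm_add_left sm_mult)
  then show ?thesis
  proof (intro pseudonormed_space.intro pseudonormed_space_axioms.intro)
    fix s t a assume s: "s \<in> carrier ?S"
    show "0 \<le> nrm ?S s"
      by (rule LIMSEQ_le_const[OF cauchy_tendsto[OF s]]) (use c[OF s] nrm_nonneg in auto)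
    show "nrm ?S (a \<odot>\<^bsub>?S\<^esub> s) = \<bar>a\<bar> * nrm ?S s"
    proof (rule LIMSEQ_unique)
      show "(\<lambda>n. nrm X (a \<odot> s n)) \<longlonglongrightarrow> nrm ?S (a \<odot>\<^bsub>?S\<^esub> s)"
        using cauchy_tendsto[OF cauchy_sequences_smult[OF s, of a]] by (simp add: cauchy_sequences_simps)
      show "(\<lambda>n. nrm X (a \<odot> s n)) \<longlonglongrightarrow> \<bar>a\<bar> * nrm ?S s"
        using tendsto_mult_left[OF cauchy_tendsto[OF s], of "\<bar>a\<bar>"] c[OF s] by (simp add: nrm_smult)
    qed
    assume t: "t \<in> carrier ?S"
    show "nrm ?S (s \<oplus>\<^bsub>?S\<^esub> t) \<le> nrm ?S s + nrm ?S t"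
    proof (rule LIMSEQ_le)
      show "(\<lambda>n. nrm X (s n \<oplus> t n)) \<longlonglongrightarrow> nrm ?S (s \<oplus>\<^bsub>?S\<^esub> t)"
        using cauchy_tendsto[OF cauchy_sequences_add[OF s t]] by (simp add: cauchy_sequences_simps)
      show "(\<lambda>n. nrm X (s n) + nrm X (t n)) \<longlonglongrightarrow> nrm ?S s + nrm ?S t"
        by (intro tendsto_add cauchy_tendsto s t)
      show "\<exists>N. \<forall>n\<ge>N. nrm X (s n \<oplus> t n) \<le> nrm X (s n) + nrm X (t n)"
        using c[OF s] c[OF t] nrm_triangle by blast
    qed
  qed
qed

definition const_class :: "'a \<Rightarrow> (nat \<Rightarrow> 'a) set" where
  "const_class x = null_coset (cauchy_sequences X) (\<lambda>_. x)"

text \<open>For completeness, the \<open>k\<close>-th member of a Cauchy sequence of classes is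
  approximated within \<open>1 / (k + 1)\<close> by a constant class. The approximating points of
  \<open>X\<close> form a Cauchy sequence, and the class of that sequence is the limit.\<close>

theorem completion_properties:
  shows "banach_space (completion X)"
    and "linear_map X (completion X) const_class"
    and "\<And>x. x \<in> carrier X \<Longrightarrow> nrm (completion X) (const_class x) = nrm X x"
    and "\<And>z e. z \<in> carrier (completion X) \<Longrightarrow> 0 < e \<Longrightarrow>
      \<exists>x\<in>carrier X. nrm (completion X) (z \<ominus>\<^bsub>completion X\<^esub> const_class x) < e"
proof -
  let ?S = "cauchy_sequences X" and ?Z = "completion X"
  let ?k = "null_coset ?S"
  interpret S: pseudonormed_space ?S by (rule pseudonormed_cauchy_sequences)
  interpret Z: normed_space ?Z unfolding completion_def by (rule S.normed_quotient)
  note Zs = S.quotient_simps[folded completion_def] and Zd = S.quotient_diff[folded completion_def]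
  note const = cauchy_sequences_const
  have c: "s n \<in> carrier X" if "s \<in> carrier ?S" for s n using that by (simp add: in_cauchy_sequences)
  have Sdiff: "(s \<ominus>\<^bsub>?S\<^esub> t) = (\<lambda>n. s n \<ominus> t n)" if "s \<in> carrier ?S" "t \<in> carrier ?S" for s t
    using that c[OF that(2)] S.sm_minus_one[OF that(2)]
    by (simp add: a_minus_def cauchy_sequences_simps sm_minus_one flip: S.sm_minus_one)
  have cc: "const_class x \<in> carrier ?Z" if "x \<in> carrier X" for x
    using that by (simp add: const_class_def Zs const)
  show lin: "linear_map X ?Z const_class"
    unfolding linear_map_def const_class_def
    by (auto simp: Zs const cauchy_sequences_simps)
  show nrm_const: "nrm ?Z (const_class x) = nrm X x" if "x \<in> carrier X" for x
    using that LIMSEQ_unique[OF cauchy_tendsto[OF const[OF that]]]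
    by (simp add: const_class_def Zs const)
  have dist_small: "nrm ?Z (?k s \<ominus>\<^bsub>?Z\<^esub> const_class (s n)) \<le> e"
    if s: "s \<in> carrier ?S" and e: "\<And>m. N \<le> m \<Longrightarrow> nrm X (s m \<ominus> s n) < e" for s n e N
  proof -
    have sn: "(\<lambda>_. s n) \<in> carrier ?S" using c[OF s] by (simp add: const)
    have "nrm ?Z (?k s \<ominus>\<^bsub>?Z\<^esub> const_class (s n)) = nrm ?S (\<lambda>m. s m \<ominus> s n)"
      using s sn by (simp add: const_class_def Zd Zs Sdiff S.M.minus_closed flip: Sdiff)
    also have "\<dots> \<le> e"
      by (rule LIMSEQ_le_const2[OF cauchy_tendsto])
         (use S.M.minus_closed[OF s sn] e in \<open>auto simp: Sdiff[OF s sn] intro: less_imp_le\<close>)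
    finally show ?thesis .
  qed
  show dense: "\<exists>x\<in>carrier X. nrm ?Z (z \<ominus>\<^bsub>?Z\<^esub> const_class x) < e"
    if z: "z \<in> carrier ?Z" and e: "0 < e" for z e
  proof -
    obtain s where s: "s \<in> carrier ?S" "z = ?k s" using z Zs(1) by auto
    obtain N where N: "\<forall>m\<ge>N. \<forall>n\<ge>N. nrm X (s m \<ominus> s n) < e / 2"
      using cauchy_sequencesD[OF s(1), of "e / 2"] e by auto
    then have "nrm ?Z (?k s \<ominus>\<^bsub>?Z\<^esub> const_class (s N)) \<le> e / 2"
      by (intro dist_small[OF s(1)]) auto
    then show ?thesis using s c[OF s(1)] e by (intro bexI[of _ "s N"]) auto
  qed
  show "banach_space ?Z"
  proof (rule banach_spaceI)
    show "normed_space ?Z" by (rule Z.normed_space_axioms)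
    fix z :: "nat \<Rightarrow> (nat \<Rightarrow> 'a) set"
    assume z: "\<And>n. z n \<in> carrier ?Z"
      and cau: "\<And>e. 0 < e \<Longrightarrow> \<exists>N. \<forall>m\<ge>N. \<forall>n\<ge>N. nrm ?Z (z m \<ominus>\<^bsub>?Z\<^esub> z n) < e"
    have "\<exists>x\<in>carrier X. nrm ?Z (z k \<ominus>\<^bsub>?Z\<^esub> const_class x) < inverse (real (Suc k))" for k
      using dense[OF z] by simp
    then obtain y where y: "\<And>k. y k \<in> carrier X"
      "\<And>k. nrm ?Z (z k \<ominus>\<^bsub>?Z\<^esub> const_class (y k)) < inverse (real (Suc k))" by metis
    have inv0: "\<exists>N. \<forall>k\<ge>N. inverse (real (Suc k)) < e" if "0 < e" for e :: real
      using order_tendstoD(2)[OF LIMSEQ_inverse_real_of_nat that] by (simp add: eventually_sequentially)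
    have ydiff: "nrm X (y m \<ominus> y n) = nrm ?Z (const_class (y m) \<ominus>\<^bsub>?Z\<^esub> const_class (y n))" for m n
    proof -
      have "const_class (y m) \<ominus>\<^bsub>?Z\<^esub> const_class (y n) = const_class (y m \<ominus> y n)"
        using y(1) by (simp add: const_class_def Zd const Sdiff)
      then show ?thesis using y(1) by (simp add: nrm_const M.minus_closed)
    qed
    have ycau: "\<exists>N. \<forall>m\<ge>N. \<forall>n\<ge>N. nrm X (y m \<ominus> y n) < e" if e: "0 < e" for e
    proof -
      obtain N1 where N1: "\<forall>k\<ge>N1. inverse (real (Suc k)) < e / 3" using inv0[of "e / 3"] e by auto
      obtain N2 where N2: "\<forall>m\<ge>N2. \<forall>n\<ge>N2. nrm ?Z (z m \<ominus>\<^bsub>?Z\<^esub> z n) < e / 3"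
        using cau[of "e / 3"] e by auto
      have "nrm X (y m \<ominus> y n) < e" if "max N1 N2 \<le> m" "max N1 N2 \<le> n" for m n
      proof -
        have "inverse (real (Suc m)) < e / 3" "inverse (real (Suc n)) < e / 3"
          "nrm ?Z (z m \<ominus>\<^bsub>?Z\<^esub> z n) < e / 3"
          using N1 N2 that by (simp_all del: of_nat_Suc)
        moreover have "nrm ?Z (const_class (y m) \<ominus>\<^bsub>?Z\<^esub> const_class (y n)) \<le>
            nrm ?Z (const_class (y m) \<ominus>\<^bsub>?Z\<^esub> z m) + nrm ?Z (z m \<ominus>\<^bsub>?Z\<^esub> const_class (y n))"
          by (intro Z.nrm_triangle_diff cc y(1) z)
        moreover have "nrm ?Z (z m \<ominus>\<^bsub>?Z\<^esub> const_class (y n)) \<le>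
            nrm ?Z (z m \<ominus>\<^bsub>?Z\<^esub> z n) + nrm ?Z (z n \<ominus>\<^bsub>?Z\<^esub> const_class (y n))"
          by (intro Z.nrm_triangle_diff cc y(1) z)
        moreover have "nrm ?Z (const_class (y m) \<ominus>\<^bsub>?Z\<^esub> z m) = nrm ?Z (z m \<ominus>\<^bsub>?Z\<^esub> const_class (y m))"
          by (intro Z.nrm_diff cc y(1) z)
        ultimately show ?thesis
          using y(2)[of m] y(2)[of n] unfolding ydiff by linarith
      qed
      then show ?thesis by blast
    qed
    then have yS: "y \<in> carrier ?S" using y(1) by (simp add: in_cauchy_sequences)
    then have kZ: "?k y \<in> carrier ?Z" by (simp add: Zs)
    have "(\<lambda>n. nrm ?Z (z n \<ominus>\<^bsub>?Z\<^esub> ?k y)) \<longlonglongrightarrow> 0"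
    proof (rule LIMSEQ_I)
      fix e :: real assume e: "0 < e"
      obtain N1 where N1: "\<forall>k\<ge>N1. inverse (real (Suc k)) < e / 3" using inv0[of "e / 3"] e by auto
      obtain N2 where N2: "\<forall>m\<ge>N2. \<forall>n\<ge>N2. nrm X (y m \<ominus> y n) < e / 3" using ycau[of "e / 3"] e by auto
      have "norm (nrm ?Z (z n \<ominus>\<^bsub>?Z\<^esub> ?k y) - 0) < e" if n: "max N1 N2 \<le> n" for n
      proof -
        have "nrm ?Z (?k y \<ominus>\<^bsub>?Z\<^esub> const_class (y n)) \<le> e / 3"
          by (rule dist_small[OF yS, of N2]) (use N2 n in auto)
        moreover have "inverse (real (Suc n)) < e / 3" using N1 n by (simp del: of_nat_Suc)
        moreover have "nrm ?Z (z n \<ominus>\<^bsub>?Z\<^esub> ?k y) \<le> nrm ?Z (z n \<ominus>\<^bsub>?Z\<^esub> const_class (y n)) +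
            nrm ?Z (const_class (y n) \<ominus>\<^bsub>?Z\<^esub> ?k y)"
          by (intro Z.nrm_triangle_diff z cc y(1) kZ)
        moreover have "nrm ?Z (const_class (y n) \<ominus>\<^bsub>?Z\<^esub> ?k y) = nrm ?Z (?k y \<ominus>\<^bsub>?Z\<^esub> const_class (y n))"
          by (intro Z.nrm_diff cc y(1) kZ)
        moreover have "0 \<le> nrm ?Z (z n \<ominus>\<^bsub>?Z\<^esub> ?k y)"
          by (intro Z.nrm_nonneg Z.M.minus_closed z kZ)
        ultimately show ?thesis using y(2)[of n] e unfolding real_norm_def diff_0_right by linarith
      qed
      then show "\<exists>N. \<forall>n\<ge>N. norm (nrm ?Z (z n \<ominus>\<^bsub>?Z\<^esub> ?k y) - 0) < e" by blast
    qed
    then show "\<exists>x\<in>carrier ?Z. (\<lambda>n. nrm ?Z (z n \<ominus>\<^bsub>?Z\<^esub> x)) \<longlonglongrightarrow> 0" using kZ by blast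
  qed
qed

end

section \<open>Extensions of pseudonorms and finite dimension\<close>

lemma c00_induct [case_names single add]:
  assumes "\<And>i c. P (Poly_Mapping.single i c)" "\<And>x y. P x \<Longrightarrow> P y \<Longrightarrow> P (x + y)"
  shows "P (x :: nat \<Rightarrow>\<^sub>0 'b::comm_monoid_add)"
proof -
  have sum: "P (\<Sum>i\<in>A. Poly_Mapping.single i (c i))" if "finite A" for A c
    using that
  proof induction
    case empty
    show ?case using assms(1)[of 0 0] by simp
  qed (simp add: assms)
  show ?thesis
    using sum[OF finite_keys[of x], of "Poly_Mapping.lookup x"] by (simp add: sum_single_lookup)
qed

section \<open>Rational vectors and the extension of a pseudonorm to \<open>c00\<close>\<close>

abbreviation rat_c00 :: "V \<Rightarrow> c00" where
  "rat_c00 \<equiv> Poly_Mapping.map real_of_rat"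

lemma lookup_rat_c00 [simp]: "Poly_Mapping.lookup (rat_c00 q) i = real_of_rat (Poly_Mapping.lookup q i)"
  by (simp add: Poly_Mapping.map.rep_eq when_def)

lemma keys_rat_c00 [simp]: "Poly_Mapping.keys (rat_c00 q) = Poly_Mapping.keys q"
  by (auto simp: in_keys_iff)

lemma lookup_map_mult: "Poly_Mapping.lookup (Poly_Mapping.map ((*) (r :: 'b::mult_zero)) q) i = r * Poly_Mapping.lookup q i"
  by (simp add: Poly_Mapping.map.rep_eq when_def)

lemma rat_c00_add: "rat_c00 (p + q) = rat_c00 p + rat_c00 q"
  by (rule poly_mapping_eqI) (simp add: lookup_add of_rat_add)

lemma rat_c00_diff: "rat_c00 (p - q) = rat_c00 p - rat_c00 q"
  by (rule poly_mapping_eqI) (simp add: lookup_minus of_rat_diff)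

lemma rat_c00_zero [simp]: "rat_c00 0 = 0"
  by (rule poly_mapping_eqI) simp

lemma rat_c00_scale: "rat_c00 (Poly_Mapping.map ((*) r) q) = real_of_rat r *\<^sub>R rat_c00 q"
  by (rule poly_mapping_eqI) (simp add: lookup_map_mult of_rat_mult)

lemma rat_c00_single: "rat_c00 (Poly_Mapping.single i r) = Poly_Mapping.single i (real_of_rat r)"
  by (rule poly_mapping_eqI) (simp add: lookup_single when_def)

lemma rat_c00_dense:
  assumes "seminorm p" "0 < e"
  shows "\<exists>q. p (x - rat_c00 q) < e"
proof -
  interpret seminorm p by fact
  have "\<forall>e>0. \<exists>q. p (x - rat_c00 q) < e"
  proof (induction x rule: c00_induct)
    case (single i c)
    show ?case
    proof (intro allI impI)
      fix e :: real assume e: "0 < e"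
      let ?w = "p (Poly_Mapping.single i 1) + 1"
      have w: "0 < ?w" using nonneg[of "Poly_Mapping.single i 1"] by linarith
      obtain r where r: "c < real_of_rat r" "real_of_rat r < c + e / ?w"
        using of_rat_dense[of c "c + e / ?w"] w e by auto
      have "Poly_Mapping.single i c - rat_c00 (Poly_Mapping.single i r) =
          (c - real_of_rat r) *\<^sub>R Poly_Mapping.single i 1"
        by (simp add: rat_c00_single scaleR_single single_diff)
      then have "p (Poly_Mapping.single i c - rat_c00 (Poly_Mapping.single i r)) \<le> \<bar>c - real_of_rat r\<bar> * ?w"
        by (simp add: scale distrib_left)
      also have "\<dots> < e / ?w * ?w" using r w by (intro mult_strict_right_mono) auto
      also have "\<dots> = e" using w by simp
      finally show "\<exists>q. p (Poly_Mapping.single i c - rat_c00 q) < e" by blast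
    qed
  next
    case (add x y)
    show ?case
    proof (intro allI impI)
      fix e :: real assume "0 < e"
      then have e: "0 < e / 2" by simp
      obtain q r where q: "p (x - rat_c00 q) < e / 2" and r: "p (y - rat_c00 r) < e / 2"
        using add e by blast
      have eq: "x + y - rat_c00 (q + r) = (x - rat_c00 q) + (y - rat_c00 r)" by (simp add: rat_c00_add)
      have "p (x + y - rat_c00 (q + r)) < e"
        unfolding eq using triangle[of "x - rat_c00 q" "y - rat_c00 r"] q r by linarith
      then show "\<exists>q. p (x + y - rat_c00 q) < e" by blast
    qed
  qed
  then show ?thesis using assms(2) by blast
qed

text \<open>Density is applied to the sum of the two seminorms, so that a single rational vector is
  close to \<open>x\<close> for both.\<close>

lemma seminorm_eq_on_rat:
  assumes "seminorm p" "seminorm p'" "\<And>q. p (rat_c00 q) = p' (rat_c00 q)"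
  shows "p = p'"
proof
  fix x
  interpret p: seminorm p by fact
  interpret p': seminorm p' by fact
  have "seminorm (\<lambda>x. p x + p' x)"
    by unfold_locales (use p.triangle p'.triangle in \<open>auto simp: p.scale p'.scale distrib_left intro: add_mono\<close>,
      smt (verit) p.triangle p'.triangle)
  then have d: "\<exists>q. p (x - rat_c00 q) + p' (x - rat_c00 q) < e" if "0 < e" for e
    using rat_c00_dense that by blast
  have "\<bar>p x - p' x\<bar> \<le> 0"
  proof (rule field_le_epsilon)
    fix e :: real assume "0 < e"
    then obtain q where "p (x - rat_c00 q) + p' (x - rat_c00 q) < e" using d by blast
    then show "\<bar>p x - p' x\<bar> \<le> 0 + e"
      using p.abs_diff_le[of x "rat_c00 q"] p'.abs_diff_le[of x "rat_c00 q"] assms(3)[of q] by linarith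
  qed
  then show "p x = p' x" by simp
qed

text \<open>Weighted l_1 norms. With the values at the unit vectors as weights they dominate any
  seminorm on \<open>c00\<close>, which gives the bounds needed for extensions and limits.\<close>

definition wsum :: "(nat \<Rightarrow> real) \<Rightarrow> c00 \<Rightarrow> real" where
  "wsum w x = (\<Sum>i\<in>Poly_Mapping.keys x. \<bar>Poly_Mapping.lookup x i\<bar> * w i)"

lemma wsum_superset:
  "finite A \<Longrightarrow> Poly_Mapping.keys x \<subseteq> A \<Longrightarrow> wsum w x = (\<Sum>i\<in>A. \<bar>Poly_Mapping.lookup x i\<bar> * w i)"
  unfolding wsum_def by (rule sum.mono_neutral_left) (auto simp: in_keys_iff)

lemma seminorm_wsum:
  assumes "\<And>i. 0 \<le> w i"
  shows "seminorm (wsum w)"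
proof
  fix c and x y :: c00
  show "wsum w (c *\<^sub>R x) = \<bar>c\<bar> * wsum w x"
    using wsum_superset[OF finite_keys keys_scaleR[of c x], of w]
    by (simp add: wsum_def abs_mult sum_distrib_left mult.assoc)
  let ?A = "Poly_Mapping.keys x \<union> Poly_Mapping.keys y"
  have "wsum w (x + y) \<le> (\<Sum>i\<in>?A. \<bar>Poly_Mapping.lookup x i\<bar> * w i + \<bar>Poly_Mapping.lookup y i\<bar> * w i)"
    unfolding wsum_superset[OF _ Poly_Mapping.keys_add[of x y], of w, simplified]
    by (intro sum_mono) (use assms in \<open>auto simp: lookup_add intro: mult_right_mono simp flip: distrib_right\<close>)
  then show "wsum w (x + y) \<le> wsum w x + wsum w y"
    by (simp add: wsum_superset[of ?A] sum.distrib)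
qed

lemma seminorm_le_wsum:
  assumes "seminorm p"
  shows "p x \<le> wsum (\<lambda>i. p (Poly_Mapping.single i 1)) x"
  using seminorm.sum_le[OF assms, of "Poly_Mapping.lookup x" "\<lambda>i. Poly_Mapping.single i 1" "Poly_Mapping.keys x"]
  by (simp add: wsum_def comb_units[unfolded comb_def])

lemma pseudonorms_props:
  assumes "\<mu> \<in> pseudonorms"
  shows "0 \<le> \<mu> q" "\<mu> (Poly_Mapping.map ((*) r) q) = \<bar>real_of_rat r\<bar> * \<mu> q" "\<mu> (q + q') \<le> \<mu> q + \<mu> q'" "\<mu> 0 = 0"
proof -
  show *: "0 \<le> \<mu> q" "\<mu> (Poly_Mapping.map ((*) r) q) = \<bar>real_of_rat r\<bar> * \<mu> q" "\<mu> (q + q') \<le> \<mu> q + \<mu> q'" for q q' r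
    using assms by (auto simp: pseudonorms_def)
  have "Poly_Mapping.map ((*) 0) 0 = (0 :: V)" by (rule poly_mapping_eqI) (simp add: Poly_Mapping.map.rep_eq)
  then show "\<mu> 0 = 0" using *(2)[of 0 0] by simp
qed

lemma pseudonorm_le_wsum:
  assumes "\<mu> \<in> pseudonorms"
  shows "\<mu> q \<le> wsum (\<lambda>i. \<mu> (Poly_Mapping.single i 1)) (rat_c00 q)"
proof -
  note \<mu> = pseudonorms_props[OF assms]
  have "\<mu> (\<Sum>i\<in>A. Poly_Mapping.single i (c i)) \<le> (\<Sum>i\<in>A. \<bar>real_of_rat (c i)\<bar> * \<mu> (Poly_Mapping.single i 1))"
    if "finite A" for A and c :: "nat \<Rightarrow> rat"
    using that
  proof induction
    case (insert a A)
    have "Poly_Mapping.single a (c a) = Poly_Mapping.map ((*) (c a)) (Poly_Mapping.single a 1)"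
      by (rule poly_mapping_eqI) (simp add: Poly_Mapping.map.rep_eq lookup_single when_def)
    then have "\<mu> (Poly_Mapping.single a (c a)) = \<bar>real_of_rat (c a)\<bar> * \<mu> (Poly_Mapping.single a 1)"
      using \<mu>(2)[of "c a" "Poly_Mapping.single a 1"] by simp
    then show ?case
      using \<mu>(3)[of "Poly_Mapping.single a (c a)" "\<Sum>i\<in>A. Poly_Mapping.single i (c i)"] insert
      by simp
  qed (simp add: \<mu>)
  from this[OF finite_keys[of q], of "Poly_Mapping.lookup q"]
  have "\<mu> (\<Sum>i\<in>Poly_Mapping.keys q. Poly_Mapping.single i (Poly_Mapping.lookup q i)) \<le>
      wsum (\<lambda>i. \<mu> (Poly_Mapping.single i 1)) (rat_c00 q)"
    by (simp add: wsum_def)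
  then show ?thesis by (simp add: sum_single_lookup)
qed

lemma pseudonorm_c00_iff: "pseudonorm_c00 \<nu> \<longleftrightarrow> seminorm \<nu>"
  by (auto simp: pseudonorm_c00_def seminorm_def seminorm.nonneg)

text \<open>The extension is the infimal convolution of \<open>\<mu>\<close> with a weighted \<open>l\<^sub>1\<close> norm dominating it.\<close>

lemma ex_extension:
  assumes "\<mu> \<in> pseudonorms"
  shows "\<exists>\<nu>. seminorm \<nu> \<and> (\<forall>q. \<nu> (rat_c00 q) = \<mu> q)"
proof -
  note \<mu> = pseudonorms_props[OF assms]
  define M where "M = wsum (\<lambda>i. \<mu> (Poly_Mapping.single i 1))"
  interpret M: seminorm M unfolding M_def by (rule seminorm_wsum) (rule \<mu>(1))
  have le: "\<mu> q \<le> M (rat_c00 q)" for q unfolding M_def by (rule pseudonorm_le_wsum[OF assms])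
  define \<nu> where "\<nu> x = (INF q. \<mu> q + M (x - rat_c00 q))" for x
  have bdd: "bdd_below (range (\<lambda>q. \<mu> q + M (x - rat_c00 q)))" for x
    by (rule bdd_belowI[of _ 0]) (auto simp: \<mu>(1))
  have upper: "\<nu> x \<le> \<mu> q + M (x - rat_c00 q)" for x q
    unfolding \<nu>_def by (rule cINF_lower[OF bdd]) simp
  have lower: "a \<le> \<nu> x" if "\<And>q. a \<le> \<mu> q + M (x - rat_c00 q)" for a x
    unfolding \<nu>_def by (rule cINF_greatest) (use that in auto)
  have tri: "\<nu> (x + y) \<le> \<nu> x + \<nu> y" for x y
  proof -
    have h: "\<nu> (x + y) \<le> (\<mu> q + M (x - rat_c00 q)) + (\<mu> r + M (y - rat_c00 r))" for q r
    proof -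
      have eq: "x + y - rat_c00 (q + r) = (x - rat_c00 q) + (y - rat_c00 r)" by (simp add: rat_c00_add)
      show ?thesis
        using upper[of "x + y" "q + r", unfolded eq] \<mu>(3)[of q r] M.triangle[of "x - rat_c00 q" "y - rat_c00 r"]
        by linarith
    qed
    have h': "\<nu> (x + y) - (\<mu> q + M (x - rat_c00 q)) \<le> \<nu> y" for q
    proof (rule lower)
      show "\<nu> (x + y) - (\<mu> q + M (x - rat_c00 q)) \<le> \<mu> r + M (y - rat_c00 r)" for r
        using h[of q r] by linarith
    qed
    have "\<nu> (x + y) - \<nu> y \<le> \<nu> x"
    proof (rule lower)
      show "\<nu> (x + y) - \<nu> y \<le> \<mu> q + M (x - rat_c00 q)" for q
        using h'[of q] by linarith
    qed
    then show ?thesis by simp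
  qed
  have nn: "0 \<le> \<nu> x" for x by (rule lower) (simp add: \<mu>(1))
  have leM: "\<nu> x \<le> M x" for x using upper[of x 0] by (simp add: \<mu>(4))
  \<comment> \<open>Only an inequality is proved, here for rational factors and in
    \<open>half\<close> for real ones, which are approximated by rational ones. Equality then comes
    from applying it to the inverse factor.\<close>
  have rat: "\<nu> (real_of_rat r *\<^sub>R x) \<le> \<bar>real_of_rat r\<bar> * \<nu> x" for r x
  proof (cases "r = 0")
    case True
    then show ?thesis using leM[of 0] by simp
  next
    case False
    have "\<nu> (real_of_rat r *\<^sub>R x) / \<bar>real_of_rat r\<bar> \<le> \<mu> q + M (x - rat_c00 q)" for q
    proof -
      have "real_of_rat r *\<^sub>R x - rat_c00 (Poly_Mapping.map ((*) r) q) = real_of_rat r *\<^sub>R (x - rat_c00 q)"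
        by (simp add: rat_c00_scale scaleR_diff_right)
      then have "\<nu> (real_of_rat r *\<^sub>R x) \<le> \<bar>real_of_rat r\<bar> * (\<mu> q + M (x - rat_c00 q))"
        using upper[of "real_of_rat r *\<^sub>R x" "Poly_Mapping.map ((*) r) q"]
        by (simp add: \<mu>(2) M.scale distrib_left)
      then show ?thesis using False by (simp add: divide_le_eq mult.commute)
    qed
    then have "\<nu> (real_of_rat r *\<^sub>R x) / \<bar>real_of_rat r\<bar> \<le> \<nu> x" by (rule lower)
    then show ?thesis using False by (simp add: divide_le_eq mult.commute)
  qed
  have half: "\<nu> (c *\<^sub>R x) \<le> \<bar>c\<bar> * \<nu> x" for c x
  proof (rule field_le_epsilon)
    fix e :: real assume e: "0 < e"
    let ?w = "\<nu> x + M x + 1"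
    have w: "0 < ?w" using nn[of x] M.nonneg[of x] by linarith
    obtain r where r: "c < real_of_rat r" "real_of_rat r < c + e / ?w"
      using of_rat_dense[of c "c + e / ?w"] w e by auto
    define t where "t = \<bar>c - real_of_rat r\<bar>"
    have t: "t * ?w \<le> e" "0 \<le> t"
      using r w by (auto simp: t_def field_simps)
    have "\<nu> (c *\<^sub>R x) \<le> \<nu> (real_of_rat r *\<^sub>R x) + \<nu> ((c - real_of_rat r) *\<^sub>R x)"
      using tri[of "real_of_rat r *\<^sub>R x" "(c - real_of_rat r) *\<^sub>R x"] by (simp flip: scaleR_add_left)
    also have "\<nu> ((c - real_of_rat r) *\<^sub>R x) \<le> t * M x"
      using leM[of "(c - real_of_rat r) *\<^sub>R x"] by (simp add: M.scale t_def)
    also have "\<nu> (real_of_rat r *\<^sub>R x) \<le> (\<bar>c\<bar> + t) * \<nu> x"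
      using rat[of r x]
    proof (rule order_trans)
      have "\<bar>real_of_rat r\<bar> \<le> \<bar>c\<bar> + t" unfolding t_def by linarith
      then show "\<bar>real_of_rat r\<bar> * \<nu> x \<le> (\<bar>c\<bar> + t) * \<nu> x" by (intro mult_right_mono nn)
    qed
    finally show "\<nu> (c *\<^sub>R x) \<le> \<bar>c\<bar> * \<nu> x + e"
      using t by (simp add: algebra_simps)
  qed
  have "\<nu> (c *\<^sub>R x) = \<bar>c\<bar> * \<nu> x" for c x
  proof (cases "c = 0")
    case True
    then show ?thesis using half[of c x] nn[of "c *\<^sub>R x"] by simp
  next
    case False
    have "\<nu> x \<le> \<bar>inverse c\<bar> * \<nu> (c *\<^sub>R x)"
      using half[of "inverse c" "c *\<^sub>R x"] False by simp
    then have "\<bar>c\<bar> * \<nu> x \<le> \<nu> (c *\<^sub>R x)"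
      using False by (simp add: abs_inverse field_simps)
    then show ?thesis using half[of c x] by simp
  qed
  then have "seminorm \<nu>" using tri by unfold_locales
  moreover have "\<nu> (rat_c00 q) = \<mu> q" for q
  proof (rule antisym)
    show "\<nu> (rat_c00 q) \<le> \<mu> q" using upper[of "rat_c00 q" q] by simp
    show "\<mu> q \<le> \<nu> (rat_c00 q)"
    proof (rule lower)
      fix q'
      have "\<mu> q \<le> \<mu> q' + \<mu> (q - q')" using \<mu>(3)[of q' "q - q'"] by simp
      also have "\<mu> (q - q') \<le> M (rat_c00 q - rat_c00 q')" using le[of "q - q'"] by (simp add: rat_c00_diff)
      finally show "\<mu> q \<le> \<mu> q' + M (rat_c00 q - rat_c00 q')" by simp
    qed
  qed
  ultimately show ?thesis by blast
qed

lemma extension_unique: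
  assumes "seminorm \<nu>" "\<And>q. \<nu> (rat_c00 q) = \<mu> q"
  shows "extension \<mu> = \<nu>"
  unfolding extension_def pseudonorm_c00_iff
  by (rule the_equality) (use assms in \<open>auto intro: seminorm_eq_on_rat\<close>)

lemma extension_props:
  assumes "\<mu> \<in> pseudonorms"
  shows "seminorm (extension \<mu>)" "extension \<mu> (rat_c00 q) = \<mu> q"
  using ex_extension[OF assms] extension_unique by auto

lemma restrict_pseudonorm:
  assumes "seminorm \<nu>"
  shows "(\<lambda>q. \<nu> (rat_c00 q)) \<in> pseudonorms" "extension (\<lambda>q. \<nu> (rat_c00 q)) = \<nu>"
proof -
  interpret seminorm \<nu> by fact
  show "(\<lambda>q. \<nu> (rat_c00 q)) \<in> pseudonorms"
    by (auto simp: pseudonorms_def rat_c00_scale scale rat_c00_add triangle)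
qed (rule extension_unique[OF assms refl])

text \<open>On \<open>c00\<close> the values are eventually bounded by a weighted sum, so their
  limits exist. The limit is a seminorm that agrees with \<open>\<mu>\<close> on rational vectors,
  hence it is the extension by uniqueness.\<close>

lemma extension_tendsto:
  assumes U: "limit_filter U" and m: "\<And>i. m i \<in> pseudonorms" and \<mu>: "\<mu> \<in> pseudonorms"
    and lim: "\<And>q. ((\<lambda>i. m i q) \<longlongrightarrow> \<mu> q) U"
  shows "((\<lambda>i. extension (m i) x) \<longlongrightarrow> extension \<mu> x) U"
proof -
  define \<nu> where "\<nu> x = Lim U (\<lambda>i. extension (m i) x)" for x
  have l: "((\<lambda>i. extension (m i) x) \<longlongrightarrow> \<nu> x) U" for x
  proof -
    let ?W = "\<lambda>i. wsum (\<lambda>k. extension (m i) (Poly_Mapping.single k 1)) x"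
    have "extension (m i) (Poly_Mapping.single k 1) = m i (Poly_Mapping.single k 1)" for i k
      using extension_props(2)[OF m, of i "Poly_Mapping.single k 1"] by (simp add: rat_c00_single)
    then have "(?W \<longlongrightarrow> wsum (\<lambda>k. \<mu> (Poly_Mapping.single k 1)) x) U"
      unfolding wsum_def by (auto intro!: tendsto_intros lim)
    then have "\<forall>\<^sub>F i in U. ?W i < wsum (\<lambda>k. \<mu> (Poly_Mapping.single k 1)) x + 1"
      by (rule order_tendstoD) simp
    then have "\<forall>\<^sub>F i in U. \<bar>extension (m i) x\<bar> \<le> wsum (\<lambda>k. \<mu> (Poly_Mapping.single k 1)) x + 1"
      by (rule eventually_mono)
        (use seminorm_le_wsum[OF extension_props(1)[OF m]] seminorm.nonneg[OF extension_props(1)[OF m]] in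
          \<open>smt (verit, ccfv_threshold)\<close>)
    then show ?thesis unfolding \<nu>_def by (rule limit_filter_tendsto_Lim[OF U])
  qed
  have "seminorm \<nu>"
    by (rule seminorm_Lim[OF U _ l]) (rule extension_props(1)[OF m])
  moreover have "\<nu> (rat_c00 q) = \<mu> q" for q
    using tendsto_unique[OF limit_filter_nonbot[OF U] l[of "rat_c00 q"]] lim[of q]
    by (simp add: extension_props(2)[OF m])
  ultimately have "extension \<mu> = \<nu>" by (rule extension_unique)
  then show ?thesis using l by simp
qed

text \<open>The interface to quotient and completion: later arguments reach
  \<open>X_space \<mu>\<close> through the dense map \<open>J\<close>.\<close>

lemma X_space_properties:
  assumes "\<mu> \<in> pseudonorms"
  obtains J where "banach_space (X_space \<mu>)" "lin_c00 (X_space \<mu>) J" "dense_c00 (X_space \<mu>) J"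
    "\<And>x. nrm (X_space \<mu>) (J x) = extension \<mu> x"
proof -
  interpret \<nu>: seminorm "extension \<mu>" by (rule extension_props(1)[OF assms])
  let ?Y = "c00_space \<mu>"
  have simps: "carrier ?Y = UNIV" "x \<oplus>\<^bsub>?Y\<^esub> y = x + y" "c \<odot>\<^bsub>?Y\<^esub> x = c *\<^sub>R x" "\<zero>\<^bsub>?Y\<^esub> = 0"
    "nrm ?Y x = extension \<mu> x" for x y c
    by (simp_all add: c00_space_def)
  have group: "abelian_group ?Y"
    by (rule abelian_groupI) (auto simp: simps algebra_simps intro: exI[of _ "- x" for x])
  have "module real_ring ?Y"
    by (rule moduleI[OF cring_real_ring group]) (auto simp: simps algebra_simps)
  then interpret Y: pseudonormed_space ?Y
    by (intro pseudonormed_space.intro pseudonormed_space_axioms.intro)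
      (auto simp: simps \<nu>.scale \<nu>.triangle)
  let ?Q = "quotient_by_null ?Y"
  interpret Q: normed_space ?Q by (rule Y.normed_quotient)
  note Qs = Y.quotient_simps[unfolded simps, simplified]
  define k where "k = null_coset ?Y"
  have k: "k x \<in> carrier ?Q" for x by (simp add: k_def Qs)
  define J where "J x = Q.const_class (k x)" for x
  note Z = Q.completion_properties[folded X_space_def[symmetric]]
  show ?thesis
  proof (rule that[of J])
    show "banach_space (X_space \<mu>)" unfolding X_space_def by (rule Q.completion_properties(1))
    show "nrm (X_space \<mu>) (J x) = extension \<mu> x" for x
      using Q.completion_properties(3)[OF k, of x] by (simp add: X_space_def J_def k_def Qs simps)
    have "Q.const_class (k (x + y)) = Q.const_class (k x) \<oplus>\<^bsub>completion ?Q\<^esub> Q.const_class (k y)"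
      "Q.const_class (k (c *\<^sub>R x)) = c \<odot>\<^bsub>completion ?Q\<^esub> Q.const_class (k x)"
      "Q.const_class (k x) \<in> carrier (completion ?Q)" for x y c
      using Q.completion_properties(2) k[of x] k[of y] unfolding linear_map_def k_def
      by (auto simp: Qs Pi_iff simp flip: Qs(3,4))
    then show "lin_c00 (X_space \<mu>) J" by (simp add: lin_c00_def X_space_def J_def)
    show "dense_c00 (X_space \<mu>) J"
      unfolding dense_c00_def X_space_def J_def
    proof (intro ballI allI impI)
      fix z and e :: real assume "z \<in> carrier (completion ?Q)" "0 < e"
      then obtain A where A: "A \<in> carrier ?Q" "nrm (completion ?Q) (z \<ominus>\<^bsub>completion ?Q\<^esub> Q.const_class A) < e"
        using Q.completion_properties(4) by blast
      then obtain c where "A = k c" by (auto simp: Qs k_def)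
      then show "\<exists>c. nrm (completion ?Q) (z \<ominus>\<^bsub>completion ?Q\<^esub> Q.const_class (k c)) < e" using A by blast
    qed
  qed
qed

text \<open>A finite spanning set \<open>B\<close> lets \<open>T\<close> factor through the
  coefficient space \<open>'a \<Rightarrow>\<^sub>0 real\<close>, a type where the dimension theory
  of real vector spaces applies. There the \<open>card B + 1\<close> unit vectors from
  \<open>k\<close> on would have independent images in the span of \<open>card B\<close>
  vectors.\<close>

lemma not_finite_dimensional:
  assumes X: "pseudonormed_space X" and T: "lin_c00 X T"
    and inj: "\<And>x. Poly_Mapping.keys x \<subseteq> {k..} \<Longrightarrow> T x = \<zero>\<^bsub>X\<^esub> \<Longrightarrow> x = 0"
  shows "\<not> finite_dimensional X"
proof
  interpret X: pseudonormed_space X by fact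
  note T' = X.lin_c00D[OF T]
  assume "finite_dimensional X"
  then obtain B where B: "finite B" "B \<subseteq> carrier X"
    "\<And>x. x \<in> carrier X \<Longrightarrow> \<exists>c. x = (\<Oplus>\<^bsub>X\<^esub>b\<in>B. c b \<odot>\<^bsub>X\<^esub> b)"
    by (auto simp: finite_dimensional_def)
  have Bc: "b \<in> B \<Longrightarrow> b \<in> carrier X" for b using B(2) by blast
  define L where "L u = (\<Oplus>\<^bsub>X\<^esub>b\<in>B. Poly_Mapping.lookup u b \<odot>\<^bsub>X\<^esub> b)" for u :: "'a \<Rightarrow>\<^sub>0 real"
  have L_add: "L (u + v) = L u \<oplus>\<^bsub>X\<^esub> L v" for u v
  proof -
    have "L (u + v) = (\<Oplus>\<^bsub>X\<^esub>b\<in>B. Poly_Mapping.lookup u b \<odot>\<^bsub>X\<^esub> b \<oplus>\<^bsub>X\<^esub> Poly_Mapping.lookup v b \<odot>\<^bsub>X\<^esub> b)"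
      unfolding L_def by (rule X.M.finsum_cong') (auto simp: lookup_add X.sm_add_left Bc)
    also have "\<dots> = L u \<oplus>\<^bsub>X\<^esub> L v"
      unfolding L_def by (rule X.M.finsum_addf) (auto simp: Bc)
    finally show ?thesis .
  qed
  have L_scale: "L (c *\<^sub>R u) = c \<odot>\<^bsub>X\<^esub> L u" for c u
  proof -
    have "c \<odot>\<^bsub>X\<^esub> L u = (\<Oplus>\<^bsub>X\<^esub>b\<in>B. c \<odot>\<^bsub>X\<^esub> (Poly_Mapping.lookup u b \<odot>\<^bsub>X\<^esub> b))"
      unfolding L_def by (rule X.finsum_smult_ldistr) (auto simp: B(1) Bc)
    also have "\<dots> = L (c *\<^sub>R u)"
      unfolding L_def by (rule X.M.finsum_cong') (auto simp: X.sm_mult Bc)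
    finally show ?thesis by simp
  qed
  have "\<exists>c. T (Poly_Mapping.single i 1) = (\<Oplus>\<^bsub>X\<^esub>b\<in>B. c b \<odot>\<^bsub>X\<^esub> b)" for i
    using B(3) T'(1) by blast
  then obtain c where c: "\<And>i. T (Poly_Mapping.single i 1) = (\<Oplus>\<^bsub>X\<^esub>b\<in>B. c i b \<odot>\<^bsub>X\<^esub> b)"
    by metis
  define C where "C i = (\<Sum>b\<in>B. Poly_Mapping.single b (c i b))" for i
  have lookC: "Poly_Mapping.lookup (C i) b = c i b" if "b \<in> B" for i b
    unfolding C_def lookup_sum using that B(1)
    by (simp add: lookup_single when_def)
  have LC: "L (C i) = T (Poly_Mapping.single i 1)" for i
    unfolding L_def c by (rule X.M.finsum_cong') (auto simp: lookC Bc)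
  have TL: "T x = L (comb C x)" for x
  proof (induction x rule: c00_induct)
    case (single i a)
    then show ?case using T'(3)[of a "Poly_Mapping.single i 1"] by (simp add: scaleR_single L_scale LC)
  next
    case (add x y)
    then show ?case by (simp add: T'(2) L_add linear_add[OF linear_comb])
  qed
  let ?S = "(\<lambda>b. Poly_Mapping.single b 1 :: 'a \<Rightarrow>\<^sub>0 real) ` B"
  let ?E = "(\<lambda>i. Poly_Mapping.single i 1 :: c00) ` {k..k + card B}"
  have ki: "subspace {x :: c00. Poly_Mapping.keys x \<subseteq> {k..}}"
    by (rule subspaceI) (use Poly_Mapping.keys_add keys_scaleR in \<open>fastforce+\<close>)
  have spanE: "Poly_Mapping.keys x \<subseteq> {k..}" if "x \<in> span ?E" for x
    using span_minimal[OF _ ki, of ?E] that by fastforce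
  have "inj_on (comb C) (span ?E)"
  proof (rule inj_onI)
    fix x y assume xy: "x \<in> span ?E" "y \<in> span ?E" "comb C x = comb C y"
    then have "comb C (x - y) = 0" by (simp add: linear_diff[OF linear_comb])
    moreover have "L 0 = \<zero>\<^bsub>X\<^esub>" using T'(4) TL[of 0] linear_0[OF linear_comb, of C] by simp
    ultimately have "T (x - y) = \<zero>\<^bsub>X\<^esub>" by (simp add: TL)
    then show "x = y" using inj[OF spanE[OF span_diff[OF xy(1,2)]]] by simp
  qed
  moreover have "independent ?E"
    unfolding dependent_def
  proof (rule notI, elim bexE)
    fix a assume a: "a \<in> ?E" "a \<in> span (?E - {a})"
    then obtain i where i: "a = Poly_Mapping.single i 1" by blast
    have "subspace {x :: c00. Poly_Mapping.lookup x i = 0}"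
      by (rule subspaceI) (auto simp: lookup_add)
    moreover have "?E - {a} \<subseteq> {x. Poly_Mapping.lookup x i = 0}"
      by (auto simp: i lookup_single when_def)
    ultimately have "span (?E - {a}) \<subseteq> {x. Poly_Mapping.lookup x i = 0}" by (intro span_minimal)
    then have "Poly_Mapping.lookup a i = 0" using a(2) by blast
    then show False by (simp add: i)
  qed
  ultimately have "independent (comb C ` ?E)"
    by (intro linear_independent_injective_image[OF linear_comb])
  moreover have "comb C ` ?E \<subseteq> span ?S"
  proof -
    have "C i \<in> span ?S" for i
      unfolding C_def
    proof (rule span_sum)
      fix b assume "b \<in> B"
      then have "c i b *\<^sub>R Poly_Mapping.single b 1 \<in> span ?S" by (intro span_scale span_base) auto
      then show "Poly_Mapping.single b (c i b) \<in> span ?S" by (simp add: scaleR_single)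
    qed
    then show ?thesis by auto
  qed
  ultimately have "card (comb C ` ?E) \<le> card ?S"
    using independent_span_bound[of ?S "comb C ` ?E"] B(1) by simp
  also have "\<dots> \<le> card B" using B(1) by (rule card_image_le)
  finally have "card (comb C ` ?E) \<le> card B" .
  moreover have "card (comb C ` ?E) = card ?E"
    by (rule card_image[OF inj_on_subset[OF \<open>inj_on (comb C) (span ?E)\<close> span_superset]])
  moreover have "card ?E = card {k..k + card B}"
  proof (intro card_image inj_onI)
    fix i j :: nat
    assume "Poly_Mapping.single i 1 = (Poly_Mapping.single j 1 :: c00)"
    then have "Poly_Mapping.keys (Poly_Mapping.single i 1 :: c00) = Poly_Mapping.keys (Poly_Mapping.single j 1 :: c00)"
      by (rule arg_cong)
    then show "i = j" by simp
  qed
  ultimately show False by simp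
qed

text \<open>Otherwise take a dense span with the fewest generators. Each generator then has positive
  distance from the span of the others, so the norm controls the coefficients. A limit of bounded
  coefficients shows that the span is already closed, hence the whole space.\<close>

lemma inf_dim_of_not_finite_dimensional:
  assumes X: "normed_space X" and T: "lin_c00 X T" "dense_c00 X T" and nfd: "\<not> finite_dimensional X"
  shows "inf_dim (\<lambda>x. nrm X (T x))"
proof (rule ccontr)
  interpret X: normed_space X by fact
  note T' = X.lin_c00D[OF T(1)]
  define p where "p x = nrm X (T x)" for x
  interpret p: seminorm p unfolding p_def by (rule X.seminorm_lin_c00[OF T(1)])
  define good where "good B \<longleftrightarrow> finite B \<and> (\<forall>x. \<forall>d>0. \<exists>u\<in>span B. p (x - u) < d)" for B
  assume "\<not> inf_dim (\<lambda>x. nrm X (T x))"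
  then have "\<exists>B. good B"
    unfolding inf_dim_def good_def p_def by (meson not_le)
  then obtain B where B: "good B" and min: "\<And>B'. good B' \<Longrightarrow> card B \<le> card B'"
    using exists_least_iff[of "\<lambda>n. \<exists>B. good B \<and> card B = n"] by (metis not_le_imp_less)
  have fin: "finite B" and approx: "\<And>x d. 0 < d \<Longrightarrow> \<exists>u\<in>span B. p (x - u) < d"
    using B by (auto simp: good_def)
  have "\<exists>\<delta>>0. \<forall>u\<in>span (B - {b}). \<delta> \<le> p (b - u)" if b: "b \<in> B" for b
  proof (rule ccontr)
    \<comment> \<open>If the other generators approximate \<open>b\<close> arbitrarily well,
      \<open>b\<close> can be left out, against minimality.\<close>
    assume "\<not> ?thesis"
    then have close: "\<exists>u\<in>span (B - {b}). p (b - u) < \<delta>" if "0 < \<delta>" for \<delta>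
      using that by (meson not_le)
    have "\<exists>u\<in>span (B - {b}). p (x - u) < d" if d: "0 < d" for x d
    proof -
      obtain w where w: "w \<in> span B" "p (x - w) < d / 2" using approx[of "d / 2"] d by auto
      obtain t where t: "w - t *\<^sub>R b \<in> span (B - {b})" using span_breakdown[OF b w(1)] by blast
      have "0 < d / (2 * (\<bar>t\<bar> + 1))" using d by (simp add: add_nonneg_pos)
      then obtain u where u: "u \<in> span (B - {b})" "p (b - u) < d / (2 * (\<bar>t\<bar> + 1))" using close by blast
      have "\<bar>t\<bar> * p (b - u) \<le> (\<bar>t\<bar> + 1) * (d / (2 * (\<bar>t\<bar> + 1)))"
        using u(2) by (intro mult_mono) auto
      also have "\<dots> = d / 2" by (simp add: field_simps add_nonneg_eq_0_iff)
      finally have tb: "p (t *\<^sub>R (b - u)) \<le> d / 2" by (simp add: p.scale)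
      have mem: "(w - t *\<^sub>R b) + t *\<^sub>R u \<in> span (B - {b})"
        by (intro span_add span_scale t u(1))
      have eq: "x - ((w - t *\<^sub>R b) + t *\<^sub>R u) = (x - w) + t *\<^sub>R (b - u)" by (simp add: algebra_simps)
      have "p (x - ((w - t *\<^sub>R b) + t *\<^sub>R u)) < d"
        unfolding eq using p.triangle[of "x - w" "t *\<^sub>R (b - u)"] w(2) tb by linarith
      then show ?thesis using mem by blast
    qed
    then have "good (B - {b})" using fin by (simp add: good_def)
    then show False using min[of "B - {b}"] card_Diff1_less[OF fin b] by simp
  qed
  then obtain \<delta> where \<delta>: "\<And>b. b \<in> B \<Longrightarrow> 0 < \<delta> b" "\<And>b u. b \<in> B \<Longrightarrow> u \<in> span (B - {b}) \<Longrightarrow> \<delta> b \<le> p (b - u)"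
    by metis
  have coeff: "\<bar>c b\<bar> * \<delta> b \<le> p (\<Sum>b\<in>B. c b *\<^sub>R b)" if b: "b \<in> B" for c b
  proof (cases "c b = 0")
    case False
    let ?r = "\<Sum>b\<in>B - {b}. c b *\<^sub>R b"
    have "?r \<in> span (B - {b})" by (intro span_sum span_scale span_base)
    then have "- (inverse (c b) *\<^sub>R ?r) \<in> span (B - {b})" by (intro span_neg span_scale)
    then have "\<delta> b \<le> p (b + inverse (c b) *\<^sub>R ?r)" using \<delta>(2)[OF b] by fastforce
    then have "\<bar>c b\<bar> * \<delta> b \<le> p (c b *\<^sub>R (b + inverse (c b) *\<^sub>R ?r))"
      by (simp add: p.scale mult_left_mono del: scaleR_right_distrib)
    also have "c b *\<^sub>R (b + inverse (c b) *\<^sub>R ?r) = (\<Sum>b\<in>B. c b *\<^sub>R b)"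
      using False by (simp add: scaleR_add_right sum.remove[OF fin b])
    finally show ?thesis .
  qed simp
  have inj: "inj_on T B"
  proof (rule inj_onI)
    fix b b' assume b: "b \<in> B" "b' \<in> B" "T b = T b'"
    show "b = b'"
    proof (rule ccontr)
      assume "b \<noteq> b'"
      then have "b' \<in> span (B - {b})" using b by (intro span_base) auto
      then have "\<delta> b \<le> p (b - b')" using \<delta>(2) b by blast
      also have "p (b - b') = 0" using b T'(1)[of b'] by (simp add: p_def T'(5))
      finally show False using \<delta>(1)[OF b(1)] by simp
    qed
  qed
  have Tsum: "T (\<Sum>b\<in>A. c b *\<^sub>R b) = (\<Oplus>\<^bsub>X\<^esub>b\<in>A. c b \<odot>\<^bsub>X\<^esub> T b)" if "finite A" for A c
    using that by induction (simp_all add: T' Pi_iff)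
  have "\<exists>c. z = (\<Oplus>\<^bsub>X\<^esub>b\<in>T ` B. c b \<odot>\<^bsub>X\<^esub> b)" if z: "z \<in> carrier X" for z
  proof -
    have "\<exists>c. nrm X (z \<ominus>\<^bsub>X\<^esub> T (\<Sum>b\<in>B. c b *\<^sub>R b)) < inverse (real (Suc n))" for n
    proof -
      have pos: "0 < inverse (real (Suc n)) / 2" by simp
      obtain x where x: "nrm X (z \<ominus>\<^bsub>X\<^esub> T x) < inverse (real (Suc n)) / 2"
        using T(2) z pos unfolding dense_c00_def by blast
      obtain u where u: "u \<in> span B" "p (x - u) < inverse (real (Suc n)) / 2"
        using approx[OF pos] by blast
      obtain c where c: "u = (\<Sum>b\<in>B. c b *\<^sub>R b)" using u(1) span_finite[OF fin] by auto
      have "nrm X (z \<ominus>\<^bsub>X\<^esub> T u) \<le> nrm X (z \<ominus>\<^bsub>X\<^esub> T x) + nrm X (T x \<ominus>\<^bsub>X\<^esub> T u)"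
        using z T'(1) by (intro X.nrm_triangle_diff) auto
      then have "nrm X (z \<ominus>\<^bsub>X\<^esub> T u) < inverse (real (Suc n))"
        using x u(2) by (simp add: p_def T'(5) del: of_nat_Suc)
      then show ?thesis unfolding c by blast
    qed
    then obtain c where c: "\<And>n. nrm X (z \<ominus>\<^bsub>X\<^esub> T (\<Sum>b\<in>B. c n b *\<^sub>R b)) < inverse (real (Suc n))"
      by metis
    let ?w = "\<lambda>n. \<Sum>b\<in>B. c n b *\<^sub>R b"
    obtain U :: "nat filter" where U: "U \<le> sequentially" "limit_filter U"
      using ex_limit_filter[of sequentially] by auto
    have nb: "U \<noteq> bot" using U(2) by (rule limit_filter_nonbot)
    have bound: "\<bar>c n b\<bar> \<le> (nrm X z + 1) / \<delta> b" if b: "b \<in> B" for n b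
    proof -
      have "inverse (real (Suc n)) \<le> 1" by (simp add: inverse_eq_divide)
      then have "nrm X (T (?w n) \<ominus>\<^bsub>X\<^esub> z) \<le> 1"
        using c[of n] X.nrm_diff[OF z T'(1), of "?w n"] by linarith
      moreover have "nrm X (T (?w n)) \<le> nrm X (T (?w n) \<ominus>\<^bsub>X\<^esub> z) + nrm X z"
        using X.nrm_triangle_diff[OF T'(1) z X.M.zero_closed, of "?w n"] z T'(1)[of "?w n"] by simp
      ultimately have "\<bar>c n b\<bar> * \<delta> b \<le> nrm X z + 1"
        using coeff[OF b, of "c n"] by (simp add: p_def)
      then show ?thesis using \<delta>(1)[OF b] by (simp add: pos_le_divide_eq)
    qed
    define l where "l b = Lim U (\<lambda>n. c n b)" for b
    have l: "((\<lambda>n. c n b) \<longlongrightarrow> l b) U" if "b \<in> B" for b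
      unfolding l_def by (rule limit_filter_tendsto_Lim[OF U(2) always_eventually]) (use bound[OF that] in blast)
    let ?l = "\<Sum>b\<in>B. l b *\<^sub>R b"
    have "((\<lambda>n. inverse (real (Suc n)) + (\<Sum>b\<in>B. \<bar>c n b - l b\<bar> * p b)) \<longlongrightarrow> 0 + (\<Sum>b\<in>B. \<bar>l b - l b\<bar> * p b)) U"
      by (intro tendsto_intros l tendsto_mono[OF U(1) LIMSEQ_inverse_real_of_nat])
    moreover have "nrm X (z \<ominus>\<^bsub>X\<^esub> T ?l) \<le> inverse (real (Suc n)) + (\<Sum>b\<in>B. \<bar>c n b - l b\<bar> * p b)" for n
    proof -
      have "nrm X (z \<ominus>\<^bsub>X\<^esub> T ?l) \<le> nrm X (z \<ominus>\<^bsub>X\<^esub> T (?w n)) + nrm X (T (?w n) \<ominus>\<^bsub>X\<^esub> T ?l)"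
        using z T'(1) by (intro X.nrm_triangle_diff) auto
      also have "nrm X (T (?w n) \<ominus>\<^bsub>X\<^esub> T ?l) = p (\<Sum>b\<in>B. (c n b - l b) *\<^sub>R b)"
        by (simp add: p_def scaleR_diff_left sum_subtractf flip: T'(5))
      also have "\<dots> \<le> (\<Sum>b\<in>B. \<bar>c n b - l b\<bar> * p b)" by (rule p.sum_le)
      finally show ?thesis using c[of n] by linarith
    qed
    ultimately have "nrm X (z \<ominus>\<^bsub>X\<^esub> T ?l) \<le> 0"
      by (intro tendsto_lowerbound[OF _ always_eventually nb]) (auto simp del: of_nat_Suc)
    then have "z = T ?l"
      using z T'(1) by (intro X.eqI_small) auto
    also have "\<dots> = (\<Oplus>\<^bsub>X\<^esub>b\<in>B. l b \<odot>\<^bsub>X\<^esub> T b)" by (rule Tsum[OF fin])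
    also have "\<dots> = (\<Oplus>\<^bsub>X\<^esub>b\<in>B. l (the_inv_into B T (T b)) \<odot>\<^bsub>X\<^esub> T b)"
      by (rule X.M.finsum_cong') (auto simp: the_inv_into_f_f[OF inj] T'(1))
    also have "\<dots> = (\<Oplus>\<^bsub>X\<^esub>b\<in>T ` B. l (the_inv_into B T b) \<odot>\<^bsub>X\<^esub> b)"
      by (rule X.M.finsum_reindex[symmetric, where f = "\<lambda>b. l (the_inv_into B T b) \<odot>\<^bsub>X\<^esub> b"])
         (auto simp: inj T'(1))
    finally show ?thesis by (intro exI[of _ "\<lambda>b. l (the_inv_into B T b)"])
  qed
  then have "finite_dimensional X"
    unfolding finite_dimensional_def using fin T'(1) by (intro exI[of _ "T ` B"]) auto
  then show False using nfd by simp
qed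

section \<open>The Hilbert space\<close>

lemma ell2_simps [simp]:
  "carrier ell2 = {x. summable (\<lambda>n. (x n)\<^sup>2)}" "x \<oplus>\<^bsub>ell2\<^esub> y = (\<lambda>n. x n + y n)"
  "c \<odot>\<^bsub>ell2\<^esub> x = (\<lambda>n. c * x n)" "\<zero>\<^bsub>ell2\<^esub> = (\<lambda>n. 0)"
  "nrm ell2 x = sqrt (suminf (\<lambda>n. (x n)\<^sup>2))"
  by (simp_all add: ell2_def)

lemma L2_le_ell2:
  assumes "summable (\<lambda>n. (x n)\<^sup>2)"
  shows "L2_set x {..<n} \<le> sqrt (suminf (\<lambda>n. (x n)\<^sup>2))"
  unfolding L2_set_def by (intro real_sqrt_le_mono sum_le_suminf assms) auto

lemma ell2_bounded:
  assumes "\<And>n. L2_set x {..<n} \<le> B"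
  shows "summable (\<lambda>n. (x n)\<^sup>2)" "sqrt (suminf (\<lambda>n. (x n)\<^sup>2)) \<le> B"
proof -
  have B: "0 \<le> B" using assms[of 0] by simp
  have le: "(\<Sum>i<n. (x i)\<^sup>2) \<le> B\<^sup>2" for n
    using power_mono[OF assms[of n] L2_set_nonneg, of 2] by (simp add: L2_set_def sum_nonneg)
  show s: "summable (\<lambda>n. (x n)\<^sup>2)"
    by (rule summableI_nonneg_bounded[OF _ le]) simp
  have "(suminf (\<lambda>n. (x n)\<^sup>2)) \<le> B\<^sup>2" using s le by (rule suminf_le_const)
  then show "sqrt (suminf (\<lambda>n. (x n)\<^sup>2)) \<le> B" using B by (simp add: real_le_lsqrt suminf_nonneg s)
qed

lemma ell2_add:
  assumes "summable (\<lambda>n. (x n)\<^sup>2)" "summable (\<lambda>n. (y n)\<^sup>2)"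
  shows "summable (\<lambda>n. (x n + y n)\<^sup>2)"
    "sqrt (suminf (\<lambda>n. (x n + y n)\<^sup>2)) \<le> sqrt (suminf (\<lambda>n. (x n)\<^sup>2)) + sqrt (suminf (\<lambda>n. (y n)\<^sup>2))"
proof -
  have "L2_set (\<lambda>n. x n + y n) {..<n} \<le> sqrt (suminf (\<lambda>n. (x n)\<^sup>2)) + sqrt (suminf (\<lambda>n. (y n)\<^sup>2))" for n
    using L2_set_triangle_ineq[of x y "{..<n}"] L2_le_ell2[OF assms(1), of n] L2_le_ell2[OF assms(2), of n]
    by linarith
  from ell2_bounded[OF this] show "summable (\<lambda>n. (x n + y n)\<^sup>2)"
    "sqrt (suminf (\<lambda>n. (x n + y n)\<^sup>2)) \<le> sqrt (suminf (\<lambda>n. (x n)\<^sup>2)) + sqrt (suminf (\<lambda>n. (y n)\<^sup>2))" .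
qed

lemma normed_ell2: "normed_space ell2"
proof -
  have group: "abelian_group ell2"
  proof (rule abelian_groupI)
    fix x assume "x \<in> carrier ell2"
    then show "\<exists>y\<in>carrier ell2. y \<oplus>\<^bsub>ell2\<^esub> x = \<zero>\<^bsub>ell2\<^esub>"
      by (intro bexI[of _ "\<lambda>n. - x n"]) auto
  qed (auto simp: ell2_add algebra_simps)
  have mod: "module real_ring ell2"
    by (rule moduleI[OF cring_real_ring group])
       (auto simp: algebra_simps power_mult_distrib intro: summable_mult)
  have pseudo: "pseudonormed_space ell2"
  proof (intro pseudonormed_space.intro pseudonormed_space_axioms.intro mod)
    fix x y :: "nat \<Rightarrow> real" and c
    assume x: "x \<in> carrier ell2"
    show "0 \<le> nrm ell2 x" using x by (simp add: suminf_nonneg)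
    show "nrm ell2 (c \<odot>\<^bsub>ell2\<^esub> x) = \<bar>c\<bar> * nrm ell2 x"
      using x by (simp add: power_mult_distrib suminf_mult real_sqrt_mult)
    assume y: "y \<in> carrier ell2"
    show "nrm ell2 (x \<oplus>\<^bsub>ell2\<^esub> y) \<le> nrm ell2 x + nrm ell2 y"
      using x y by (simp add: ell2_add)
  qed
  show ?thesis
  proof (intro normed_space.intro normed_space_axioms.intro pseudo)
    fix x assume x: "x \<in> carrier ell2" "nrm ell2 x = 0"
    then have "(suminf (\<lambda>n. (x n)\<^sup>2)) = 0" by simp
    then have "\<forall>n. (x n)\<^sup>2 = 0" using x(1) by (subst (asm) suminf_eq_zero_iff) auto
    then show "x = \<zero>\<^bsub>ell2\<^esub>" by auto
  qed
qed

interpretation ell2: normed_space ell2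
  by (rule normed_ell2)

lemma ell2_diff: "summable (\<lambda>n. (y n)\<^sup>2) \<Longrightarrow> x \<ominus>\<^bsub>ell2\<^esub> y = (\<lambda>n. x n - y n)"
  by (simp add: a_minus_def flip: ell2.sm_minus_one)

lemma banach_ell2: "banach_space ell2"
proof (rule banach_spaceI[OF normed_ell2])
  fix s :: "nat \<Rightarrow> nat \<Rightarrow> real"
  assume s: "\<And>n. s n \<in> carrier ell2"
    and cau: "\<And>e. 0 < e \<Longrightarrow> \<exists>N. \<forall>m\<ge>N. \<forall>n\<ge>N. nrm ell2 (s m \<ominus>\<^bsub>ell2\<^esub> s n) < e"
  have dc: "s m \<ominus>\<^bsub>ell2\<^esub> s n \<in> carrier ell2" for m n using s by (intro ell2.M.minus_closed)
  have L2: "L2_set (\<lambda>i. s m i - s n i) {..<k} \<le> nrm ell2 (s m \<ominus>\<^bsub>ell2\<^esub> s n)" for m n k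
    using L2_le_ell2[of "\<lambda>i. s m i - s n i" k] dc[of m n] s[of n] by (simp add: ell2_diff)
  have "convergent (\<lambda>n. s n i)" for i
  proof -
    have "Cauchy (\<lambda>n. s n i)"
      unfolding Cauchy_def
    proof (intro allI impI)
      fix e :: real assume "0 < e"
      then obtain N where N: "\<forall>m\<ge>N. \<forall>n\<ge>N. nrm ell2 (s m \<ominus>\<^bsub>ell2\<^esub> s n) < e" using cau by blast
      have "dist (s m i) (s n i) < e" if "N \<le> m" "N \<le> n" for m n
      proof -
        have "\<bar>s m i - s n i\<bar> \<le> L2_set (\<lambda>i. \<bar>s m i - s n i\<bar>) {..<Suc i}"
          by (rule member_le_L2_set) auto
        also have "\<dots> = L2_set (\<lambda>i. s m i - s n i) {..<Suc i}" by (simp add: L2_set_def)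
        also have "\<dots> < e" using L2[of m n "Suc i"] N that by (meson le_less_trans)
        finally show ?thesis by (simp add: dist_real_def)
      qed
      then show "\<exists>N. \<forall>m\<ge>N. \<forall>n\<ge>N. dist (s m i) (s n i) < e" by blast
    qed
    then show ?thesis by (simp add: Cauchy_convergent_iff)
  qed
  then obtain l where l: "\<And>i. (\<lambda>n. s n i) \<longlonglongrightarrow> l i" unfolding convergent_def by metis
  have close: "\<exists>N. \<forall>m\<ge>N. \<forall>k. L2_set (\<lambda>i. s m i - l i) {..<k} \<le> e" if e: "0 < e" for e
  proof -
    obtain N where N: "\<forall>m\<ge>N. \<forall>n\<ge>N. nrm ell2 (s m \<ominus>\<^bsub>ell2\<^esub> s n) < e" using cau[OF e] by blast
    have "L2_set (\<lambda>i. s m i - l i) {..<k} \<le> e" if m: "N \<le> m" for m k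
    proof (rule LIMSEQ_le_const2)
      show "(\<lambda>n. L2_set (\<lambda>i. s m i - s n i) {..<k}) \<longlonglongrightarrow> L2_set (\<lambda>i. s m i - l i) {..<k}"
        unfolding L2_set_def by (intro tendsto_intros l)
      have "L2_set (\<lambda>i. s m i - s n i) {..<k} \<le> e" if "N \<le> n" for n
        using L2[of m n k] N m that by (meson le_less_trans less_imp_le)
      then show "\<exists>N. \<forall>n\<ge>N. L2_set (\<lambda>i. s m i - s n i) {..<k} \<le> e" by blast
    qed
    then show ?thesis by blast
  qed
  obtain N where "\<forall>m\<ge>N. \<forall>k. L2_set (\<lambda>i. s m i - l i) {..<k} \<le> 1" using close[of 1] by auto
  then have "summable (\<lambda>i. (s N i - l i)\<^sup>2)" by (intro ell2_bounded(1)) auto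
  then have "summable (\<lambda>i. (- (s N i - l i))\<^sup>2)" by (simp only: power2_minus)
  then have lc: "l \<in> carrier ell2"
    using ell2_add(1)[of "s N" "\<lambda>i. - (s N i - l i)"] s[of N] by simp
  have "(\<lambda>n. nrm ell2 (s n \<ominus>\<^bsub>ell2\<^esub> l)) \<longlonglongrightarrow> 0"
  proof (rule LIMSEQ_I)
    fix e :: real assume e: "0 < e"
    then obtain N where N: "\<forall>m\<ge>N. \<forall>k. L2_set (\<lambda>i. s m i - l i) {..<k} \<le> e / 2"
      using close[of "e / 2"] by auto
    have "norm (nrm ell2 (s n \<ominus>\<^bsub>ell2\<^esub> l) - 0) < e" if "N \<le> n" for n
    proof -
      have "sqrt (suminf (\<lambda>i. (s n i - l i)\<^sup>2)) \<le> e / 2" using N that by (intro ell2_bounded(2)) auto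
      moreover have "0 \<le> nrm ell2 (s n \<ominus>\<^bsub>ell2\<^esub> l)"
        by (intro ell2.nrm_nonneg ell2.M.minus_closed s lc)
      ultimately show ?thesis using e lc by (simp add: ell2_diff)
    qed
    then show "\<exists>N. \<forall>n\<ge>N. norm (nrm ell2 (s n \<ominus>\<^bsub>ell2\<^esub> l) - 0) < e" by blast
  qed
  then show "\<exists>x\<in>carrier ell2. (\<lambda>n. nrm ell2 (s n \<ominus>\<^bsub>ell2\<^esub> x)) \<longlonglongrightarrow> 0" using lc by blast
qed

lemma ell2_truncate:
  assumes y: "summable (\<lambda>n. (y n)\<^sup>2)" and e: "0 < e"
  shows "\<exists>N. summable (\<lambda>n. (y n - (if n < N then y n else 0))\<^sup>2) \<and>
    sqrt (suminf (\<lambda>n. (y n - (if n < N then y n else 0))\<^sup>2)) < e"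
proof -
  have "0 < e\<^sup>2" using e by simp
  from suminf_exist_split[OF this y]
  obtain N where N: "norm (suminf (\<lambda>i. (y (i + N))\<^sup>2)) < e\<^sup>2" by blast
  let ?f = "\<lambda>n. (y n - (if n < N then y n else 0))\<^sup>2"
  have s: "summable ?f"
    by (rule summable_comparison_test'[OF y, of 0]) auto
  have "(suminf (\<lambda>n. ?f n)) = (suminf (\<lambda>i. ?f (i + N))) + (\<Sum>i<N. ?f i)" by (rule suminf_split_initial_segment[OF s])
  also have "\<dots> = (suminf (\<lambda>i. (y (i + N))\<^sup>2))" by simp
  finally have "(suminf (\<lambda>n. ?f n)) < e\<^sup>2" using N by simp
  then have "sqrt (suminf (\<lambda>n. ?f n)) < e" using e real_sqrt_less_mono by fastforce
  then show ?thesis using s by blast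
qed

lemma summable_lookup: "summable (\<lambda>n. (Poly_Mapping.lookup x n)\<^sup>2 :: real)"
  by (rule summable_finite[OF finite_keys[of x]]) (simp add: in_keys_iff)

lemma lin_lookup: "lin_c00 ell2 Poly_Mapping.lookup"
  by (simp add: lin_c00_def summable_lookup plus_poly_mapping.rep_eq fun_eq_iff)

lemma dense_lookup: "dense_c00 ell2 Poly_Mapping.lookup"
  unfolding dense_c00_def
proof (intro ballI allI impI)
  fix y :: "nat \<Rightarrow> real" and e :: real assume y: "y \<in> carrier ell2" and e: "0 < e"
  then obtain N where N: "sqrt (suminf (\<lambda>n. (y n - (if n < N then y n else 0))\<^sup>2)) < e"
    using ell2_truncate[of y e] by auto
  define c where "c = (\<Sum>i<N. Poly_Mapping.single i (y i))"
  have "Poly_Mapping.lookup c n = (if n < N then y n else 0)" for n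
    by (simp add: c_def lookup_sum lookup_single when_def)
  then show "\<exists>c. nrm ell2 (y \<ominus>\<^bsub>ell2\<^esub> Poly_Mapping.lookup c) < e"
    using N by (intro exI[of _ c]) (simp add: ell2_diff[OF summable_lookup])
qed

section \<open>Separability and dense sequences\<close>

lemma countable_V: "countable (UNIV :: V set)"
proof -
  let ?f = "\<lambda>l :: (nat \<times> rat) list. sum_list (map (\<lambda>(i, r). Poly_Mapping.single i r) l)"
  have "x \<in> range ?f" for x
  proof (induction x rule: c00_induct)
    case (single i c)
    show ?case by (rule range_eqI[of _ _ "[(i, c)]"]) simp
  next
    case (add x y)
    then obtain k l where "x = ?f k" "y = ?f l" by blast
    then show ?case by (intro range_eqI[of _ _ "k @ l"]) simp
  qed
  then have "(UNIV :: V set) = range ?f" by blast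
  then show ?thesis by (metis countable_image uncountable_def countableI_type)
qed

lemma separable_of_dense:
  assumes X: "normed_space X" and T: "lin_c00 X T" "dense_c00 X T"
  shows "separable_space (ntop X)"
proof -
  interpret X: normed_space X by fact
  note T' = X.lin_c00D[OF T(1)]
  interpret M: Metric_space "carrier X" "ndist X" by (rule X.Metric_space)
  let ?D = "range (\<lambda>q. T (rat_c00 q))"
  have "M.mtopology closure_of ?D = topspace M.mtopology"
  proof (intro equalityI subsetI)
    fix x assume "x \<in> topspace M.mtopology"
    then have x: "x \<in> carrier X" by simp
    have "\<exists>y\<in>?D. y \<in> M.mball x e" if e: "0 < e" for e
    proof -
      obtain c where c: "nrm X (x \<ominus>\<^bsub>X\<^esub> T c) < e / 2"
        using T(2) x half_gt_zero[OF e] unfolding dense_c00_def by blast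
      obtain q where q: "nrm X (T (c - rat_c00 q)) < e / 2"
        using rat_c00_dense[OF X.seminorm_lin_c00[OF T(1)] half_gt_zero[OF e]] by blast
      have "nrm X (x \<ominus>\<^bsub>X\<^esub> T (rat_c00 q)) < e"
        using X.nrm_triangle_diff[OF x T'(1) T'(1), of "rat_c00 q" c] c q unfolding T'(5) by linarith
      then show ?thesis using x T'(1) by (intro bexI[of _ "T (rat_c00 q)"]) (auto simp: ndist_def)
    qed
    then show "x \<in> M.mtopology closure_of ?D" using x unfolding M.metric_closure_of by blast
  qed (auto simp: closure_of_def)
  moreover have "countable ?D" by (rule countable_image[OF countable_V])
  ultimately show ?thesis
    unfolding separable_space_def ntop_def using T'(1) by (intro exI[of _ ?D]) auto
qed

theorem ell2_separable_infinite_dimensional_banach: "separable_infinite_dimensional_banach ell2"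
  unfolding separable_infinite_dimensional_banach_def
proof (intro conjI banach_ell2)
  show "separable_space (ntop ell2)"
    by (rule separable_of_dense[OF normed_ell2 lin_lookup dense_lookup])
  show "\<not> finite_dimensional ell2"
  proof (rule not_finite_dimensional[OF ell2.pseudonormed_space_axioms lin_lookup, where k = 0])
    show "x = 0" if "Poly_Mapping.lookup x = \<zero>\<^bsub>ell2\<^esub>" for x :: c00
      using that by (intro poly_mapping_eqI) simp
  qed
qed

text \<open>The unit vectors are sent to the members of a dense sequence, so their images alone are
  dense.\<close>

lemma separable_dense_c00:
  assumes X: "normed_space X" and sep: "separable_space (ntop X)"
  obtains T where "lin_c00 X T" "dense_c00 X T"
proof -
  interpret X: normed_space X by fact
  interpret M: Metric_space "carrier X" "ndist X" by (rule X.Metric_space)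
  obtain D where D: "countable D" "D \<subseteq> carrier X" "M.mtopology closure_of D = carrier X"
    using sep unfolding separable_space_def ntop_def by auto
  have ne: "D \<noteq> {}" using D(3) X.M.zero_closed by force
  define d where "d = from_nat_into D"
  have range_d: "range d = D" unfolding d_def by (rule range_from_nat_into[OF ne D(1)])
  have dc: "d i \<in> carrier X" for i using D(2) range_d by blast
  define T where "T x = (\<Oplus>\<^bsub>X\<^esub>i\<in>Poly_Mapping.keys x. Poly_Mapping.lookup x i \<odot>\<^bsub>X\<^esub> d i)" for x :: c00
  have sup: "T x = (\<Oplus>\<^bsub>X\<^esub>i\<in>A. Poly_Mapping.lookup x i \<odot>\<^bsub>X\<^esub> d i)"
    if "finite A" "Poly_Mapping.keys x \<subseteq> A" for A x
    unfolding T_def using that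
    by (intro X.M.add.finprod_mono_neutral_cong_left) (auto simp: dc in_keys_iff)
  have lin: "lin_c00 X T"
    unfolding lin_c00_def
  proof (intro conjI allI)
    fix x y :: c00 and c :: real
    show "T x \<in> carrier X" unfolding T_def by (rule X.M.finsum_closed) (auto simp: dc)
    let ?A = "Poly_Mapping.keys x \<union> Poly_Mapping.keys y"
    have "T (x + y) = (\<Oplus>\<^bsub>X\<^esub>i\<in>?A. Poly_Mapping.lookup x i \<odot>\<^bsub>X\<^esub> d i \<oplus>\<^bsub>X\<^esub> Poly_Mapping.lookup y i \<odot>\<^bsub>X\<^esub> d i)"
      unfolding sup[OF finite_UnI[OF finite_keys finite_keys] Poly_Mapping.keys_add]
      by (rule X.M.finsum_cong') (auto simp: lookup_add X.sm_add_left dc)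
    also have "\<dots> = (\<Oplus>\<^bsub>X\<^esub>i\<in>?A. Poly_Mapping.lookup x i \<odot>\<^bsub>X\<^esub> d i) \<oplus>\<^bsub>X\<^esub> (\<Oplus>\<^bsub>X\<^esub>i\<in>?A. Poly_Mapping.lookup y i \<odot>\<^bsub>X\<^esub> d i)"
      by (rule X.M.finsum_addf) (auto simp: dc)
    finally show "T (x + y) = T x \<oplus>\<^bsub>X\<^esub> T y"
      by (simp add: sup[of ?A])
    have "c \<odot>\<^bsub>X\<^esub> T x = (\<Oplus>\<^bsub>X\<^esub>i\<in>Poly_Mapping.keys x. c \<odot>\<^bsub>X\<^esub> (Poly_Mapping.lookup x i \<odot>\<^bsub>X\<^esub> d i))"
      unfolding T_def by (rule X.finsum_smult_ldistr) (auto simp: dc)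
    also have "\<dots> = (\<Oplus>\<^bsub>X\<^esub>i\<in>Poly_Mapping.keys x. Poly_Mapping.lookup (c *\<^sub>R x) i \<odot>\<^bsub>X\<^esub> d i)"
      by (rule X.M.finsum_cong') (auto simp: X.sm_mult dc)
    finally show "T (c *\<^sub>R x) = c \<odot>\<^bsub>X\<^esub> T x"
      using sup[OF finite_keys keys_scaleR[of c x]] by simp
  qed
  have Td: "T (Poly_Mapping.single i 1) = d i" for i
    using sup[of "{i}" "Poly_Mapping.single i 1"] dc[of i] by simp
  have "dense_c00 X T"
    unfolding dense_c00_def
  proof (intro ballI allI impI)
    fix x and e :: real assume x: "x \<in> carrier X" and e: "0 < e"
    then have "x \<in> M.mtopology closure_of D" using D(3) by simp
    then obtain y where y: "y \<in> D" "y \<in> M.mball x e"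
      using e unfolding M.metric_closure_of by blast
    then obtain i where "y = d i" using range_d by blast
    then show "\<exists>c. nrm X (x \<ominus>\<^bsub>X\<^esub> T c) < e"
      using y x dc by (intro exI[of _ "Poly_Mapping.single i 1"]) (simp add: Td ndist_def)
  qed
  with lin show ?thesis by (rule that)
qed

section \<open>Hilbertian pseudonorms\<close>

text \<open>Forms may vanish on nonzero vectors: pseudonorms have null spaces, and definiteness is
  not preserved by limits.\<close>

definition semi_inner :: "(c00 \<Rightarrow> c00 \<Rightarrow> real) \<Rightarrow> bool" where
  "semi_inner b \<longleftrightarrow> (\<forall>x y z. b (x + y) z = b x z + b y z) \<and> (\<forall>c x y. b (c *\<^sub>R x) y = c * b x y) \<and>
     (\<forall>x y. b x y = b y x) \<and> (\<forall>x. 0 \<le> b x x)"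

lemma semi_innerD:
  assumes "semi_inner b"
  shows "b (x + y) z = b x z + b y z" "b (c *\<^sub>R x) y = c * b x y" "b x y = b y x" "0 \<le> b x x"
    "b z (x + y) = b z x + b z y" "b x (c *\<^sub>R y) = c * b x y" "b (x - y) z = b x z - b y z"
    "b z (x - y) = b z x - b z y" "b 0 x = 0" "b x 0 = 0" "\<bar>b x y\<bar> \<le> (b x x + b y y) / 2"
    "b (\<Sum>i\<in>A. f i *\<^sub>R g i) z = (\<Sum>i\<in>A. f i * b (g i) z)"
proof -
  show *: "b (x + y) z = b x z + b y z" "b (c *\<^sub>R x) y = c * b x y" "b x y = b y x" "0 \<le> b x x" for x y z c
    using assms by (auto simp: semi_inner_def)
  show **: "b z (x + y) = b z x + b z y" for x y z
    using *(1)[of x y z] *(3)[of z "x + y"] *(3)[of z x] *(3)[of z y] by linarith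
  show "b x (c *\<^sub>R y) = c * b x y" for x y c
    using *(2)[of c y x] by (simp only: *(3)[of x "c *\<^sub>R y"] *(3)[of x y])
  show d: "b (x - y) z = b x z - b y z" for x y z
    using *(1)[of "x - y" y z] by simp
  show d': "b z (x - y) = b z x - b z y" for x y z
    using d[of x y z] *(3)[of z "x - y"] *(3)[of z x] *(3)[of z y] by linarith
  show 0: "b 0 x = 0" for x using *(2)[of 0 0 x] by simp
  show "b x 0 = 0" using 0[of x] *(3)[of x 0] by simp
  have "0 \<le> b x x + b x y + (b y x + b y y)"
    using *(4)[of "x + y"] *(1)[of x y "x + y"] **[of x x y] **[of y x y] by linarith
  moreover have "0 \<le> b x x - b x y - (b y x - b y y)"
    using *(4)[of "x - y"] d[of x y "x - y"] d'[of x x y] d'[of y x y] by linarith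
  ultimately show "\<bar>b x y\<bar> \<le> (b x x + b y y) / 2"
    unfolding *(3)[of y x] abs_le_iff by (simp add: field_simps)
  show "b (\<Sum>i\<in>A. f i *\<^sub>R g i) z = (\<Sum>i\<in>A. f i * b (g i) z)"
    by (induction A rule: infinite_finite_induct) (simp_all add: *(1,2) 0)
qed

text \<open>The inequality \<open>\<bar>t * b z y\<bar> \<le> b y y / 2\<close> holds for every real
  \<open>t\<close>, which forces \<open>b z y = 0\<close>.\<close>

lemma semi_inner_null:
  assumes b: "semi_inner b" and z: "b z z = 0"
  shows "b z y = 0"
proof -
  note B = semi_innerD[OF b]
  have "\<bar>t * b z y\<bar> \<le> b y y / 2" for t
    using B(11)[of "t *\<^sub>R z" y] by (simp add: B z)
  from this[of "(b y y + 1) / b z y"] show ?thesis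
    using B(4)[of y] by (cases "b z y = 0") auto
qed

lemma semi_inner_Lim:
  assumes U: "limit_filter U" and b: "\<And>i. semi_inner (b i)" and lim: "\<And>x y. ((\<lambda>i. b i x y) \<longlongrightarrow> c x y) U"
  shows "semi_inner c"
  unfolding semi_inner_def
proof (intro conjI allI)
  note nb = limit_filter_nonbot[OF U]
  fix x y z r
  show "c (x + y) z = c x z + c y z"
    by (rule tendsto_unique[OF nb lim]) (simp add: semi_innerD(1)[OF b] tendsto_add lim)
  show "c (r *\<^sub>R x) y = r * c x y"
    by (rule tendsto_unique[OF nb lim]) (simp add: semi_innerD(2)[OF b] tendsto_mult_left lim)
  show "c x y = c y x"
    by (rule tendsto_unique[OF nb lim]) (subst semi_innerD(3)[OF b], rule lim)
  show "0 \<le> c x x"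
    by (rule tendsto_lowerbound[OF lim _ nb]) (simp add: semi_innerD(4)[OF b])
qed

lemma semi_inner_compose:
  assumes "semi_inner b" "linear S"
  shows "semi_inner (\<lambda>x y. b (S x) (S y))"
  using semi_innerD[OF assms(1)] by (simp add: semi_inner_def linear_add[OF assms(2)] linear_scale[OF assms(2)])

text \<open>\<open>C\<close> is the square of the constant of equivalence. The normalisation of
  \<open>b\<close> from above by \<open>\<nu>\<close> bounds all values of \<open>b\<close> in terms
  of \<open>\<nu>\<close>, so such forms have limits whenever the pseudonorms converge.\<close>

definition hilbert_const :: "real \<Rightarrow> (c00 \<Rightarrow> real) \<Rightarrow> bool" where
  "hilbert_const C \<nu> \<longleftrightarrow> (\<exists>b. semi_inner b \<and> (\<forall>x. b x x \<le> (\<nu> x)\<^sup>2 \<and> (\<nu> x)\<^sup>2 \<le> C * b x x))"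

lemma hilbert_const_mono: "hilbert_const C \<nu> \<Longrightarrow> C \<le> C' \<Longrightarrow> hilbert_const C' \<nu>"
  unfolding hilbert_const_def by (meson mult_right_mono order_trans semi_innerD(4))

lemma hilbert_constI:
  assumes b: "semi_inner b" and C: "0 < C" "\<And>x. b x x \<le> C * (\<nu> x)\<^sup>2" "\<And>x. (\<nu> x)\<^sup>2 \<le> C * b x x"
  shows "hilbert_const (C * C) \<nu>"
  unfolding hilbert_const_def
proof (intro exI conjI allI)
  show "semi_inner (\<lambda>x y. b x y / C)"
    using semi_innerD[OF b] C(1) by (simp add: semi_inner_def add_divide_distrib)
  show "b x x / C \<le> (\<nu> x)\<^sup>2" for x using C by (simp add: divide_le_eq mult.commute)
  show "(\<nu> x)\<^sup>2 \<le> C * C * (b x x / C)" for x using C by simp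
qed

text \<open>Compactness of the admissible forms:
  \<open>\<bar>b x y\<bar> \<le> (b x x + b y y) / 2\<close> keeps them bounded at each pair of
  vectors, so they have a limit form, and both inequalities persist.\<close>

lemma hilbert_const_Lim:
  assumes U: "limit_filter U" and h: "\<And>i. hilbert_const C (p i)" and lim: "\<And>x. ((\<lambda>i. p i x) \<longlongrightarrow> q x) U"
  shows "hilbert_const C q"
proof -
  note nb = limit_filter_nonbot[OF U]
  obtain b where b: "\<And>i. semi_inner (b i)" "\<And>i x. b i x x \<le> (p i x)\<^sup>2" "\<And>i x. (p i x)\<^sup>2 \<le> C * b i x x"
    using h unfolding hilbert_const_def by metis
  define c where "c x y = Lim U (\<lambda>i. b i x y)" for x y
  have l: "((\<lambda>i. b i x y) \<longlongrightarrow> c x y) U" for x y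
    unfolding c_def
  proof (rule limit_filter_tendsto_Lim[OF U])
    have "((\<lambda>i. ((p i x)\<^sup>2 + (p i y)\<^sup>2) / 2) \<longlongrightarrow> ((q x)\<^sup>2 + (q y)\<^sup>2) / 2) U"
      by (intro tendsto_intros lim) simp
    then have "\<forall>\<^sub>F i in U. ((p i x)\<^sup>2 + (p i y)\<^sup>2) / 2 < ((q x)\<^sup>2 + (q y)\<^sup>2) / 2 + 1"
      by (rule order_tendstoD) simp
    then show "\<forall>\<^sub>F i in U. \<bar>b i x y\<bar> \<le> ((q x)\<^sup>2 + (q y)\<^sup>2) / 2 + 1"
    proof (rule eventually_mono)
      fix i assume "((p i x)\<^sup>2 + (p i y)\<^sup>2) / 2 < ((q x)\<^sup>2 + (q y)\<^sup>2) / 2 + 1"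
      then show "\<bar>b i x y\<bar> \<le> ((q x)\<^sup>2 + (q y)\<^sup>2) / 2 + 1"
        using semi_innerD(11)[OF b(1), of i x y] b(2)[of i x] b(2)[of i y] by (simp add: field_simps)
    qed
  qed
  show ?thesis
    unfolding hilbert_const_def
  proof (intro exI conjI allI)
    show "semi_inner c" by (rule semi_inner_Lim[OF U b(1) l])
    show "c x x \<le> (q x)\<^sup>2" for x
      by (rule tendsto_le[OF nb tendsto_power[OF lim] l]) (simp add: b)
    show "(q x)\<^sup>2 \<le> C * c x x" for x
      by (rule tendsto_le[OF nb tendsto_mult_left[OF l] tendsto_power[OF lim]]) (simp add: b)
  qed
qed

text \<open>Downward induction on \<open>j\<close>: the vector \<open>e\<^sub>j\<close> either keeps a positive distance from the span
  of the later unit vectors, or it lies in their closure.\<close>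

lemma hilbert_const_of_tail:
  assumes \<nu>: "seminorm \<nu>" and C: "0 < C"
    "\<And>x. Poly_Mapping.keys x \<subseteq> {k..} \<Longrightarrow> l2 x \<le> C * \<nu> x \<and> \<nu> x \<le> C * l2 x"
  shows "\<exists>C. hilbert_const C \<nu>"
proof -
  interpret seminorm \<nu> by fact
  define W where "W j = {x :: c00. Poly_Mapping.keys x \<subseteq> {j..}}" for j
  define Q where "Q j \<longleftrightarrow> (\<exists>b C. semi_inner b \<and> 0 < C \<and> (\<forall>x\<in>W j. b x x \<le> C * (\<nu> x)\<^sup>2 \<and> (\<nu> x)\<^sup>2 \<le> C * b x x))" for j
  have "Q k"
  proof -
    define b where "b x y = (\<Sum>i\<in>Poly_Mapping.keys x. Poly_Mapping.lookup x i * Poly_Mapping.lookup y i)" for x y :: c00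
    have b_sup: "b x y = (\<Sum>i\<in>A. Poly_Mapping.lookup x i * Poly_Mapping.lookup y i)"
      if "finite A" "Poly_Mapping.keys x \<subseteq> A" for x y A
      unfolding b_def using that by (intro sum.mono_neutral_left) (auto simp: in_keys_iff)
    have "semi_inner b"
      unfolding semi_inner_def
    proof (intro conjI allI)
      fix x y z :: c00 and c :: real
      let ?A = "Poly_Mapping.keys x \<union> Poly_Mapping.keys y"
      show "b (x + y) z = b x z + b y z"
        using Poly_Mapping.keys_add[of x y] by (simp add: b_sup[of ?A] lookup_add distrib_right sum.distrib)
      show "b (c *\<^sub>R x) y = c * b x y"
        using keys_scaleR[of c x] by (simp add: b_sup[of "Poly_Mapping.keys x"] sum_distrib_left mult.assoc)
      show "b x y = b y x" by (simp add: b_sup[of ?A] mult.commute)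
      show "0 \<le> b x x" unfolding b_def by (intro sum_nonneg) simp
    qed
    moreover have bl: "b x x = (l2 x)\<^sup>2" for x
      by (simp add: b_def l2_def L2_set_def sum_nonneg power2_eq_square)
    have "b x x \<le> C\<^sup>2 * (\<nu> x)\<^sup>2 \<and> (\<nu> x)\<^sup>2 \<le> C\<^sup>2 * b x x" if "x \<in> W k" for x
      using C(2)[of x] that power_mono[of "l2 x" "C * \<nu> x" 2] power_mono[of "\<nu> x" "C * l2 x" 2]
      by (simp add: W_def bl power_mult_distrib)
    ultimately show ?thesis unfolding Q_def using C(1) by (intro exI[of _ b] exI[of _ "C\<^sup>2"]) auto
  qed
  moreover have "Q j" if Qj: "Q (Suc j)" for j
  proof -
    obtain b D where b: "semi_inner b" and D: "0 < D"
      "\<And>x. x \<in> W (Suc j) \<Longrightarrow> b x x \<le> D * (\<nu> x)\<^sup>2" "\<And>x. x \<in> W (Suc j) \<Longrightarrow> (\<nu> x)\<^sup>2 \<le> D * b x x"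
      using Qj unfolding Q_def by blast
    let ?e = "Poly_Mapping.single j 1 :: c00"
    \<comment> \<open>\<open>\<pi>\<close> drops the coordinates below \<open>j\<close> and is the
      identity on \<open>W j\<close>. \<open>\<sigma> w\<close> moreover replaces the unit vector
      \<open>?e\<close> by \<open>- w\<close>, so it maps into \<open>W (Suc j)\<close> and changes
      a vector of \<open>W j\<close> by a multiple of \<open>?e + w\<close>.\<close>
    define \<pi> where "\<pi> = comb (\<lambda>i. if i < j then 0 else Poly_Mapping.single i (1::real))"
    define \<sigma> where "\<sigma> w = comb (\<lambda>i. if i < j then 0 else if i = j then - w else Poly_Mapping.single i (1::real))" for w
    have lin: "linear \<pi>" "linear (\<sigma> w)" for w unfolding \<pi>_def \<sigma>_def by (rule linear_comb)+
    have \<pi>W: "\<pi> x = x" if "x \<in> W j" for x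
    proof -
      have "\<pi> x = comb (\<lambda>i. Poly_Mapping.single i 1) x"
        unfolding \<pi>_def using that by (intro comb_cong) (auto simp: W_def)
      then show ?thesis by (simp add: comb_units)
    qed
    have subW: "subspace (W i)" for i
      unfolding W_def by (rule subspaceI) (use Poly_Mapping.keys_add keys_scaleR in \<open>fastforce+\<close>)
    have \<sigma>W: "\<sigma> w x \<in> W (Suc j)" if w: "w \<in> W (Suc j)" for w x
      unfolding \<sigma>_def comb_def
    proof (intro subspace_sum[OF subW] subspace_scale[OF subW])
      fix i
      show "(if i < j then 0 else if i = j then - w else Poly_Mapping.single i 1) \<in> W (Suc j)"
        using w subspace_0[OF subW] subspace_neg[OF subW w] by (auto simp: W_def)
    qed
    have diff: "\<pi> x - \<sigma> w x = Poly_Mapping.lookup x j *\<^sub>R (?e + w)" for x w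
    proof -
      have "\<pi> x - \<sigma> w x = (\<Sum>i\<in>insert j (Poly_Mapping.keys x). Poly_Mapping.lookup x i *\<^sub>R (if i = j then ?e + w else 0))"
        unfolding \<pi>_def \<sigma>_def
        by (subst (1 2) comb_superset[of "insert j (Poly_Mapping.keys x)"])
           (auto simp: sum_subtractf[symmetric] scaleR_diff_right[symmetric] intro!: sum.cong)
      also have "\<dots> = (\<Sum>i\<in>insert j (Poly_Mapping.keys x). if i = j then Poly_Mapping.lookup x j *\<^sub>R (?e + w) else 0)"
        by (intro sum.cong) auto
      finally show ?thesis by (simp add: sum.delta)
    qed
    show ?thesis
    proof (cases "\<exists>\<delta>>0. \<forall>w\<in>W (Suc j). \<delta> \<le> \<nu> (?e + w)")
      case True
      then obtain \<delta> where \<delta>: "0 < \<delta>" "\<And>w. w \<in> W (Suc j) \<Longrightarrow> \<delta> \<le> \<nu> (?e + w)" by blast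
      \<comment> \<open>As \<open>?e\<close> keeps distance \<open>\<delta>\<close> from the later
        vectors, the coordinate at \<open>j\<close> is bounded by \<open>\<nu> x / \<delta>\<close>;
        its square can therefore be added to the form.\<close>
      define b' where "b' x y = Poly_Mapping.lookup x j * Poly_Mapping.lookup y j + b (\<sigma> 0 x) (\<sigma> 0 y)" for x y
      have 0: "0 \<in> W (Suc j)" by (simp add: W_def)
      have "semi_inner b'"
        using semi_innerD[OF semi_inner_compose[OF b lin(2)[of 0]]]
        unfolding semi_inner_def b'_def by (auto simp: lookup_add algebra_simps)
      moreover
      define E where "E = \<nu> ?e"
      \<comment> \<open>The first two summands are used to bound \<open>b'\<close> by
        \<open>\<nu>\<close>, the last two to bound \<open>\<nu>\<close> by
        \<open>b'\<close>.\<close>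
      define D' where "D' = 1 / \<delta>\<^sup>2 + D * (1 + E / \<delta>)\<^sup>2 + 2 * E\<^sup>2 + 2 * D"
      have E: "0 \<le> E" by (simp add: E_def)
      have D'pos: "0 < D'" unfolding D'_def using D(1) \<delta>(1) E
        by (intro add_nonneg_pos add_nonneg_nonneg) auto
      have "b' x x \<le> D' * (\<nu> x)\<^sup>2 \<and> (\<nu> x)\<^sup>2 \<le> D' * b' x x" if x: "x \<in> W j" for x
      proof
        let ?c = "Poly_Mapping.lookup x j" and ?x = "\<sigma> 0 x"
        have x': "?x \<in> W (Suc j)" by (rule \<sigma>W[OF 0])
        have eq: "x = ?c *\<^sub>R ?e + ?x" using diff[of x 0] \<pi>W[OF x] by (simp add: algebra_simps)
        have c: "\<delta> * \<bar>?c\<bar> \<le> \<nu> x"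
        proof (cases "?c = 0")
          case False
          have "inverse ?c *\<^sub>R ?x \<in> W (Suc j)" by (rule subspace_scale[OF subW x'])
          then have "\<delta> \<le> \<nu> (?e + inverse ?c *\<^sub>R ?x)" by (rule \<delta>(2))
          then have "\<bar>?c\<bar> * \<delta> \<le> \<nu> (?c *\<^sub>R (?e + inverse ?c *\<^sub>R ?x))" by (simp only: scale mult_left_mono abs_ge_zero)
          also have "?c *\<^sub>R (?e + inverse ?c *\<^sub>R ?x) = ?c *\<^sub>R ?e + ?x"
            using False by (simp add: scaleR_add_right)
          also have "\<dots> = x" by (rule eq[symmetric])
          finally show ?thesis by (simp add: mult.commute)
        qed simp
        have c2: "?c\<^sup>2 \<le> 1 / \<delta>\<^sup>2 * (\<nu> x)\<^sup>2"
          using power_mono[OF c, of 2] \<delta>(1) by (simp add: power_mult_distrib field_simps)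
        have "\<nu> ?x \<le> \<nu> x + \<nu> (?c *\<^sub>R ?e)"
          using triangle[of x "- (?c *\<^sub>R ?e)"] eq by (simp add: minus) (metis add_diff_cancel_left')
        then have "\<nu> ?x \<le> \<nu> x + \<bar>?c\<bar> * E" by (simp add: scale E_def)
        moreover have "\<bar>?c\<bar> \<le> \<nu> x / \<delta>" using c \<delta>(1) by (simp add: pos_le_divide_eq mult.commute)
        then have "\<bar>?c\<bar> * E \<le> \<nu> x / \<delta> * E" using E by (rule mult_right_mono)
        ultimately have "\<nu> ?x \<le> (1 + E / \<delta>) * \<nu> x" by (simp add: algebra_simps)
        then have "(\<nu> ?x)\<^sup>2 \<le> (1 + E / \<delta>)\<^sup>2 * (\<nu> x)\<^sup>2"
          using power_mono[of "\<nu> ?x" _ 2] by (simp flip: power_mult_distrib)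
        then have "b ?x ?x \<le> D * ((1 + E / \<delta>)\<^sup>2 * (\<nu> x)\<^sup>2)"
          using D(1) D(2)[OF x'] by (meson less_imp_le mult_left_mono order_trans)
        then have "b' x x \<le> (1 / \<delta>\<^sup>2 + D * (1 + E / \<delta>)\<^sup>2) * (\<nu> x)\<^sup>2"
          using c2 by (simp add: b'_def distrib_right mult.assoc) (simp add: power2_eq_square)
        also have "\<dots> \<le> D' * (\<nu> x)\<^sup>2" unfolding D'_def using D(1) by (intro mult_right_mono) auto
        finally show "b' x x \<le> D' * (\<nu> x)\<^sup>2" .
        have bx: "0 \<le> b ?x ?x" by (rule semi_innerD(4)[OF b])
        have "\<nu> x \<le> \<bar>?c\<bar> * E + \<nu> ?x"
          using triangle[of "?c *\<^sub>R ?e" ?x] eq by (simp add: scale E_def)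
        then have "(\<nu> x)\<^sup>2 \<le> (\<bar>?c\<bar> * E + \<nu> ?x)\<^sup>2" by (intro power_mono) auto
        also have "\<dots> \<le> 2 * (\<bar>?c\<bar> * E)\<^sup>2 + 2 * (\<nu> ?x)\<^sup>2"
          using sum_squares_bound[of "\<bar>?c\<bar> * E" "\<nu> ?x"] by (simp add: power2_sum)
        also have "\<dots> \<le> 2 * (\<bar>?c\<bar> * E)\<^sup>2 + 2 * (D * b ?x ?x)"
          using D(3)[OF x'] by simp
        also have "\<dots> = 2 * E\<^sup>2 * ?c\<^sup>2 + 2 * D * b ?x ?x" by (simp add: power_mult_distrib)
        also have "\<dots> \<le> D' * ?c\<^sup>2 + D' * b ?x ?x"
          unfolding D'_def using D(1) bx by (intro add_mono mult_right_mono) auto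
        also have "\<dots> = D' * b' x x" by (simp add: b'_def power2_eq_square distrib_left)
        finally show "(\<nu> x)\<^sup>2 \<le> D' * b' x x" .
      qed
      ultimately show ?thesis unfolding Q_def using D'pos by blast
    next
      case False
      then have "\<exists>w\<in>W (Suc j). \<nu> (?e + w) < inverse (real (Suc n))" for n
        by (metis not_le inverse_positive_iff_positive of_nat_0_less_iff zero_less_Suc)
      then obtain w where w: "\<And>n. w n \<in> W (Suc j)" "\<And>n. \<nu> (?e + w n) < inverse (real (Suc n))" by metis
      obtain U :: "nat filter" where U: "U \<le> sequentially" "limit_filter U"
        using ex_limit_filter[of sequentially] by auto
      note nb = limit_filter_nonbot[OF U(2)]
      have lim0: "((\<lambda>n. \<nu> (?e + w n)) \<longlongrightarrow> 0) U"
        by (rule tendsto_mono[OF U(1)], rule tendsto_sandwich[OF _ _ tendsto_const LIMSEQ_inverse_real_of_nat])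
           (use w(2) in \<open>auto intro!: always_eventually less_imp_le simp del: of_nat_Suc\<close>)
      have lim\<sigma>: "((\<lambda>n. \<nu> (\<sigma> (w n) x)) \<longlongrightarrow> \<nu> (\<pi> x)) U" for x
      proof (rule Lim_transform2)
        have "((\<lambda>n. \<bar>Poly_Mapping.lookup x j\<bar> * \<nu> (?e + w n)) \<longlongrightarrow> \<bar>Poly_Mapping.lookup x j\<bar> * 0) U"
          by (intro tendsto_mult_left lim0)
        then have l0: "((\<lambda>n. \<nu> (\<pi> x - \<sigma> (w n) x)) \<longlongrightarrow> 0) U" by (simp only: diff scale mult_zero_right)
        show "((\<lambda>n. \<nu> (\<pi> x) - \<nu> (\<sigma> (w n) x)) \<longlongrightarrow> 0) U"
          by (rule tendsto_rabs_zero_cancel, rule tendsto_sandwich[OF _ _ tendsto_const l0])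
             (auto intro!: always_eventually abs_diff_le)
      qed simp
      \<comment> \<open>Replacing \<open>?e\<close> by \<open>- w n\<close> costs nothing in the
        limit, so the limit of the pulled back forms works on all of \<open>W j\<close>.\<close>
      define b' where "b' x y = Lim U (\<lambda>n. b (\<sigma> (w n) x) (\<sigma> (w n) y))" for x y
      have l: "((\<lambda>n. b (\<sigma> (w n) x) (\<sigma> (w n) y)) \<longlongrightarrow> b' x y) U" for x y
        unfolding b'_def
      proof (rule limit_filter_tendsto_Lim[OF U(2)])
        have "((\<lambda>n. (D * (\<nu> (\<sigma> (w n) x))\<^sup>2 + D * (\<nu> (\<sigma> (w n) y))\<^sup>2) / 2) \<longlongrightarrow>
            (D * (\<nu> (\<pi> x))\<^sup>2 + D * (\<nu> (\<pi> y))\<^sup>2) / 2) U"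
          by (intro tendsto_intros lim\<sigma>) simp
        then have "\<forall>\<^sub>F n in U. (D * (\<nu> (\<sigma> (w n) x))\<^sup>2 + D * (\<nu> (\<sigma> (w n) y))\<^sup>2) / 2 <
            (D * (\<nu> (\<pi> x))\<^sup>2 + D * (\<nu> (\<pi> y))\<^sup>2) / 2 + 1"
          by (rule order_tendstoD) simp
        then show "\<forall>\<^sub>F n in U. \<bar>b (\<sigma> (w n) x) (\<sigma> (w n) y)\<bar> \<le> (D * (\<nu> (\<pi> x))\<^sup>2 + D * (\<nu> (\<pi> y))\<^sup>2) / 2 + 1"
        proof (rule eventually_mono)
          fix n
          assume "(D * (\<nu> (\<sigma> (w n) x))\<^sup>2 + D * (\<nu> (\<sigma> (w n) y))\<^sup>2) / 2 < (D * (\<nu> (\<pi> x))\<^sup>2 + D * (\<nu> (\<pi> y))\<^sup>2) / 2 + 1"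
          then show "\<bar>b (\<sigma> (w n) x) (\<sigma> (w n) y)\<bar> \<le> (D * (\<nu> (\<pi> x))\<^sup>2 + D * (\<nu> (\<pi> y))\<^sup>2) / 2 + 1"
            using semi_innerD(11)[OF b, of "\<sigma> (w n) x" "\<sigma> (w n) y"] D(2)[OF \<sigma>W[OF w(1)], of n x] D(2)[OF \<sigma>W[OF w(1)], of n y]
            by argo
        qed
      qed
      have "semi_inner b'"
        by (rule semi_inner_Lim[OF U(2) _ l]) (rule semi_inner_compose[OF b lin(2)])
      moreover have "b' x x \<le> D * (\<nu> x)\<^sup>2 \<and> (\<nu> x)\<^sup>2 \<le> D * b' x x" if x: "x \<in> W j" for x
      proof
        have l2: "((\<lambda>n. (\<nu> (\<sigma> (w n) x))\<^sup>2) \<longlongrightarrow> (\<nu> x)\<^sup>2) U"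
          using tendsto_power[OF lim\<sigma>[of x], of 2] by (simp add: \<pi>W[OF x])
        show "b' x x \<le> D * (\<nu> x)\<^sup>2"
          by (rule tendsto_le[OF nb tendsto_mult_left[OF l2] l]) (simp add: D(2) \<sigma>W w(1))
        show "(\<nu> x)\<^sup>2 \<le> D * b' x x"
          by (rule tendsto_le[OF nb tendsto_mult_left[OF l] l2]) (simp add: D(3) \<sigma>W w(1))
      qed
      ultimately show ?thesis unfolding Q_def using D(1) by blast
    qed
  qed
  ultimately have "Q 0" by (rule inc_induct[of 0 k, OF le0])
  then obtain b D where "semi_inner b" "0 < D" "\<forall>x\<in>W 0. b x x \<le> D * (\<nu> x)\<^sup>2 \<and> (\<nu> x)\<^sup>2 \<le> D * b x x"
    unfolding Q_def by blast
  then have "hilbert_const (D * D) \<nu>" by (intro hilbert_constI[of b]) (auto simp: W_def)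
  then show ?thesis by blast
qed

lemma summable_mult_ell2:
  fixes x y :: "nat \<Rightarrow> real"
  assumes "summable (\<lambda>n. (x n)\<^sup>2)" "summable (\<lambda>n. (y n)\<^sup>2)"
  shows "summable (\<lambda>n. x n * y n)"
proof (rule summable_comparison_test'[OF summable_add[OF assms], of 0])
  fix n
  have "2 * (\<bar>x n\<bar> * \<bar>y n\<bar>) \<le> (x n)\<^sup>2 + (y n)\<^sup>2"
    using sum_squares_bound[of "\<bar>x n\<bar>" "\<bar>y n\<bar>"] by simp
  moreover have "0 \<le> \<bar>x n\<bar> * \<bar>y n\<bar>" by simp
  ultimately show "norm (x n * y n) \<le> (x n)\<^sup>2 + (y n)\<^sup>2"
    unfolding real_norm_def abs_mult by linarith
qed

lemma hilbert_const_of_ell2: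
  assumes S: "lin_c00 ell2 S" and C: "0 < C" "\<And>x. nrm ell2 (S x) \<le> C * \<nu> x" "\<And>x. \<nu> x \<le> C * nrm ell2 (S x)"
    and \<nu>: "\<And>x. 0 \<le> \<nu> x"
  shows "\<exists>C. hilbert_const C \<nu>"
proof -
  have s: "summable (\<lambda>n. (S x n)\<^sup>2)" for x using S by (simp add: lin_c00_def)
  define b where "b x y = suminf (\<lambda>n. S x n * S y n)" for x y
  have bn: "b x x = (nrm ell2 (S x))\<^sup>2" for x
    using suminf_nonneg[OF s[of x]] by (simp add: b_def power2_eq_square)
  have "semi_inner b"
    unfolding semi_inner_def b_def
  proof (intro conjI allI)
    note sm = summable_mult_ell2[OF s s]
    fix x y z c
    show "suminf (\<lambda>n. S (x + y) n * S z n) = suminf (\<lambda>n. S x n * S z n) + suminf (\<lambda>n. S y n * S z n)"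
      using S by (simp add: lin_c00_def distrib_right suminf_add[OF sm sm])
    show "suminf (\<lambda>n. S (c *\<^sub>R x) n * S y n) = c * suminf (\<lambda>n. S x n * S y n)"
      using S by (simp add: lin_c00_def mult.assoc suminf_mult[OF sm])
    show "suminf (\<lambda>n. S x n * S y n) = suminf (\<lambda>n. S y n * S x n)" by (simp add: mult.commute)
    show "0 \<le> suminf (\<lambda>n. S x n * S x n)" by (rule suminf_nonneg[OF sm]) simp
  qed
  moreover have "b x x \<le> C\<^sup>2 * (\<nu> x)\<^sup>2" for x
    using power_mono[OF C(2)[of x], of 2] suminf_nonneg[OF s[of x]] unfolding bn by (simp add: power_mult_distrib)
  moreover have "(\<nu> x)\<^sup>2 \<le> C\<^sup>2 * b x x" for x
    using power_mono[OF C(3)[of x] \<nu>, of 2] unfolding bn by (simp only: power_mult_distrib)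
  ultimately have "hilbert_const (C\<^sup>2 * C\<^sup>2) \<nu>" using C(1) by (intro hilbert_constI) auto
  then show ?thesis by blast
qed

text \<open>Since \<open>inverse 0 = 0\<close>, vectors dependent on their predecessors are replaced by \<open>0\<close>.\<close>

fun gram_schmidt :: "(c00 \<Rightarrow> c00 \<Rightarrow> real) \<Rightarrow> nat \<Rightarrow> c00" where
  "gram_schmidt b j =
    (let r = Poly_Mapping.single j 1 -
       (\<Sum>i\<in>{..<j}. b (Poly_Mapping.single j 1) (gram_schmidt b i) *\<^sub>R gram_schmidt b i)
     in inverse (sqrt (b r r)) *\<^sub>R r)"

declare gram_schmidt.simps [simp del]

context
  fixes b :: "c00 \<Rightarrow> c00 \<Rightarrow> real"
  assumes b: "semi_inner b"
begin

private abbreviation "u \<equiv> gram_schmidt b"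
private abbreviation "e j \<equiv> (Poly_Mapping.single j 1 :: c00)"

private definition r where "r j = e j - (\<Sum>i<j. b (e j) (u i) *\<^sub>R u i)"

private lemma u_r: "u j = inverse (sqrt (b (r j) (r j))) *\<^sub>R r j"
  by (subst gram_schmidt.simps) (simp add: r_def Let_def)

private lemma u_cases: "u j = 0 \<and> b (r j) (r j) = 0 \<or> b (u j) (u j) = 1 \<and> r j = sqrt (b (r j) (r j)) *\<^sub>R u j"
proof (cases "b (r j) (r j) = 0")
  case False
  then have pos: "0 < b (r j) (r j)" using semi_innerD(4)[OF b, of "r j"] by linarith
  have "b (u j) (u j) = inverse (sqrt (b (r j) (r j))) * (inverse (sqrt (b (r j) (r j))) * b (r j) (r j))"
    by (simp add: u_r semi_innerD(2,6)[OF b])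
  also have "\<dots> = 1" using pos by (simp add: field_simps)
  finally show ?thesis using pos by (simp add: u_r)
qed (simp add: u_r)

text \<open>True for zero and for normalised vectors alike, which spares the orthogonality proof a
  case distinction.\<close>

private lemma u_norm: "b (u j) (u j) * b x (u j) = b x (u j)"
  using u_cases[of j] by (auto simp: semi_innerD(10)[OF b])

private lemma orth: "i < j \<Longrightarrow> b (u i) (u j) = 0"
proof (induction j arbitrary: i rule: less_induct)
  case (less j)
  have *: "b (u l) (u i) = (if l = i then b (u i) (u i) else 0)" if "l < j" for l
    using less.IH[of i l] less.IH[of l i] less.prems that semi_innerD(3)[OF b, of "u l" "u i"]
    by (cases l i rule: linorder_cases) auto
  have "b (\<Sum>l<j. b (e j) (u l) *\<^sub>R u l) (u i) = (\<Sum>l<j. b (e j) (u l) * b (u l) (u i))"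
    by (rule semi_innerD(12)[OF b])
  also have "\<dots> = (\<Sum>l<j. if l = i then b (e j) (u i) * b (u i) (u i) else 0)"
  proof (rule sum.cong[OF refl])
    fix l assume "l \<in> {..<j}"
    then show "b (e j) (u l) * b (u l) (u i) = (if l = i then b (e j) (u i) * b (u i) (u i) else 0)"
      using *[of l] by (cases "l = i") simp_all
  qed
  also have "\<dots> = b (e j) (u i)"
    using less.prems u_norm[of i "e j"] by (simp add: mult.commute)
  finally have "b (r j) (u i) = 0" by (simp add: r_def semi_innerD(7)[OF b])
  then have "b (u j) (u i) = 0" by (simp add: u_r semi_innerD(2)[OF b])
  then show ?case using semi_innerD(3)[OF b, of "u i" "u j"] by simp
qed

private lemma orth': "i \<noteq> j \<Longrightarrow> b (u i) (u j) = 0"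
  using orth[of i j] orth[of j i] semi_innerD(3)[OF b, of "u i" "u j"] by (cases i j rule: linorder_cases) auto

private lemma unit_expand: "b (e j) z = (\<Sum>i<Suc j. b (e j) (u i) * b (u i) z)"
proof -
  have eu: "b (e j) (u j) = b (r j) (u j)"
  proof -
    have "b (\<Sum>l<j. b (e j) (u l) *\<^sub>R u l) (u j) = (\<Sum>l<j. b (e j) (u l) * b (u l) (u j))"
      by (rule semi_innerD(12)[OF b])
    also have "\<dots> = 0" by (rule sum.neutral) (simp add: orth)
    finally show ?thesis by (simp add: r_def semi_innerD(7)[OF b])
  qed
  have "b (r j) z = b (r j) (u j) * b (u j) z"
    using u_cases[of j]
  proof
    assume "u j = 0 \<and> b (r j) (r j) = 0"
    then show ?thesis using semi_inner_null[OF b, of "r j" z] by (simp add: semi_innerD(10)[OF b])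
  next
    assume h: "b (u j) (u j) = 1 \<and> r j = sqrt (b (r j) (r j)) *\<^sub>R u j"
    define s where "s = sqrt (b (r j) (r j))"
    have rs: "r j = s *\<^sub>R u j" using h by (simp add: s_def)
    show ?thesis unfolding rs using h by (simp add: semi_innerD(2)[OF b])
  qed
  moreover have "b (e j) z = b (r j) z + (\<Sum>i<j. b (e j) (u i) * b (u i) z)"
    by (simp add: r_def semi_innerD(7)[OF b] semi_innerD(12)[OF b])
  ultimately show ?thesis by (simp add: eu)
qed

private lemma unit_orth: "j < i \<Longrightarrow> b (e j) (u i) = 0"
  unfolding unit_expand[of j "u i"] by (rule sum.neutral) (simp add: orth)

text \<open>Parseval's identity for a possibly degenerate form. The sum stops at \<open>K\<close>
  because each unit vector below \<open>K\<close> is, up to a null vector of \<open>b\<close>, a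
  combination of the first \<open>K\<close> vectors of the system.\<close>

lemma gram_schmidt_expand:
  assumes x: "Poly_Mapping.keys x \<subseteq> {..<K}"
  shows "b x z = (\<Sum>i<K. b x (u i) * b (u i) z)"
proof -
  have bx: "b x y = (\<Sum>j\<in>Poly_Mapping.keys x. Poly_Mapping.lookup x j * b (e j) y)" for y
    using semi_innerD(12)[OF b, of "Poly_Mapping.lookup x" e "Poly_Mapping.keys x" y]
    by (simp add: comb_units[unfolded comb_def])
  have "b (e j) z = (\<Sum>i<K. b (e j) (u i) * b (u i) z)" if "j \<in> Poly_Mapping.keys x" for j
    unfolding unit_expand[of j z]
    by (rule sum.mono_neutral_left) (use that x unit_orth in \<open>auto simp: not_less Suc_le_eq\<close>)
  then have "b x z = (\<Sum>j\<in>Poly_Mapping.keys x. Poly_Mapping.lookup x j * (\<Sum>i<K. b (e j) (u i) * b (u i) z))"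
    by (subst bx) (rule sum.cong, auto)
  also have "\<dots> = (\<Sum>j\<in>Poly_Mapping.keys x. \<Sum>i<K. Poly_Mapping.lookup x j * b (e j) (u i) * b (u i) z)"
    by (simp add: sum_distrib_left mult.assoc)
  also have "\<dots> = (\<Sum>i<K. \<Sum>j\<in>Poly_Mapping.keys x. Poly_Mapping.lookup x j * b (e j) (u i) * b (u i) z)"
    by (rule sum.swap)
  also have "\<dots> = (\<Sum>i<K. b x (u i) * b (u i) z)"
    by (subst bx) (simp add: sum_distrib_right)
  finally show ?thesis .
qed

lemma gram_schmidt_orthonormal: "i \<noteq> j \<Longrightarrow> b (u i) (u j) = 0" "u j = 0 \<or> b (u j) (u j) = 1"
  using orth' u_cases by blast+

lemma gram_schmidt_support:
  assumes x: "Poly_Mapping.keys x \<subseteq> {..<K}" and i: "K \<le> i"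
  shows "b x (u i) = 0"
  by (subst gram_schmidt_expand[OF x], rule sum.neutral) (use i in \<open>auto simp: orth'\<close>)

end

text \<open>Taking coefficients with respect to the nonzero Gram-Schmidt vectors is isometric for
  \<open>b\<close> and has dense range in \<open>ell2\<close>. Infinite dimension guarantees that
  there are infinitely many of these vectors.\<close>

lemma isomorphic_ell2_of_hilbert:
  assumes X: "banach_space X" and T: "lin_c00 X T" "dense_c00 X T" and nfd: "\<not> finite_dimensional X"
    and h: "hilbert_const C (\<lambda>x. nrm X (T x))"
  shows "X \<simeq>\<^sub>l ell2"
proof -
  have nX: "normed_space X" using X by (simp add: banach_space_def)
  interpret X: normed_space X by fact
  let ?\<nu> = "\<lambda>x. nrm X (T x)"
  obtain b where b: "semi_inner b" and bC: "\<And>x. b x x \<le> (?\<nu> x)\<^sup>2" "\<And>x. (?\<nu> x)\<^sup>2 \<le> C * b x x"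
    using h by (auto simp: hilbert_const_def)
  note B = semi_innerD[OF b] and expand = gram_schmidt_expand[OF b]
    and on = gram_schmidt_orthonormal[OF b] and supp = gram_schmidt_support[OF b]
  let ?u = "gram_schmidt b"
  have \<nu>0: "0 \<le> ?\<nu> x" for x by (rule X.nrm_nonneg[OF X.lin_c00D(1)[OF T(1)]])
  have keys: "\<exists>K. Poly_Mapping.keys x \<subseteq> {..<K}" for x :: c00
    using finite_nat_bounded[OF finite_keys[of x]] by simp
  define J where "J = {j. ?u j \<noteq> 0}"
  have "infinite J"
  proof
    assume "finite J"
    have "inf_dim ?\<nu>" by (rule inf_dim_of_not_finite_dimensional[OF nX T nfd])
    then obtain x d where d: "0 < d" "\<forall>w\<in>span (?u ` J). d \<le> ?\<nu> (x - w)"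
      unfolding inf_dim_def using \<open>finite J\<close> by (meson finite_imageI)
    obtain K where K: "Poly_Mapping.keys x \<subseteq> {..<K}" using keys by blast
    \<comment> \<open>The \<open>b\<close>-orthogonal projection of \<open>x\<close>. It leaves a
      remainder that is null for \<open>b\<close>, hence for the norm, against the positive distance
      \<open>d\<close>.\<close>
    define w where "w = (\<Sum>i<K. b x (?u i) *\<^sub>R ?u i)"
    have w_span: "w \<in> span (?u ` J)"
      unfolding w_def
    proof (intro span_sum span_scale)
      fix i
      show "?u i \<in> span (?u ` J)"
        by (cases "i \<in> J") (auto simp: J_def span_zero intro: span_base)
    qed
    have "b x z = b w z" for z
      unfolding w_def B(12) by (rule expand[OF K])
    then have "b (x - w) (x - w) = 0" by (simp add: B(7))
    then have "(?\<nu> (x - w))\<^sup>2 \<le> 0" using bC(2)[of "x - w"] by simp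
    then have "?\<nu> (x - w) = 0" by simp
    then show False using d w_span by fastforce
  qed
  define g where "g n = ?u (enumerate J n)" for n
  have mono: "strict_mono (enumerate J)" using \<open>infinite J\<close> by (rule strict_mono_enumerate)
  have rng: "range (enumerate J) = J" using \<open>infinite J\<close> by (rule range_enumerate)
  have gJ: "enumerate J n \<in> J" for n using rng by blast
  have gg: "b (g m) (g n) = (if m = n then 1 else 0)" for m n
    using on(1)[of "enumerate J m" "enumerate J n"] on(2)[of "enumerate J n"] gJ[of n] mono
    by (auto simp: g_def J_def strict_mono_eq)
  define S where "S x n = b x (g n)" for x n
  have sums: "(\<lambda>n. (S x n)\<^sup>2) sums b x x" for x
  proof -
    obtain K where K: "Poly_Mapping.keys x \<subseteq> {..<K}" using keys by blast
    have "(\<lambda>i. (b x (?u i))\<^sup>2) sums (\<Sum>i<K. (b x (?u i))\<^sup>2)"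
      by (rule sums_finite) (use supp[OF K] in auto)
    also have "(\<Sum>i<K. (b x (?u i))\<^sup>2) = b x x"
      by (subst expand[OF K, of x]) (simp add: power2_eq_square B(3)[of _ x])
    finally have "(\<lambda>i. (b x (?u i))\<^sup>2) sums b x x" .
    moreover have "(b x (?u i))\<^sup>2 = 0" if "i \<notin> range (enumerate J)" for i
      using that unfolding rng by (simp add: J_def B(10))
    ultimately show ?thesis
      unfolding S_def g_def using sums_mono_reindex[OF mono, of "\<lambda>i. (b x (?u i))\<^sup>2"] by blast
  qed
  have nS: "nrm ell2 (S x) = sqrt (b x x)" for x
    using sums_unique[OF sums[of x]] by simp
  have lin: "lin_c00 ell2 S"
    using sums_summable[OF sums] by (simp add: lin_c00_def S_def fun_eq_iff B)
  have dense: "dense_c00 ell2 S"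
    unfolding dense_c00_def
  proof (intro ballI allI impI)
    fix y :: "nat \<Rightarrow> real" and e :: real assume y: "y \<in> carrier ell2" and e: "0 < e"
    then obtain N where N: "sqrt (suminf (\<lambda>n. (y n - (if n < N then y n else 0))\<^sup>2)) < e"
      using ell2_truncate[of y e] by auto
    define c where "c = (\<Sum>i<N. y i *\<^sub>R g i)"
    have "S c n = (\<Sum>i<N. if i = n then y n else 0)" for n
      unfolding S_def c_def B(12) gg by (rule sum.cong) auto
    then have "S c n = (if n < N then y n else 0)" for n
      by simp
    then show "\<exists>c. nrm ell2 (y \<ominus>\<^bsub>ell2\<^esub> S c) < e"
      using N sums_summable[OF sums[of c]] by (intro exI[of _ c]) (simp add: ell2_diff)
  qed
  let ?C = "max 1 (sqrt \<bar>C\<bar>)"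
  show ?thesis
  proof (rule isomorphic_of_dense[OF X banach_ell2 T lin dense])
    show "0 < ?C" by simp
    show "nrm ell2 (S c) \<le> ?C * nrm X (T c)" for c
    proof -
      have "sqrt (b c c) \<le> sqrt ((?\<nu> c)\<^sup>2)" by (rule real_sqrt_le_mono[OF bC(1)])
      also have "\<dots> = 1 * ?\<nu> c" using \<nu>0[of c] by simp
      also have "\<dots> \<le> ?C * ?\<nu> c" using \<nu>0[of c] by (intro mult_right_mono) auto
      finally show ?thesis unfolding nS .
    qed
    show "nrm X (T c) \<le> ?C * nrm ell2 (S c)" for c
    proof -
      have "?\<nu> c = sqrt ((?\<nu> c)\<^sup>2)" using \<nu>0[of c] by simp
      also have "\<dots> \<le> sqrt (\<bar>C\<bar> * b c c)"
        using bC(2)[of c] B(4)[of c] by (intro real_sqrt_le_mono) (meson abs_ge_self mult_right_mono order_trans)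
      also have "\<dots> = sqrt \<bar>C\<bar> * sqrt (b c c)" by (rule real_sqrt_mult)
      also have "\<dots> \<le> ?C * sqrt (b c c)" using B(4)[of c] by (intro mult_right_mono) auto
      finally show ?thesis unfolding nS .
    qed
  qed
qed

theorem isomorphic_ell2_iff:
  assumes \<mu>: "\<mu> \<in> pseudonorms" and nfd: "\<not> finite_dimensional (X_space \<mu>)"
  shows "X_space \<mu> \<simeq>\<^sub>l ell2 \<longleftrightarrow> (\<exists>C. hilbert_const C (extension \<mu>))"
proof -
  obtain J where J: "banach_space (X_space \<mu>)" "lin_c00 (X_space \<mu>) J" "dense_c00 (X_space \<mu>) J"
    "\<And>x. nrm (X_space \<mu>) (J x) = extension \<mu> x"
    using X_space_properties[OF \<mu>] by blast
  have nX: "normed_space (X_space \<mu>)" using J(1) by (simp add: banach_space_def)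
  show ?thesis
  proof
    assume "X_space \<mu> \<simeq>\<^sub>l ell2"
    then obtain S C where S: "lin_c00 ell2 S" "0 < C" "\<And>c. nrm ell2 (S c) \<le> C * nrm (X_space \<mu>) (J c)"
      "\<And>c. nrm (X_space \<mu>) (J c) \<le> C * nrm ell2 (S c)"
      using isomorphic_dense[OF nX normed_ell2 _ J(2,3)] by metis
    show "\<exists>C. hilbert_const C (extension \<mu>)"
      by (rule hilbert_const_of_ell2[OF S(1,2)])
        (use S(3,4) J(4) seminorm.nonneg[OF extension_props(1)[OF \<mu>]] in simp_all)
  next
    assume "\<exists>C. hilbert_const C (extension \<mu>)"
    then obtain C where "hilbert_const C (\<lambda>x. nrm (X_space \<mu>) (J x))" by (auto simp: J(4))
    then show "X_space \<mu> \<simeq>\<^sub>l ell2" by (rule isomorphic_ell2_of_hilbert[OF J(1-3) nfd])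
  qed
qed

section \<open>The class of the Hilbert space is \<open>F\<^sub>\<sigma>\<close>\<close>

lemma I_props:
  assumes "I = B_norms \<or> I = P_inf" "\<mu> \<in> I"
  shows "\<mu> \<in> pseudonorms" "\<not> finite_dimensional (X_space \<mu>)"
  using assms by (auto simp: B_norms_def P_inf_def)

text \<open>A norm on \<open>c00\<close> has infinite-dimensional completion, so it lies in
  \<open>P_inf\<close> and in \<open>B_norms\<close> alike. The constructions below produce norms in
  order to serve both cases of \<open>I\<close>.\<close>

lemma norm_in_I:
  assumes I: "I = B_norms \<or> I = P_inf" and \<nu>: "seminorm \<nu>" "\<And>x. \<nu> x = 0 \<Longrightarrow> x = 0"
  shows "(\<lambda>q. \<nu> (rat_c00 q)) \<in> I"
proof -
  note \<mu> = restrict_pseudonorm[OF \<nu>(1)]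
  obtain J where J: "banach_space (X_space (\<lambda>q. \<nu> (rat_c00 q)))" "lin_c00 (X_space (\<lambda>q. \<nu> (rat_c00 q))) J"
    "\<And>x. nrm (X_space (\<lambda>q. \<nu> (rat_c00 q))) (J x) = \<nu> x"
    using X_space_properties[OF \<mu>(1)] unfolding \<mu>(2) by blast
  interpret X: normed_space "X_space (\<lambda>q. \<nu> (rat_c00 q))" using J(1) by (simp add: banach_space_def)
  have "\<not> finite_dimensional (X_space (\<lambda>q. \<nu> (rat_c00 q)))"
  proof (rule not_finite_dimensional[OF X.pseudonormed_space_axioms J(2), where k = 0])
    fix x assume "J x = \<zero>\<^bsub>X_space (\<lambda>q. \<nu> (rat_c00 q))\<^esub>"
    then show "x = 0" using J(3)[of x] \<nu>(2) by simp
  qed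
  then show ?thesis
    using I \<mu> \<nu>(2) by (auto simp: B_norms_def P_inf_def)
qed

lemma ell2_class_eq:
  assumes I: "I = B_norms \<or> I = P_inf"
  shows "iso_class I ell2 = {\<mu> \<in> I. \<exists>C. hilbert_const C (extension \<mu>)}"
  using isomorphic_ell2_iff[OF I_props[OF I]] by (auto simp: iso_class_def)

text \<open>A filter refining the approach to a limit point makes the extensions converge on all of
  \<open>c00\<close>, and \<open>hilbert_const_Lim\<close> passes the constant on.\<close>

lemma closedin_hilbert_const:
  assumes I: "I \<subseteq> pseudonorms"
  shows "closedin (top_of_set I) {\<mu> \<in> I. hilbert_const C (extension \<mu>)}"
  unfolding closedin_limpt
proof (intro conjI allI impI)
  let ?H = "{\<mu> \<in> I. hilbert_const C (extension \<mu>)}"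
  fix \<mu> assume \<mu>: "\<mu> islimpt ?H \<and> \<mu> \<in> I"
  then have "at \<mu> within ?H \<noteq> bot" by (simp add: trivial_limit_within)
  then obtain U where U: "U \<le> at \<mu> within ?H" "limit_filter U" by (rule ex_limit_filter)
  have ev: "\<forall>\<^sub>F i in U. i \<in> ?H"
    using U(1) unfolding le_filter_def eventually_at_filter by (metis (mono_tags, lifting) always_eventually)
  then obtain h where h: "h \<in> ?H"
    using eventually_happens limit_filter_nonbot[OF U(2)] by blast
  \<comment> \<open>The limit lemmas ask for their hypotheses at every index, so points outside
    \<open>?H\<close> are replaced by a fixed member of it; along \<open>U\<close> nothing
    changes.\<close>
  define m where "m i = (if i \<in> ?H then i else h)" for i
  have mH: "m i \<in> ?H" for i using h by (simp add: m_def)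
  have mp: "m i \<in> pseudonorms" and mh: "hilbert_const C (extension (m i))" for i
    using mH[of i] I by auto
  have lim: "((\<lambda>i. m i q) \<longlongrightarrow> \<mu> q) U" for q
  proof (rule Lim_transform_eventually)
    have "((\<lambda>i. i) \<longlongrightarrow> \<mu>) U" by (rule tendsto_mono[OF U(1) tendsto_ident_at])
    then show "((\<lambda>i. i q) \<longlongrightarrow> \<mu> q) U"
      by (rule continuous_on_tendsto_compose[OF continuous_on_product_coordinates[of q]]) auto
    show "\<forall>\<^sub>F i in U. i q = m i q" using ev by eventually_elim (simp add: m_def)
  qed
  have "\<mu> \<in> pseudonorms" using \<mu> I by blast
  from extension_tendsto[OF U(2) mp this lim]
  have "hilbert_const C (extension \<mu>)"
    by (rule hilbert_const_Lim[OF U(2) mh])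
  then show "\<mu> \<in> ?H" using \<mu> by simp
qed auto

theorem fsigma_ell2_class:
  assumes I: "I = B_norms \<or> I = P_inf"
  shows "fsigma_in (top_of_set I) (iso_class I ell2)"
proof -
  let ?H = "\<lambda>n. {\<mu> \<in> I. hilbert_const (real n) (extension \<mu>)}"
  have "\<exists>n. hilbert_const (real n) \<nu>" if "hilbert_const C \<nu>" for C \<nu>
    using hilbert_const_mono[OF that] real_arch_simple by blast
  then have "iso_class I ell2 = \<Union> (range ?H)"
    unfolding ell2_class_eq[OF I] by blast
  moreover have "I \<subseteq> pseudonorms" using I_props(1)[OF I] by blast
  then have "fsigma_in (top_of_set I) (\<Union> (range ?H))"
    by (intro fsigma_in_Union) (auto intro!: closed_imp_fsigma_in closedin_hilbert_const)
  ultimately show ?thesis by simp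
qed

text \<open>In the product topology, lying outside a closed set is secured by finitely many values
  up to an error. Hence a finite-dimensional part of a norm can force it out of
  \<open>F\<close>.\<close>

lemma closedin_avoid:
  fixes F :: "('a \<Rightarrow> real) set"
  assumes F: "closedin (top_of_set I) F" and \<mu>: "\<mu> \<in> I" "\<mu> \<notin> F"
  obtains S e where "finite S" "0 < e" "\<And>\<mu>'. \<mu>' \<in> I \<Longrightarrow> (\<And>q. q \<in> S \<Longrightarrow> \<bar>\<mu>' q - \<mu> q\<bar> < e) \<Longrightarrow> \<mu>' \<notin> F"
proof -
  obtain G where G: "closed G" "F = I \<inter> G" using F by (auto simp: closedin_closed)
  have "open (- G)" using G(1) by auto
  then have op: "openin (product_topology (\<lambda>_. euclidean) UNIV) (- G)"
    by (simp add: euclidean_product_topology)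
  have "\<mu> \<in> - G" using G \<mu> by blast
  from product_topology_open_contains_basis[OF op this]
  obtain X where X': "\<mu> \<in> PiE UNIV X \<and> (\<forall>i. openin euclidean (X i)) \<and>
      finite {i. X i \<noteq> topspace euclidean} \<and> PiE UNIV X \<subseteq> - G"
    by (elim exE)
  then have X: "\<mu> \<in> PiE UNIV X" "\<And>i. open (X i)" "finite {i. X i \<noteq> UNIV}" "PiE UNIV X \<subseteq> - G"
    unfolding open_openin[symmetric] topspace_euclidean by blast+
  let ?S = "{i. X i \<noteq> UNIV}"
  have "\<exists>e>0. \<forall>y. \<bar>y - \<mu> i\<bar> < e \<longrightarrow> y \<in> X i" for i
  proof -
    have "\<mu> i \<in> X i" using X(1) by (simp add: PiE_def Pi_def)
    then show ?thesis using X(2)[of i] unfolding open_dist dist_real_def by blast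
  qed
  then obtain e where e: "\<And>i. 0 < e i" "\<And>i y. \<bar>y - \<mu> i\<bar> < e i \<Longrightarrow> y \<in> X i" by metis
  let ?e = "Min (insert 1 (e ` ?S))"
  show ?thesis
  proof (rule that[OF X(3)])
    show "0 < ?e" using X(3) e(1) by simp
    fix \<mu>' assume *: "\<And>q. q \<in> ?S \<Longrightarrow> \<bar>\<mu>' q - \<mu> q\<bar> < ?e"
    have "\<mu>' q \<in> X q" for q
    proof (cases "q \<in> ?S")
      case True
      then have "?e \<le> e q" using X(3) by (intro Min_le) auto
      then show ?thesis using *[OF True] e(2)[of "\<mu>' q" q] by simp
    qed simp
    then have "\<mu>' \<in> PiE UNIV X" by (simp add: PiE_def)
    then show "\<mu>' \<notin> F" using X(4) G(2) by blast
  qed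
qed

section \<open>Only the Hilbert space has an \<open>F\<^sub>\<sigma>\<close> class\<close>

lemma hilbert_const_equiv:
  assumes h: "hilbert_const C \<nu>" and D: "0 < D" "\<And>x. \<nu> x \<le> D * \<nu>' x" "\<And>x. \<nu>' x \<le> D * \<nu> x"
    and nn: "\<And>x. 0 \<le> \<nu> x" "\<And>x. 0 \<le> \<nu>' x"
  shows "\<exists>C. hilbert_const C \<nu>'"
proof -
  obtain b where b: "semi_inner b" "\<And>x. b x x \<le> (\<nu> x)\<^sup>2" "\<And>x. (\<nu> x)\<^sup>2 \<le> C * b x x"
    using h by (auto simp: hilbert_const_def)
  have bn: "0 \<le> b x x" for x by (rule semi_innerD(4)[OF b(1)])
  define E where "E = D\<^sup>2 * (\<bar>C\<bar> + 1)"
  have E: "0 < E" using D(1) by (simp add: E_def add_nonneg_pos)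
  have "b x x \<le> E * (\<nu>' x)\<^sup>2" for x
  proof -
    have "b x x \<le> D\<^sup>2 * (\<nu>' x)\<^sup>2"
      using b(2)[of x] power_mono[OF D(2)[of x] nn(1), of 2] by (simp add: power_mult_distrib)
    also have "\<dots> \<le> E * (\<nu>' x)\<^sup>2" unfolding E_def by (intro mult_right_mono) (auto simp: mult_le_cancel_left1)
    finally show ?thesis .
  qed
  moreover have "(\<nu>' x)\<^sup>2 \<le> E * b x x" for x
  proof -
    have "(\<nu>' x)\<^sup>2 \<le> D\<^sup>2 * (\<nu> x)\<^sup>2"
      using power_mono[OF D(3)[of x] nn(2), of 2] by (simp add: power_mult_distrib)
    also have "(\<nu> x)\<^sup>2 \<le> (\<bar>C\<bar> + 1) * b x x"
      using b(3)[of x] by (rule order_trans) (intro mult_right_mono bn, auto)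
    finally show ?thesis by (simp add: E_def mult.assoc mult_left_mono)
  qed
  ultimately show ?thesis using hilbert_constI[OF b(1) E] by blast
qed

text \<open>Linear independence of the first \<open>k\<close> vectors modulo the null space of
  \<open>p\<close>; repetitions are excluded as well.\<close>

definition indep_upto :: "('v::real_vector \<Rightarrow> real) \<Rightarrow> (nat \<Rightarrow> 'v) \<Rightarrow> nat \<Rightarrow> bool" where
  "indep_upto p v k \<longleftrightarrow> (\<forall>x. Poly_Mapping.keys x \<subseteq> {..<k} \<longrightarrow> p (comb v x) = 0 \<longrightarrow> x = 0)"

lemma indep_upto_cong:
  assumes "\<And>i. i < k \<Longrightarrow> v i = w i"
  shows "indep_upto p v k \<longleftrightarrow> indep_upto p w k"
proof -
  have "comb v x = comb w x" if "Poly_Mapping.keys x \<subseteq> {..<k}" for x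
    using that assms by (intro comb_cong) auto
  then show ?thesis unfolding indep_upto_def by metis
qed

context seminorm
begin

lemma indep_upto_extend:
  assumes v: "indep_upto p v M" and a: "\<And>u. Poly_Mapping.keys u \<subseteq> {..<M} \<Longrightarrow> p (a - comb v u) \<noteq> 0"
  shows "indep_upto p (v(M := a)) (Suc M)"
  unfolding indep_upto_def
proof (intro allI impI)
  fix x :: c00 assume x: "Poly_Mapping.keys x \<subseteq> {..<Suc M}" "p (comb (v(M := a)) x) = 0"
  let ?c = "Poly_Mapping.lookup x M"
  define x' where "x' = x - ?c *\<^sub>R Poly_Mapping.single M 1"
  have lx': "Poly_Mapping.lookup x' i = (if i = M then 0 else Poly_Mapping.lookup x i)" for i
    by (simp add: x'_def lookup_minus lookup_single when_def)
  have kx': "Poly_Mapping.keys x' \<subseteq> {..<M}"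
  proof
    fix i assume "i \<in> Poly_Mapping.keys x'"
    then have "i \<noteq> M" "i \<in> Poly_Mapping.keys x" by (auto simp: in_keys_iff lx' split: if_splits)
    then show "i \<in> {..<M}" using x(1) by force
  qed
  have "comb (v(M := a)) x = comb (v(M := a)) (x' + ?c *\<^sub>R Poly_Mapping.single M 1)"
    by (simp add: x'_def)
  also have "\<dots> = comb (v(M := a)) x' + ?c *\<^sub>R a"
    by (simp add: linear_add[OF linear_comb] linear_scale[OF linear_comb])
  also have "comb (v(M := a)) x' = comb v x'"
    using kx' by (intro comb_cong) auto
  finally have "comb (v(M := a)) x = comb v x' + ?c *\<^sub>R a" .
  then have eq: "p (comb v x' + ?c *\<^sub>R a) = 0" using x(2) by (simp only:)
  have "?c = 0"
  proof (rule ccontr)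
    assume c: "?c \<noteq> 0"
    let ?u = "- (inverse ?c *\<^sub>R x')"
    have "Poly_Mapping.keys ?u \<subseteq> {..<M}" using kx' keys_scaleR[of "inverse ?c" x'] by auto
    then have "p (a - comb v ?u) \<noteq> 0" by (rule a)
    moreover have "?c *\<^sub>R (a - comb v ?u) = comb v x' + ?c *\<^sub>R a"
      using c by (simp add: linear_neg[OF linear_comb] linear_scale[OF linear_comb] scaleR_add_right)
    then have "\<bar>?c\<bar> * p (a - comb v ?u) = 0" using eq scale[of ?c "a - comb v ?u"] by simp
    ultimately show False using c by simp
  qed
  then have "p (comb v x') = 0" using eq by simp
  then have "x' = 0" using v kx' by (auto simp: indep_upto_def)
  then show "x = 0" using \<open>?c = 0\<close> by (simp add: x'_def)
qed

lemma comb_in_span: "Poly_Mapping.keys u \<subseteq> {..<M} \<Longrightarrow> comb v u \<in> span (v ` {..<M})"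
  unfolding comb_def by (intro span_sum span_scale span_base) auto

text \<open>Vectors that approximate an independent system may themselves be dependent. One that
  falls into the span of its predecessors is moved by a small multiple of a vector at positive
  distance from that span; infinite dimension provides such a vector.\<close>

lemma indep_upto_perturb:
  assumes inf: "inf_dim p" and v: "indep_upto p v k" and w: "\<And>i. i < k \<Longrightarrow> w i = v i"
    and d: "0 < d" and M: "k \<le> M"
  shows "\<exists>w'. (\<forall>i<k. w' i = v i) \<and> indep_upto p w' M \<and> (\<forall>i<M. p (w' i - w i) < d)"
  using M
proof (induction M rule: dec_induct)
  case base
  have "indep_upto p w k" using v indep_upto_cong[of k w v p] w by simp
  then show ?case using w d by (intro exI[of _ w]) auto
next
  case (step M)
  then obtain w' where w': "\<forall>i<k. w' i = v i" "indep_upto p w' M" "\<forall>i<M. p (w' i - w i) < d" by blast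
  have "\<exists>a. p (a - w M) < d \<and> (\<forall>u. Poly_Mapping.keys u \<subseteq> {..<M} \<longrightarrow> p (a - comb w' u) \<noteq> 0)"
  proof (cases "\<exists>u. Poly_Mapping.keys u \<subseteq> {..<M} \<and> p (w M - comb w' u) = 0")
    case False
    then show ?thesis using d by (intro exI[of _ "w M"]) auto
  next
    case True
    then obtain u0 where u0: "Poly_Mapping.keys u0 \<subseteq> {..<M}" "p (w M - comb w' u0) = 0" by blast
    have "finite (w' ` {..<M})" by simp
    then obtain z where "\<exists>e. 0 < e \<and> (\<forall>u\<in>span (w' ` {..<M}). e \<le> p (z - u))"
      using inf unfolding inf_dim_def by blast
    then obtain e where e: "0 < e" "\<forall>u\<in>span (w' ` {..<M}). e \<le> p (z - u)" by blast
    define t where "t = d / (p z + 1)"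
    have pz: "0 < p z + 1" using nonneg[of z] by linarith
    have t: "0 < t" using d pz by (simp add: t_def)
    have "t * p z < d" using d pz by (simp add: t_def field_simps)
    then have "p ((w M + t *\<^sub>R z) - w M) < d" using t by (simp add: scale)
    moreover have "p ((w M + t *\<^sub>R z) - comb w' u) \<noteq> 0" if u: "Poly_Mapping.keys u \<subseteq> {..<M}" for u
    proof
      assume 0: "p ((w M + t *\<^sub>R z) - comb w' u) = 0"
      let ?s = "inverse t *\<^sub>R (comb w' u - comb w' u0)"
      have "?s \<in> span (w' ` {..<M})"
        using u u0(1) by (intro span_scale span_diff comb_in_span)
      then have "e \<le> p (z - ?s)" using e(2) by blast
      also have "p (z - ?s) = inverse t * p (t *\<^sub>R (z - ?s))" using t by (simp add: scale)
      also have "t *\<^sub>R (z - ?s) = ((w M + t *\<^sub>R z) - comb w' u) - (w M - comb w' u0)"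
        using t by (simp add: scaleR_diff_right)
      also have "p (((w M + t *\<^sub>R z) - comb w' u) - (w M - comb w' u0)) \<le> 0"
        using triangle[of "(w M + t *\<^sub>R z) - comb w' u" "- (w M - comb w' u0)"] 0 u0(2) minus[of "w M - comb w' u0"]
        by simp
      then have "inverse t * p (((w M + t *\<^sub>R z) - comb w' u) - (w M - comb w' u0)) \<le> 0"
        using t by (intro mult_nonneg_nonpos) auto
      finally show False using e(1) by simp
    qed
    ultimately show ?thesis by blast
  qed
  then obtain a where a: "p (a - w M) < d" "\<And>u. Poly_Mapping.keys u \<subseteq> {..<M} \<Longrightarrow> p (a - comb w' u) \<noteq> 0"
    by blast
  have "indep_upto p (w'(M := a)) (Suc M)" by (rule indep_upto_extend[OF w'(2) a(2)])
  moreover have "\<forall>i<k. (w'(M := a)) i = v i" using w'(1) step(1) by auto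
  moreover have "\<forall>i<Suc M. p ((w'(M := a)) i - w i) < d" using w'(3) a(1) by (auto simp: less_Suc_eq)
  ultimately show ?case by blast
qed

text \<open>The kernel of the extended pseudonorm has dimension at most \<open>k\<close>, so it disappears after
  dropping finitely many of the new unit vectors.\<close>

lemma euclidean_norm_extension:
  assumes inf: "inf_dim p" and v: "indep_upto p v k"
  obtains N C where "seminorm N" "\<And>x. N x = 0 \<Longrightarrow> x = 0" "0 < C"
    "\<And>x. Poly_Mapping.keys x \<subseteq> {k..} \<Longrightarrow> l2 x \<le> C * N x \<and> N x \<le> C * l2 x"
    "\<And>S e. finite S \<Longrightarrow> 0 < e \<Longrightarrow> \<exists>w. (\<forall>i<k. w i = v i) \<and> (\<forall>x\<in>S. \<bar>N x - p (comb w x)\<bar> < e)"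
proof -
  obtain N C where N: "seminorm N" "0 < C"
    and tail: "\<And>x. Poly_Mapping.keys x \<subseteq> {k..} \<Longrightarrow> l2 x \<le> C * N x \<and> N x \<le> C * l2 x"
    and approx: "\<And>S e. finite S \<Longrightarrow> 0 < e \<Longrightarrow> \<exists>w. (\<forall>i<k. w i = v i) \<and> (\<forall>x\<in>S. \<bar>N x - p (comb w x)\<bar> < e)"
    by (rule euclidean_extension[OF inf, of k v], rule that)
  interpret N: seminorm N by fact
  \<comment> \<open>On heads the approximation is exact, since the first \<open>k\<close> entries of
    every \<open>w\<close> are those of \<open>v\<close>.\<close>
  have head: "N x = p (comb v x)" if x: "Poly_Mapping.keys x \<subseteq> {..<k}" for x
  proof -
    have "\<bar>N x - p (comb v x)\<bar> \<le> 0"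
    proof (rule field_le_epsilon)
      fix e :: real assume "0 < e"
      then obtain w where w: "\<forall>i<k. w i = v i" "\<bar>N x - p (comb w x)\<bar> < e" using approx[of "{x}" e] by auto
      have "comb w x = comb v x" using w(1) x by (intro comb_cong) auto
      then show "\<bar>N x - p (comb v x)\<bar> \<le> 0 + e" using w(2) by simp
    qed
    then show ?thesis by simp
  qed
  define K where "K = {x. N x = 0}"
  have subK: "subspace K" unfolding K_def by (rule N.subspace_null)
  obtain B where B: "B \<subseteq> K" "independent B" "K \<subseteq> span B"
    using maximal_independent_subset[of K] by blast
  have spanB: "span B \<subseteq> K" using B(1) subK by (rule span_minimal)
  define \<pi> where "\<pi> = comb (\<lambda>i. if i < k then Poly_Mapping.single i (1::real) else 0)"
  have lookup_comb: "Poly_Mapping.lookup (comb f x) j = (\<Sum>i\<in>Poly_Mapping.keys x. Poly_Mapping.lookup x i * Poly_Mapping.lookup (f i) j)"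
    for f :: "nat \<Rightarrow> c00" and x j
    by (simp add: comb_def lookup_sum)
  have lookup\<pi>: "Poly_Mapping.lookup (\<pi> x) j = (if j < k then Poly_Mapping.lookup x j else 0)" for x j
  proof -
    have "Poly_Mapping.lookup (\<pi> x) j = (\<Sum>i\<in>Poly_Mapping.keys x. if i = j then (if j < k then Poly_Mapping.lookup x j else 0) else 0)"
      unfolding \<pi>_def lookup_comb by (rule sum.cong) (auto simp: lookup_single when_def)
    then show ?thesis by (simp add: in_keys_iff)
  qed
  have lin\<pi>: "linear \<pi>" unfolding \<pi>_def by (rule linear_comb)
  \<comment> \<open>A kernel vector without head is a tail, and on tails \<open>C * N\<close>
    dominates \<open>l2\<close>. So the kernel embeds into the first \<open>k\<close>
    coordinates.\<close>
  have injK: "x = 0" if "x \<in> K" "\<pi> x = 0" for x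
  proof -
    have "Poly_Mapping.lookup x j = 0" if "j < k" for j
      using lookup\<pi>[of x j] \<open>\<pi> x = 0\<close> that by simp
    then have "Poly_Mapping.keys x \<subseteq> {k..}" by (auto simp: in_keys_iff not_less[symmetric])
    then have "l2 x \<le> 0" using tail[of x] \<open>x \<in> K\<close> by (simp add: K_def)
    then show ?thesis using l2_nonneg[of x] by (metis antisym l2_eq_0_iff)
  qed
  have inj: "inj_on \<pi> (span B)"
  proof (rule inj_onI)
    fix x y assume xy: "x \<in> span B" "y \<in> span B" "\<pi> x = \<pi> y"
    have "x - y \<in> K" using xy spanB subspace_diff[OF subK] by blast
    moreover have "\<pi> (x - y) = 0" using xy(3) by (simp add: linear_diff[OF lin\<pi>])
    ultimately show "x = y" using injK by fastforce
  qed
  have "finite B"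
  proof -
    have "independent (\<pi> ` B)" by (rule linear_independent_injective_image[OF lin\<pi> B(2) inj])
    moreover have "\<pi> ` B \<subseteq> span ((\<lambda>i. Poly_Mapping.single i (1::real)) ` {..<k})"
    proof
      fix y assume "y \<in> \<pi> ` B"
      then obtain x where y: "y = \<pi> x" by blast
      show "y \<in> span ((\<lambda>i. Poly_Mapping.single i (1::real)) ` {..<k})"
        unfolding y \<pi>_def comb_def
      proof (intro span_sum span_scale)
        fix i
        show "(if i < k then Poly_Mapping.single i (1::real) else 0) \<in> span ((\<lambda>i. Poly_Mapping.single i (1::real)) ` {..<k})"
          by (auto simp: span_zero intro: span_base)
      qed
    qed
    ultimately have "finite (\<pi> ` B)"
      using independent_span_bound[of "(\<lambda>i. Poly_Mapping.single i (1::real)) ` {..<k}" "\<pi> ` B"] by simp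
    then show ?thesis using inj_on_subset[OF inj span_superset] by (rule finite_imageD)
  qed
  then have "finite (\<Union>x\<in>B. Poly_Mapping.keys x)" by simp
  from finite_nat_bounded[OF this] obtain m0 where m0: "(\<Union>x\<in>B. Poly_Mapping.keys x) \<subseteq> {..<m0}" by (elim exE)
  have subm: "subspace {x :: c00. Poly_Mapping.keys x \<subseteq> {..<m0}}"
    by (rule subspaceI) (use Poly_Mapping.keys_add keys_scaleR in \<open>fastforce+\<close>)
  have "span B \<subseteq> {x. Poly_Mapping.keys x \<subseteq> {..<m0}}"
    using m0 by (intro span_minimal subm) auto
  then have Kkeys: "Poly_Mapping.keys x \<subseteq> {..<m0}" if "x \<in> K" for x using B(3) that by blast
  \<comment> \<open>All kernel vectors are supported below \<open>m0\<close>. Shifting the tail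
    coordinates by \<open>m0\<close> preserves heads and Euclidean norms of tails, and moves every
    nonzero tail coordinate out of reach of the kernel.\<close>
  define \<sigma> where "\<sigma> = comb (\<lambda>i. if i < k then Poly_Mapping.single i (1::real) else Poly_Mapping.single (i + m0) 1)"
  have lin\<sigma>: "linear \<sigma>" unfolding \<sigma>_def by (rule linear_comb)
  have lookup\<sigma>: "Poly_Mapping.lookup (\<sigma> x) (i + m0) = Poly_Mapping.lookup x i" if "k \<le> i" for x i
  proof -
    have "Poly_Mapping.lookup (\<sigma> x) (i + m0) = (\<Sum>l\<in>Poly_Mapping.keys x. if l = i then Poly_Mapping.lookup x i else 0)"
      unfolding \<sigma>_def lookup_comb using that by (intro sum.cong) (auto simp: lookup_single when_def)
    then show ?thesis by (simp add: in_keys_iff)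
  qed
  have \<sigma>head: "\<sigma> x = x" if "Poly_Mapping.keys x \<subseteq> {..<k}" for x
  proof -
    have "\<sigma> x = comb (\<lambda>i. Poly_Mapping.single i 1) x"
      unfolding \<sigma>_def using that by (intro comb_cong) auto
    then show ?thesis by (simp add: comb_units)
  qed
  have \<sigma>tail: "Poly_Mapping.keys (\<sigma> x) \<subseteq> (\<lambda>i. i + m0) ` Poly_Mapping.keys x" if x: "Poly_Mapping.keys x \<subseteq> {k..}" for x
  proof
    fix j assume j: "j \<in> Poly_Mapping.keys (\<sigma> x)"
    show "j \<in> (\<lambda>i. i + m0) ` Poly_Mapping.keys x"
    proof (rule ccontr)
      assume nj: "j \<notin> (\<lambda>i. i + m0) ` Poly_Mapping.keys x"
      have "Poly_Mapping.lookup (\<sigma> x) j = 0"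
        unfolding \<sigma>_def lookup_comb
      proof (rule sum.neutral, rule ballI)
        fix i assume i: "i \<in> Poly_Mapping.keys x"
        then have "i + m0 \<noteq> j" "\<not> i < k" using nj x by auto
        then show "Poly_Mapping.lookup x i * Poly_Mapping.lookup
            (if i < k then Poly_Mapping.single i (1::real) else Poly_Mapping.single (i + m0) 1) j = 0"
          by (simp add: lookup_single)
      qed
      then show False using j by (simp add: in_keys_iff)
    qed
  qed
  have l2\<sigma>: "l2 (\<sigma> x) = l2 x" if x: "Poly_Mapping.keys x \<subseteq> {k..}" for x
  proof -
    have "l2 (\<sigma> x) = L2_set (Poly_Mapping.lookup (\<sigma> x)) ((\<lambda>i. i + m0) ` Poly_Mapping.keys x)"
      by (rule l2_superset[OF _ \<sigma>tail[OF x]]) simp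
    also have "\<dots> = L2_set (\<lambda>i. Poly_Mapping.lookup (\<sigma> x) (i + m0)) (Poly_Mapping.keys x)"
      unfolding L2_set_def by (subst sum.reindex) (auto simp: inj_on_def)
    also have "\<dots> = l2 x"
      unfolding l2_def by (rule L2_set_cong[OF refl]) (use x lookup\<sigma> in auto)
    finally show ?thesis .
  qed
  show ?thesis
  proof (rule that[of "\<lambda>x. N (\<sigma> x)" C])
    show "seminorm (\<lambda>x. N (\<sigma> x))" by (rule seminorm_compose[OF N(1) lin\<sigma>])
    show "0 < C" by fact
    show "l2 x \<le> C * N (\<sigma> x) \<and> N (\<sigma> x) \<le> C * l2 x" if x: "Poly_Mapping.keys x \<subseteq> {k..}" for x
    proof -
      have "Poly_Mapping.keys (\<sigma> x) \<subseteq> {k..}" using \<sigma>tail[OF x] x by fastforce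
      from tail[OF this] show ?thesis by (simp add: l2\<sigma>[OF x])
    qed
    show "x = 0" if "N (\<sigma> x) = 0" for x
    proof -
      have keys: "Poly_Mapping.keys (\<sigma> x) \<subseteq> {..<m0}" using that by (intro Kkeys) (simp add: K_def)
      have "Poly_Mapping.lookup x i = 0" if "k \<le> i" for i
      proof -
        have "i + m0 \<notin> Poly_Mapping.keys (\<sigma> x)" using keys by auto
        then show ?thesis using lookup\<sigma>[OF that, of x] by (simp add: in_keys_iff)
      qed
      then have x: "Poly_Mapping.keys x \<subseteq> {..<k}"
        by (metis in_keys_iff lessThan_iff not_le subsetI)
      then have "p (comb v x) = 0" using head[OF x] that \<sigma>head[OF x] by simp
      then show ?thesis using v x by (auto simp: indep_upto_def)
    qed
    fix S :: "c00 set" and e :: real assume S: "finite S" "0 < e"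
    obtain w where w: "\<forall>i<k. w i = v i" "\<forall>x\<in>\<sigma> ` S. \<bar>N x - p (comb w x)\<bar> < e"
      using approx[of "\<sigma> ` S" e] S by auto
    let ?w = "\<lambda>i. comb w (if i < k then Poly_Mapping.single i (1::real) else Poly_Mapping.single (i + m0) 1)"
    have "comb w (\<sigma> x) = comb ?w x" for x unfolding \<sigma>_def by (rule comb_comb)
    then show "\<exists>w. (\<forall>i<k. w i = v i) \<and> (\<forall>x\<in>S. \<bar>N (\<sigma> x) - p (comb w x)\<bar> < e)"
      using w by (intro exI[of _ ?w]) auto
  qed
qed

end

text \<open>The extended norm \<open>N\<close> is Hilbertian by
  \<open>hilbert_const_of_tail\<close>, so membership in \<open>F\<close> would make
  \<open>X\<close> isomorphic to \<open>ell2\<close>. Finitely many values of \<open>N\<close> thus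
  suffice to leave \<open>F\<close>, and vectors prolonging \<open>v\<close> realise them
  approximately under \<open>p\<close>. The avoidance is stated for all \<open>\<mu>\<close> with
  prescribed values on vectors supported below \<open>k'\<close>, so later steps cannot spoil it.
  Reaching the unit vector \<open>n\<close> serves the density of the final presentation.\<close>

lemma fusion_step:
  assumes I: "I = B_norms \<or> I = P_inf" and X: "banach_space X" and nfd: "\<not> finite_dimensional X"
    and T: "lin_c00 X T" "dense_c00 X T" and niso: "\<not> X \<simeq>\<^sub>l ell2"
    and p: "p = (\<lambda>x. nrm X (T x))"
    and F: "closedin (top_of_set I) F" "F \<subseteq> iso_class I X" and v: "indep_upto p v k"
  obtains v' k' where "k < k'" "\<And>i. i < k \<Longrightarrow> v' i = v i" "indep_upto p v' k'"
    "\<exists>u. Poly_Mapping.keys u \<subseteq> {..<k'} \<and> p (Poly_Mapping.single n 1 - comb v' u) = 0"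
    "\<forall>\<mu>\<in>I. (\<forall>q. Poly_Mapping.keys q \<subseteq> {..<k'} \<longrightarrow> \<mu> q = p (comb v' (rat_c00 q))) \<longrightarrow> \<mu> \<notin> F"
proof -
  have nX: "normed_space X" using X by (simp add: banach_space_def)
  interpret X: normed_space X by fact
  interpret seminorm p unfolding p by (rule X.seminorm_lin_c00[OF T(1)])
  have inf: "inf_dim p" unfolding p by (rule inf_dim_of_not_finite_dimensional[OF nX T nfd])
  obtain N C where N: "seminorm N" "\<And>x. N x = 0 \<Longrightarrow> x = 0" "0 < C"
    "\<And>x. Poly_Mapping.keys x \<subseteq> {k..} \<Longrightarrow> l2 x \<le> C * N x \<and> N x \<le> C * l2 x"
    and approx: "\<And>S e. finite S \<Longrightarrow> 0 < e \<Longrightarrow> \<exists>w. (\<forall>i<k. w i = v i) \<and> (\<forall>x\<in>S. \<bar>N x - p (comb w x)\<bar> < e)"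
    by (rule euclidean_norm_extension[OF inf v], rule that)
  define \<mu>0 where "\<mu>0 = (\<lambda>q. N (rat_c00 q))"
  have \<mu>0: "\<mu>0 \<in> I" "\<mu>0 \<in> pseudonorms" "extension \<mu>0 = N"
    unfolding \<mu>0_def using norm_in_I[OF I N(1,2)] restrict_pseudonorm[OF N(1)] by simp_all
  have "\<mu>0 \<notin> F"
  proof
    assume "\<mu>0 \<in> F"
    then have iso: "X_space \<mu>0 \<simeq>\<^sub>l X" using F(2) by (auto simp: iso_class_def)
    obtain J where J: "banach_space (X_space \<mu>0)" "lin_c00 (X_space \<mu>0) J" "dense_c00 (X_space \<mu>0) J"
      "\<And>x. nrm (X_space \<mu>0) (J x) = N x"
      using X_space_properties[OF \<mu>0(2)] unfolding \<mu>0(3) by blast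
    have nZ: "normed_space (X_space \<mu>0)" using J(1) by (simp add: banach_space_def)
    obtain S D where S: "lin_c00 X S" "dense_c00 X S" "0 < D"
      "\<And>c. nrm X (S c) \<le> D * nrm (X_space \<mu>0) (J c)" "\<And>c. nrm (X_space \<mu>0) (J c) \<le> D * nrm X (S c)"
      by (rule isomorphic_dense[OF nZ nX iso J(2,3)], rule that)
    obtain E where E: "hilbert_const E N" using hilbert_const_of_tail[OF N(1,3,4)] by blast
    have "\<exists>C. hilbert_const C (\<lambda>x. nrm X (S x))"
      by (rule hilbert_const_equiv[OF E S(3)])
        (use S(4,5) J(4) seminorm.nonneg[OF N(1)] X.nrm_nonneg[OF X.lin_c00D(1)[OF S(1)]] in auto)
    then show False using isomorphic_ell2_of_hilbert[OF X S(1,2) nfd] niso by blast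
  qed
  from closedin_avoid[OF F(1) \<mu>0(1) this]
  obtain S e where S: "finite S" "0 < e"
    "\<And>\<mu>'. \<mu>' \<in> I \<Longrightarrow> (\<And>q. q \<in> S \<Longrightarrow> \<bar>\<mu>' q - \<mu>0 q\<bar> < e) \<Longrightarrow> \<mu>' \<notin> F" by metis
  have "finite (\<Union>q\<in>S. Poly_Mapping.keys q)" using S(1) by simp
  from finite_nat_bounded[OF this] obtain M0 where M0: "(\<Union>q\<in>S. Poly_Mapping.keys q) \<subseteq> {..<M0}" by (elim exE)
  \<comment> \<open>The value is at least \<open>Suc k\<close> so that every step fixes more
    vectors, even when \<open>S\<close> tests none of the new ones.\<close>
  define M where "M = max M0 (Suc k)"
  have kM: "k < M" by (simp add: M_def)
  have M: "Poly_Mapping.keys q \<subseteq> {..<M}" if "q \<in> S" for q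
    using M0 that by (force simp: M_def)
  obtain w where w: "\<forall>i<k. w i = v i" "\<forall>x\<in>rat_c00 ` S. \<bar>N x - p (comb w x)\<bar> < e / 2"
    using approx[of "rat_c00 ` S" "e / 2"] S(1,2) by auto
  \<comment> \<open>\<open>s\<close> bounds the l_1 norms of the vectors tested by \<open>S\<close>,
    so moving each \<open>w i\<close> by less than \<open>e / (2 * s)\<close> changes the tested
    values by at most \<open>e / 2\<close>.\<close>
  define s where "s = (\<Sum>q\<in>S. wsum (\<lambda>_. 1) (rat_c00 q)) + 1"
  have ws: "0 \<le> wsum (\<lambda>_. 1) x" for x by (rule seminorm.nonneg[OF seminorm_wsum]) simp
  have s: "0 < s" "\<And>q. q \<in> S \<Longrightarrow> wsum (\<lambda>_. 1) (rat_c00 q) \<le> s"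
  proof -
    have "0 \<le> (\<Sum>q\<in>S. wsum (\<lambda>_. 1) (rat_c00 q))" by (rule sum_nonneg) (rule ws)
    then show "0 < s" by (simp add: s_def)
    fix q assume "q \<in> S"
    then have "wsum (\<lambda>_. 1) (rat_c00 q) \<le> (\<Sum>q\<in>S. wsum (\<lambda>_. 1) (rat_c00 q))"
      by (intro member_le_sum[OF _ ws S(1)])
    then show "wsum (\<lambda>_. 1) (rat_c00 q) \<le> s" by (simp add: s_def)
  qed
  define d where "d = e / (2 * s)"
  have d: "0 < d" using S(2) s(1) by (simp add: d_def)
  obtain w' where w': "\<forall>i<k. w' i = v i" "indep_upto p w' M" "\<forall>i<M. p (w' i - w i) < d"
    using indep_upto_perturb[OF inf v, of w d M] w(1) d kM by auto
  have near: "\<bar>p (comb w' (rat_c00 q)) - \<mu>0 q\<bar> < e" if q: "q \<in> S" for q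
  proof -
    let ?x = "rat_c00 q"
    have "comb w' ?x - comb w ?x = (\<Sum>i\<in>Poly_Mapping.keys ?x. Poly_Mapping.lookup ?x i *\<^sub>R (w' i - w i))"
      by (simp add: comb_def scaleR_diff_right sum_subtractf del: lookup_rat_c00 keys_rat_c00)
    then have "p (comb w' ?x - comb w ?x) \<le> (\<Sum>i\<in>Poly_Mapping.keys ?x. \<bar>Poly_Mapping.lookup ?x i\<bar> * p (w' i - w i))"
      using sum_le[of "Poly_Mapping.lookup ?x" "\<lambda>i. w' i - w i" "Poly_Mapping.keys ?x"] by simp
    also have "\<dots> \<le> (\<Sum>i\<in>Poly_Mapping.keys ?x. \<bar>Poly_Mapping.lookup ?x i\<bar> * d)"
    proof (intro sum_mono mult_left_mono)
      fix i assume "i \<in> Poly_Mapping.keys ?x"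
      then have "i < M" using M[OF q] by auto
      then show "p (w' i - w i) \<le> d" using w'(3) by (simp add: less_imp_le)
    qed simp
    also have "\<dots> = d * wsum (\<lambda>_. 1) ?x" by (simp add: wsum_def sum_distrib_left mult.commute)
    also have "\<dots> \<le> d * s" using s(2)[OF q] d by (intro mult_left_mono) auto
    also have "\<dots> = e / 2" using s(1) by (simp add: d_def)
    finally have "p (comb w' ?x - comb w ?x) \<le> e / 2" .
    then have "\<bar>p (comb w' ?x) - p (comb w ?x)\<bar> \<le> e / 2"
      using abs_diff_le[of "comb w' ?x" "comb w ?x"] by linarith
    moreover have "\<bar>N ?x - p (comb w ?x)\<bar> < e / 2" using w(2) q by blast
    ultimately show ?thesis unfolding \<mu>0_def by linarith
  qed
  have avoid: "\<mu> \<notin> F" if "\<mu> \<in> I" "M \<le> k'" "\<And>i. i < M \<Longrightarrow> v' i = w' i"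
    "\<And>q. Poly_Mapping.keys q \<subseteq> {..<k'} \<Longrightarrow> \<mu> q = p (comb v' (rat_c00 q))" for \<mu> k' v'
  proof (rule S(3)[OF that(1)])
    fix q assume q: "q \<in> S"
    have "comb v' (rat_c00 q) = comb w' (rat_c00 q)"
      using M[OF q] that(3) by (intro comb_cong) auto
    moreover have "Poly_Mapping.keys q \<subseteq> {..<k'}" using M[OF q] that(2) by force
    ultimately show "\<bar>\<mu> q - \<mu>0 q\<bar> < e" using near[OF q] that(4)[of q] by simp
  qed
  show ?thesis
  \<comment> \<open>If the unit vector \<open>n\<close> is already reached modulo the null space,
    adjoining it would destroy independence.\<close>
  proof (cases "\<exists>u. Poly_Mapping.keys u \<subseteq> {..<M} \<and> p (Poly_Mapping.single n 1 - comb w' u) = 0")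
    case True
    have "\<forall>\<mu>\<in>I. (\<forall>q. Poly_Mapping.keys q \<subseteq> {..<M} \<longrightarrow> \<mu> q = p (comb w' (rat_c00 q))) \<longrightarrow> \<mu> \<notin> F"
      using avoid[of _ M w'] by blast
    then show ?thesis
      using w'(1) by (intro that[OF kM _ w'(2) True]) simp_all
  next
    case False
    let ?v = "w'(M := Poly_Mapping.single n 1)"
    have ind: "indep_upto p ?v (Suc M)"
      using False by (intro indep_upto_extend[OF w'(2)]) blast
    have "?v i = v i" if "i < k" for i using that w'(1) kM by simp
    moreover have "\<exists>u. Poly_Mapping.keys u \<subseteq> {..<Suc M} \<and> p (Poly_Mapping.single n 1 - comb ?v u) = 0"
      by (intro exI[of _ "Poly_Mapping.single M 1"]) simp
    moreover have "\<forall>\<mu>\<in>I. (\<forall>q. Poly_Mapping.keys q \<subseteq> {..<Suc M} \<longrightarrow> \<mu> q = p (comb ?v (rat_c00 q))) \<longrightarrow> \<mu> \<notin> F"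
      by (intro ballI impI avoid[where k' = "Suc M" and v' = ?v]) simp_all
    ultimately show ?thesis using kM ind by (intro that[of "Suc M" ?v]) simp_all
  qed
qed

theorem fsigma_class_imp_ell2:
  assumes I: "I = B_norms \<or> I = P_inf" and X: "separable_infinite_dimensional_banach X"
    and fs: "fsigma_in (top_of_set I) (iso_class I X)"
  shows "X \<simeq>\<^sub>l ell2"
proof (rule ccontr)
  assume niso: "\<not> X \<simeq>\<^sub>l ell2"
  have B: "banach_space X" and sep: "separable_space (ntop X)" and nfd: "\<not> finite_dimensional X"
    using X by (auto simp: separable_infinite_dimensional_banach_def)
  have nX: "normed_space X" using B by (simp add: banach_space_def)
  interpret X: normed_space X by fact
  obtain T where T: "lin_c00 X T" "dense_c00 X T" by (rule separable_dense_c00[OF nX sep])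
  define p where "p = (\<lambda>x. nrm X (T x))"
  interpret seminorm p unfolding p_def by (rule X.seminorm_lin_c00[OF T(1)])
  obtain F where F: "\<And>n :: nat. closedin (top_of_set I) (F n)" "\<Union> (range F) = iso_class I X"
    using fs unfolding fsigma_in_ascending by auto
  have Fsub: "F n \<subseteq> iso_class I X" for n using F(2) by blast
  \<comment> \<open>A state consists of a sequence and the number of its entries that are
    final.\<close>
  define step where "step n s s' \<longleftrightarrow> snd s < snd s' \<and> (\<forall>i<snd s. fst s' i = fst s i) \<and>
      (\<exists>u. Poly_Mapping.keys u \<subseteq> {..<snd s'} \<and> p (Poly_Mapping.single n 1 - comb (fst s') u) = 0) \<and>
      (\<forall>\<mu>\<in>I. (\<forall>q. Poly_Mapping.keys q \<subseteq> {..<snd s'} \<longrightarrow> \<mu> q = p (comb (fst s') (rat_c00 q))) \<longrightarrow> \<mu> \<notin> F n)"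
    for n and s s' :: "(nat \<Rightarrow> c00) \<times> nat"
  have "\<exists>s. \<forall>n. indep_upto p (fst (s n)) (snd (s n)) \<and> step n (s n) (s (Suc n))"
  proof (rule dependent_nat_choice)
    have "indep_upto p (\<lambda>_. 0) 0" by (simp add: indep_upto_def)
    then show "\<exists>s. indep_upto p (fst s) (snd s)" by (intro exI[of _ "(\<lambda>_. 0, 0)"]) simp
    fix s :: "(nat \<Rightarrow> c00) \<times> nat" and n assume s: "indep_upto p (fst s) (snd s)"
    obtain v' k' where "snd s < k'" "\<And>i. i < snd s \<Longrightarrow> v' i = fst s i" "indep_upto p v' k'"
      "\<exists>u. Poly_Mapping.keys u \<subseteq> {..<k'} \<and> p (Poly_Mapping.single n 1 - comb v' u) = 0"
      "\<forall>\<mu>\<in>I. (\<forall>q. Poly_Mapping.keys q \<subseteq> {..<k'} \<longrightarrow> \<mu> q = p (comb v' (rat_c00 q))) \<longrightarrow> \<mu> \<notin> F n"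
      by (rule fusion_step[OF I B nfd T niso p_def F(1)[of n] Fsub s], rule that)
    then show "\<exists>s'. indep_upto p (fst s') (snd s') \<and> step n s s'"
      by (intro exI[of _ "(v', k')"]) (simp add: step_def)
  qed
  then obtain s where s: "\<And>n. indep_upto p (fst (s n)) (snd (s n))" "\<And>n. step n (s n) (s (Suc n))" by blast
  define v where "v n = fst (s n)" for n
  define k where "k n = snd (s n)" for n
  have st: "k n < k (Suc n)" "\<And>i. i < k n \<Longrightarrow> v (Suc n) i = v n i"
    "\<exists>u. Poly_Mapping.keys u \<subseteq> {..<k (Suc n)} \<and> p (Poly_Mapping.single n 1 - comb (v (Suc n)) u) = 0"
    "\<And>\<mu>. \<mu> \<in> I \<Longrightarrow> (\<And>q. Poly_Mapping.keys q \<subseteq> {..<k (Suc n)} \<Longrightarrow> \<mu> q = p (comb (v (Suc n)) (rat_c00 q))) \<Longrightarrow> \<mu> \<notin> F n"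
    for n
    using s(2)[of n] by (simp_all add: step_def v_def k_def)
  have km: "strict_mono k" using st(1) by (rule strict_monoI_Suc)
  have kge: "n \<le> k n" for n using strict_mono_imp_increasing[OF km] by simp
  have vm: "v n i = v m i" if "m \<le> n" "i < k m" for m n i
    using that
  proof (induction n rule: dec_induct)
    case (step n)
    have "k m \<le> k n" using km step(1) by (simp add: strict_mono_less_eq)
    then show ?case using st(2)[of i n] step by simp
  qed simp
  \<comment> \<open>The diagonal sequence: entry \<open>i\<close> is final from stage
    \<open>Suc i\<close> on, because \<open>i < k (Suc i)\<close>.\<close>
  define w where "w i = v (Suc i) i" for i
  have wv: "w i = v n i" if "i < k n" for i n
  proof (cases "Suc i \<le> n")
    case True
    have "i < k (Suc i)" using kge[of "Suc i"] by simp
    then show ?thesis using vm[OF True] by (simp add: w_def)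
  next
    case False
    then show ?thesis using vm[of n "Suc i" i] that by (simp add: w_def)
  qed
  have comb_w: "comb w x = comb (v n) x" if "Poly_Mapping.keys x \<subseteq> {..<k n}" for x n
    using that wv by (intro comb_cong) auto
  define \<nu> where "\<nu> x = p (comb w x)" for x
  have \<nu>: "seminorm \<nu>" unfolding \<nu>_def by (rule seminorm_compose[OF seminorm_axioms linear_comb])
  have \<nu>0: "x = 0" if "\<nu> x = 0" for x
  proof -
    obtain n where "Poly_Mapping.keys x \<subseteq> {..<n}" using finite_nat_bounded[OF finite_keys[of x]] by (elim exE)
    then have keys: "Poly_Mapping.keys x \<subseteq> {..<k n}" using kge[of n] by force
    then have "p (comb (v n) x) = 0" using that by (simp add: \<nu>_def comb_w)
    then show ?thesis using s(1)[of n] keys by (simp add: indep_upto_def v_def k_def)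
  qed
  define \<mu> where "\<mu> = (\<lambda>q. \<nu> (rat_c00 q))"
  have \<mu>: "\<mu> \<in> I" "\<mu> \<in> pseudonorms" "extension \<mu> = \<nu>"
    unfolding \<mu>_def using norm_in_I[OF I \<nu> \<nu>0] restrict_pseudonorm[OF \<nu>] by simp_all
  have notF: "\<mu> \<notin> F n" for n
    by (rule st(4)[OF \<mu>(1)]) (simp add: \<mu>_def \<nu>_def comb_w)
  obtain J where J: "banach_space (X_space \<mu>)" "lin_c00 (X_space \<mu>) J" "dense_c00 (X_space \<mu>) J"
    "\<And>x. nrm (X_space \<mu>) (J x) = \<nu> x"
    using X_space_properties[OF \<mu>(2)] unfolding \<mu>(3) by blast
  have lin: "lin_c00 X (\<lambda>x. T (comb w x))"
    using T(1) by (simp add: lin_c00_def linear_add[OF linear_comb] linear_scale[OF linear_comb])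
  have dense: "dense_c00 X (\<lambda>x. T (comb w x))"
    unfolding dense_c00_def
  proof (intro ballI allI impI)
    fix x and e :: real assume x: "x \<in> carrier X" and e: "0 < e"
    then obtain c where c: "nrm X (x \<ominus>\<^bsub>X\<^esub> T c) < e" using T(2) by (auto simp: dense_c00_def)
    \<comment> \<open>Every unit vector is reached up to the null space of \<open>p\<close>, hence
      so is every vector of \<open>c00\<close>. The new presentation therefore has the same range as
      \<open>T\<close>, which is dense.\<close>
    have "\<exists>u. p (Poly_Mapping.single n 1 - comb w u) = 0" for n
      using st(3)[of n] comb_w by metis
    then obtain u where u: "\<And>n. p (Poly_Mapping.single n 1 - comb w (u n)) = 0" by metis
    have "c - comb w (comb u c) = (\<Sum>n\<in>Poly_Mapping.keys c. Poly_Mapping.lookup c n *\<^sub>R (Poly_Mapping.single n 1 - comb w (u n)))"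
      unfolding comb_comb
      by (subst (1) comb_units[of c, symmetric]) (simp add: comb_def scaleR_diff_right sum_subtractf)
    then have "p (c - comb w (comb u c)) \<le> (\<Sum>n\<in>Poly_Mapping.keys c. \<bar>Poly_Mapping.lookup c n\<bar> * p (Poly_Mapping.single n 1 - comb w (u n)))"
      using sum_le by metis
    also have "\<dots> = 0" by (simp add: u)
    finally have "nrm X (T c \<ominus>\<^bsub>X\<^esub> T (comb w (comb u c))) \<le> 0"
      by (simp add: p_def X.lin_c00D(5)[OF T(1)])
    then have "nrm X (x \<ominus>\<^bsub>X\<^esub> T (comb w (comb u c))) < e"
      using c X.nrm_triangle_diff[OF x X.lin_c00D(1)[OF T(1)] X.lin_c00D(1)[OF T(1)], of c "comb w (comb u c)"]
        X.nrm_triangle_diff[OF x X.lin_c00D(1)[OF T(1)] X.lin_c00D(1)[OF T(1)], of "comb w (comb u c)" c]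
      by linarith
    then show "\<exists>c. nrm X (x \<ominus>\<^bsub>X\<^esub> T (comb w c)) < e" by blast
  qed
  have "X_space \<mu> \<simeq>\<^sub>l X"
    by (rule isomorphic_of_dense[OF J(1) B J(2,3) lin dense, of 1]) (simp_all add: J(4) \<nu>_def p_def)
  then have "\<mu> \<in> iso_class I X" using \<mu>(1) by (simp add: iso_class_def)
  then show False using F(2) notF by blast
qed

section \<open>Completeness of the class of the Hilbert space\<close>

lemma seminorm_max:
  assumes "seminorm p" "seminorm q"
  shows "seminorm (\<lambda>x. max (p x) (q x))"
proof -
  interpret p: seminorm p by fact
  interpret q: seminorm q by fact
  show ?thesis
  proof
    fix c x y
    show "max (p (c *\<^sub>R x)) (q (c *\<^sub>R x)) = \<bar>c\<bar> * max (p x) (q x)"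
      by (simp add: p.scale q.scale max_mult_distrib_left)
    show "max (p (x + y)) (q (x + y)) \<le> max (p x) (q x) + max (p y) (q y)"
      using p.triangle[of x y] q.triangle[of x y] by linarith
  qed
qed

lemma seminorm_SUP:
  fixes p :: "'i \<Rightarrow> 'v::real_vector \<Rightarrow> real"
  assumes p: "\<And>i. seminorm (p i)" and bdd: "\<And>x. bdd_above (range (\<lambda>i. p i x))"
  shows "seminorm (\<lambda>x. SUP i. p i x)"
proof
  fix c :: real and x y :: 'v
  have upper: "p i x \<le> (SUP i. p i x)" for i x by (rule cSUP_upper[OF _ bdd]) simp
  show "(SUP i. p i (x + y)) \<le> (SUP i. p i x) + (SUP i. p i y)"
  proof (rule cSUP_least)
    fix i show "p i (x + y) \<le> (SUP i. p i x) + (SUP i. p i y)"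
      using seminorm.triangle[OF p, of i x y] upper[of i x] upper[of i y] by linarith
  qed simp
  have le: "(SUP i. p i (c *\<^sub>R x)) \<le> \<bar>c\<bar> * (SUP i. p i x)" for c x
  proof (rule cSUP_least)
    fix i show "p i (c *\<^sub>R x) \<le> \<bar>c\<bar> * (SUP i. p i x)"
      unfolding seminorm.scale[OF p] by (rule mult_left_mono[OF upper]) simp
  qed simp
  show "(SUP i. p i (c *\<^sub>R x)) = \<bar>c\<bar> * (SUP i. p i x)"
  proof (cases "c = 0")
    case True
    then show ?thesis by (simp add: seminorm.zero[OF p])
  next
    case False
    have "(SUP i. p i x) \<le> \<bar>inverse c\<bar> * (SUP i. p i (c *\<^sub>R x))"
      using le[of "inverse c" "c *\<^sub>R x"] False by simp
    then have "\<bar>c\<bar> * (SUP i. p i x) \<le> (SUP i. p i (c *\<^sub>R x))"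
      using False by (simp add: abs_inverse field_simps)
    then show ?thesis using le[of c x] by simp
  qed
qed

lemma continuous_map_Max:
  fixes g :: "'i \<Rightarrow> 'z \<Rightarrow> real"
  assumes "finite P" "\<And>i. i \<in> P \<Longrightarrow> continuous_map Z euclideanreal (g i)"
  shows "continuous_map Z euclideanreal (\<lambda>z. Max (insert c ((\<lambda>i. g i z) ` P)))"
  using assms
proof (induction P)
  case (insert a P)
  have "Max (insert c ((\<lambda>i. g i z) ` insert a P)) = max (g a z) (Max (insert c ((\<lambda>i. g i z) ` P)))" for z
  proof -
    have "insert c ((\<lambda>i. g i z) ` insert a P) = insert (g a z) (insert c ((\<lambda>i. g i z) ` P))" by auto
    then show ?thesis using insert.hyps(1) by (simp only:) (rule Max_insert, auto)
  qed
  then show ?case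
    using insert by (simp add: continuous_map_real_max)
qed simp

text \<open>Truncated multiples of the distance to \<open>C\<close>. A sequence of functions is used
  because off \<open>C\<close> the value 1 has to be attained: a large block of small weight need
  not destroy a Hilbertian norm.\<close>

lemma zero_set_functions:
  assumes "metrizable_space Z" "closedin Z C"
  obtains \<phi> :: "nat \<Rightarrow> 'z \<Rightarrow> real" where "\<And>m. continuous_map Z euclideanreal (\<phi> m)"
    "\<And>m z. 0 \<le> \<phi> m z \<and> \<phi> m z \<le> 1" "\<And>m z. z \<in> C \<Longrightarrow> \<phi> m z = 0"
    "\<And>z. z \<in> topspace Z \<Longrightarrow> z \<notin> C \<Longrightarrow> \<exists>m. \<phi> m z = 1"
proof -
  obtain M d where M: "Metric_space M d" "Z = Metric_space.mtopology M d"
    using assms(1) by (auto simp: metrizable_space_def)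
  interpret Metric_space M d by fact
  have top: "topspace Z = M" by (simp add: M(2))
  have CM: "C \<subseteq> M" using closedin_subset[OF assms(2)] top by simp
  \<comment> \<open>For empty \<open>C\<close> a positive constant takes the place of the
    distance.\<close>
  define D where "D z = (if C = {} then 1 else INF c\<in>C. d z c)" for z
  have bdd: "bdd_below (d z ` C)" for z by (rule bdd_belowI[of _ 0]) auto
  have D0: "0 \<le> D z" for z unfolding D_def by (auto intro!: cINF_greatest)
  have lip: "D z \<le> D z' + d z z'" if "z \<in> M" "z' \<in> M" for z z'
  proof (cases "C = {}")
    case False
    have "(INF c\<in>C. d z c) - d z z' \<le> (INF c\<in>C. d z' c)"
    proof (rule cINF_greatest[OF False])
      fix c assume c: "c \<in> C"
      have "(INF c\<in>C. d z c) \<le> d z c" by (rule cINF_lower[OF bdd c])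
      also have "\<dots> \<le> d z z' + d z' c" using that c CM by (intro triangle) auto
      finally show "(INF c\<in>C. d z c) - d z z' \<le> d z' c" by simp
    qed
    then show ?thesis using False by (simp add: D_def)
  qed (simp add: D_def)
  have contD: "continuous_map Z euclideanreal D"
  proof -
    have "continuous_map mtopology Met_TC.mtopology D"
      unfolding metric_continuous_map[OF Met_TC.Metric_space_axioms]
    proof (intro conjI ballI allI impI)
      fix a and e :: real assume a: "a \<in> M" and e: "0 < e"
      have "dist (D a) (D x) < e" if "x \<in> M \<and> d a x < e" for x
        using lip[OF a, of x] lip[of x a] a that commute[of a x] by (auto simp: dist_real_def)
      then show "\<exists>\<delta>>0. \<forall>x. x \<in> M \<and> d a x < \<delta> \<longrightarrow> dist (D a) (D x) < e" using e by blast
    qed simp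
    then show ?thesis by (simp add: M(2))
  qed
  define \<phi> where "\<phi> m z = min 1 (real m * D z)" for m z
  show ?thesis
  proof (rule that[of \<phi>])
    show "continuous_map Z euclideanreal (\<phi> m)" for m
      unfolding \<phi>_def by (intro continuous_map_real_min continuous_map_real_mult contD) auto
    show "0 \<le> \<phi> m z \<and> \<phi> m z \<le> 1" for m z using D0[of z] by (simp add: \<phi>_def)
    show "\<phi> m z = 0" if z: "z \<in> C" for m z
    proof -
      have "(INF c\<in>C. d z c) \<le> d z z" by (rule cINF_lower[OF bdd z])
      then have "D z \<le> 0" using z CM by (auto simp: D_def)
      then show ?thesis using D0[of z] by (simp add: \<phi>_def)
    qed
    show "\<exists>m. \<phi> m z = 1" if z: "z \<in> topspace Z" "z \<notin> C" for z
    proof -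
      have "openin mtopology (M - C)" using assms(2) top unfolding closedin_def M(2) by simp
      then obtain r where r: "0 < r" "mball z r \<subseteq> M - C"
        using z top unfolding openin_mtopology by blast
      have "min 1 r \<le> D z"
      proof (cases "C = {}")
        case False
        have "r \<le> d z c" if "c \<in> C" for c
        proof (rule ccontr)
          assume "\<not> r \<le> d z c"
          then have "c \<in> mball z r" using that z(1) top CM by auto
          then show False using r(2) that by blast
        qed
        then show ?thesis using False by (auto simp: D_def intro!: cINF_greatest min.coboundedI2)
      qed (simp add: D_def)
      then have Dpos: "0 < D z" using r(1) by linarith
      obtain m where "inverse (D z) \<le> real m" using real_arch_simple by blast
      then have "1 \<le> real m * D z" using Dpos by (simp add: field_simps)
      then show ?thesis by (intro exI[of _ m]) (simp add: \<phi>_def)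
    qed
  qed
qed

text \<open>The pair \<open>(n, m)\<close> indexes the \<open>m\<close>-th block of size
  \<open>n\<close>. Infinitely many blocks of each size allow each function of a sequence to weigh a
  block of its own; nested pair encoding makes the blocks disjoint.\<close>

definition block :: "nat \<times> nat \<Rightarrow> nat set" where
  "block i = (\<lambda>r. prod_encode (prod_encode i, r)) ` {..<fst i}"

lemma card_block: "card (block i) = fst i"
  unfolding block_def by (subst card_image) (auto simp: inj_on_def)

lemma finite_block [simp]: "finite (block i)"
  by (simp add: block_def)

definition block_norm :: "nat \<times> nat \<Rightarrow> c00 \<Rightarrow> real" where
  "block_norm i x = (\<Sum>j\<in>block i. \<bar>Poly_Mapping.lookup x j\<bar>)"

lemma seminorm_block_norm: "0 \<le> c \<Longrightarrow> seminorm (\<lambda>x. c * block_norm i x)"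
proof
  fix r and x y :: c00 assume c: "0 \<le> c"
  show "c * block_norm i (r *\<^sub>R x) = \<bar>r\<bar> * (c * block_norm i x)"
    by (simp add: block_norm_def abs_mult sum_distrib_left mult_ac)
  have "block_norm i (x + y) \<le> block_norm i x + block_norm i y"
    unfolding block_norm_def sum.distrib[symmetric]
    by (rule sum_mono) (simp add: lookup_add abs_triangle_ineq)
  then show "c * block_norm i (x + y) \<le> c * block_norm i x + c * block_norm i y"
    using c by (simp add: mult_left_mono flip: distrib_left)
qed

lemma block_norm_nonneg: "0 \<le> block_norm i x"
  by (simp add: block_norm_def sum_nonneg)

lemma block_norm_le_l2: "block_norm i x \<le> sqrt (fst i) * l2 x"
proof -
  have "block_norm i x = (\<Sum>j\<in>block i. \<bar>Poly_Mapping.lookup x j\<bar> * \<bar>1\<bar>)" by (simp add: block_norm_def)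
  also have "\<dots> \<le> L2_set (Poly_Mapping.lookup x) (block i) * L2_set (\<lambda>_. 1) (block i)"
    by (rule L2_set_mult_ineq)
  also have "\<dots> \<le> l2 x * sqrt (fst i)"
    by (intro mult_mono L2_le_l2) (auto simp: L2_set_def card_block)
  finally show ?thesis by (simp add: mult.commute)
qed

lemma block_norm_eq_0:
  assumes "i \<notin> (\<lambda>j. prod_decode (fst (prod_decode j))) ` Poly_Mapping.keys x"
  shows "block_norm i x = 0"
proof -
  have "Poly_Mapping.lookup x j = 0" if "j \<in> block i" for j
  proof (rule ccontr)
    assume "Poly_Mapping.lookup x j \<noteq> 0"
    then have "j \<in> Poly_Mapping.keys x" by (simp add: in_keys_iff)
    moreover have "i = prod_decode (fst (prod_decode j))" using that by (auto simp: block_def)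
    ultimately show False using assms by blast
  qed
  then show ?thesis by (simp add: block_norm_def)
qed

text \<open>For a weight \<open>c\<close> with values in \<open>[0, 1]\<close> this norm is Hilbertian if the sizes of the blocks of
  nonzero weight are bounded, and not Hilbertian if arbitrarily large blocks have weight \<open>1\<close>.\<close>

definition mixed_norm :: "(nat \<times> nat \<Rightarrow> real) \<Rightarrow> c00 \<Rightarrow> real" where
  "mixed_norm c x = (SUP i. max (l2 x) (c i * block_norm i x))"

context
  fixes c :: "nat \<times> nat \<Rightarrow> real"
  assumes c: "\<And>i. 0 \<le> c i \<and> c i \<le> 1"
begin

text \<open>A vector meets finitely many blocks, and which ones does not depend on \<open>c\<close>.
  As a maximum over a fixed finite index set, the norm of a vector is continuous in the
  weights.\<close>

lemma mixed_norm_eq_Max: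
  "mixed_norm c x = Max (insert (l2 x) ((\<lambda>i. c i * block_norm i x) `
     ((\<lambda>j. prod_decode (fst (prod_decode j))) ` Poly_Mapping.keys x)))" (is "_ = Max ?A")
proof -
  have fin: "finite ?A" by simp
  have in_A: "max (l2 x) (c i * block_norm i x) \<in> ?A" for i
  proof (cases "i \<in> (\<lambda>j. prod_decode (fst (prod_decode j))) ` Poly_Mapping.keys x")
    case True
    then show ?thesis by (simp add: max_def)
  next
    case False
    then show ?thesis using block_norm_eq_0[of i x] by (simp add: max_absorb1)
  qed
  have bdd: "bdd_above (range (\<lambda>i. max (l2 x) (c i * block_norm i x)))"
    by (rule bdd_above_mono[OF bdd_above_finite[OF fin]]) (use in_A in blast)
  show ?thesis
    unfolding mixed_norm_def
  proof (rule antisym)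
    show "(SUP i. max (l2 x) (c i * block_norm i x)) \<le> Max ?A"
      by (rule cSUP_least) (auto intro!: Max_ge[OF fin] in_A simp del: max.bounded_iff)
    show "Max ?A \<le> (SUP i. max (l2 x) (c i * block_norm i x))"
    proof (rule Max.boundedI[OF fin])
      fix a assume "a \<in> ?A"
      then consider "a = l2 x" | i where "a = c i * block_norm i x" by blast
      then have "\<exists>i. a \<le> max (l2 x) (c i * block_norm i x)"
        by cases (use max.cobounded1 max.cobounded2 in blast)+
      then show "a \<le> (SUP i. max (l2 x) (c i * block_norm i x))"
        using cSUP_upper[OF _ bdd] by (meson UNIV_I order_trans)
    qed simp
  qed
qed

lemma mixed_norm_bdd: "bdd_above (range (\<lambda>i. max (l2 x) (c i * block_norm i x)))"
proof (rule bdd_aboveI2)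
  fix i
  have "c i * block_norm i x \<le> 1 * block_norm i x" using c block_norm_nonneg by (intro mult_right_mono) auto
  also have "\<dots> \<le> wsum (\<lambda>_. 1) x"
  proof -
    have "block_norm i x = (\<Sum>j\<in>block i \<inter> Poly_Mapping.keys x. \<bar>Poly_Mapping.lookup x j\<bar>)"
      unfolding block_norm_def by (rule sum.mono_neutral_right) (auto simp: in_keys_iff)
    also have "\<dots> \<le> wsum (\<lambda>_. 1) x"
      unfolding wsum_def by simp (rule sum_mono2; auto)
    finally show ?thesis by simp
  qed
  finally show "max (l2 x) (c i * block_norm i x) \<le> max (l2 x) (wsum (\<lambda>_. 1) x)" by auto
qed

lemma seminorm_mixed_norm: "seminorm (mixed_norm c)"
  unfolding mixed_norm_def[abs_def]
  by (rule seminorm_SUP[OF seminorm_max[OF seminorm_l2 seminorm_block_norm] mixed_norm_bdd]) (simp add: c)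

lemma mixed_norm_ge: "l2 x \<le> mixed_norm c x" "c i * block_norm i x \<le> mixed_norm c x"
  using cSUP_upper[OF UNIV_I mixed_norm_bdd[of x], of i] unfolding mixed_norm_def by auto

lemma mixed_norm_eq_0: "mixed_norm c x = 0 \<Longrightarrow> x = 0"
  using mixed_norm_ge(1)[of x] l2_nonneg[of x] by (metis antisym l2_eq_0_iff)

text \<open>By the Cauchy-Schwarz inequality a block of size below \<open>N\<close> contributes at
  most \<open>sqrt N\<close> times the Euclidean norm, so the whole norm is equivalent to
  \<open>l2\<close>.\<close>

lemma mixed_norm_hilbert:
  assumes "\<And>i. N \<le> fst i \<Longrightarrow> c i = 0"
  shows "\<exists>C. hilbert_const C (mixed_norm c)"
proof (rule hilbert_const_of_tail[OF seminorm_mixed_norm, where k = 0])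
  show "0 < sqrt N + 1" by (simp add: add_nonneg_pos)
  fix x
  have "mixed_norm c x \<le> (sqrt N + 1) * l2 x"
    unfolding mixed_norm_def
  proof (rule cSUP_least)
    fix i
    have "c i * block_norm i x \<le> sqrt N * l2 x"
    proof (cases "N \<le> fst i")
      case False
      have "c i * block_norm i x \<le> 1 * (sqrt (fst i) * l2 x)"
        using c block_norm_le_l2 block_norm_nonneg by (intro mult_mono) auto
      also have "\<dots> \<le> sqrt N * l2 x" using False by (simp add: mult_right_mono)
      finally show ?thesis .
    qed (use assms in simp)
    moreover have "0 \<le> sqrt N * l2 x" by simp
    ultimately show "max (l2 x) (c i * block_norm i x) \<le> (sqrt N + 1) * l2 x"
      by (simp add: distrib_right add_increasing add_increasing2)
  qed simp
  moreover have "l2 x \<le> (sqrt N + 1) * mixed_norm c x"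
  proof -
    have "0 \<le> mixed_norm c x" by (rule seminorm.nonneg[OF seminorm_mixed_norm])
    then have "1 * mixed_norm c x \<le> (sqrt N + 1) * mixed_norm c x" by (intro mult_right_mono) auto
    then show ?thesis using mixed_norm_ge(1)[of x] by simp
  qed
  ultimately show "l2 x \<le> (sqrt N + 1) * mixed_norm c x \<and> mixed_norm c x \<le> (sqrt N + 1) * l2 x" by simp
qed

text \<open>Suitable signs keep the form at most \<open>n\<close> on a signed sum of the unit
  vectors in a block of size \<open>n\<close>, whereas the block norm of that sum is
  \<open>n\<close>. Comparison gives \<open>n\<^sup>2 \<le> K * n\<close>, which fails for
  \<open>n\<close> above \<open>\<bar>K\<bar>\<close>.\<close>

lemma mixed_norm_not_hilbert:
  assumes one: "\<And>n. \<exists>m. c (n, m) = 1" and h: "hilbert_const K (mixed_norm c)"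
  shows False
proof -
  obtain b where b: "semi_inner b" "\<And>x. b x x \<le> (mixed_norm c x)\<^sup>2" "\<And>x. (mixed_norm c x)\<^sup>2 \<le> K * b x x"
    using h by (auto simp: hilbert_const_def)
  note B = semi_innerD[OF b(1)]
  let ?e = "\<lambda>j. Poly_Mapping.single j 1 :: c00"
  have unit: "mixed_norm c (?e j) \<le> 1" for j
    unfolding mixed_norm_def
  proof (rule cSUP_least)
    fix i
    have "block_norm i (?e j) \<le> 1"
    proof -
      have "block_norm i (?e j) = (\<Sum>k\<in>block i. if k = j then 1 else 0)"
        unfolding block_norm_def by (rule sum.cong) (auto simp: lookup_single when_def)
      then show ?thesis by (simp add: sum.delta)
    qed
    then have "c i * block_norm i (?e j) \<le> 1 * 1" using c block_norm_nonneg by (intro mult_mono) auto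
    moreover have "l2 (?e j) = 1" by (simp add: l2_def)
    ultimately show "max (l2 (?e j)) (c i * block_norm i (?e j)) \<le> 1" by simp
  qed simp
  have bunit: "b (?e j) (?e j) \<le> 1" for j
  proof -
    have "(mixed_norm c (?e j))\<^sup>2 \<le> 1\<^sup>2"
      by (rule power_mono[OF unit seminorm.nonneg[OF seminorm_mixed_norm]])
    then show ?thesis using b(2)[of "?e j"] by simp
  qed
  have signs: "\<exists>s. (\<forall>j. \<bar>s j\<bar> = 1) \<and> b (\<Sum>j\<in>A. s j *\<^sub>R ?e j) (\<Sum>j\<in>A. s j *\<^sub>R ?e j) \<le> card A"
    if "finite A" for A
    using that
  proof induction
    case empty
    show ?case by (rule exI[of _ "\<lambda>_. 1"]) (simp add: B(9))
  next
    case (insert a A)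
    then obtain s where s: "\<forall>j. \<bar>s j\<bar> = 1" "b (\<Sum>j\<in>A. s j *\<^sub>R ?e j) (\<Sum>j\<in>A. s j *\<^sub>R ?e j) \<le> card A" by blast
    define y where "y = (\<Sum>j\<in>A. s j *\<^sub>R ?e j)"
    \<comment> \<open>This choice makes the cross term nonpositive, so each new vector adds at most
      1 to the form.\<close>
    define t :: real where "t = (if b y (?e a) \<le> 0 then 1 else - 1)"
    have t: "\<bar>t\<bar> = 1" "t * b y (?e a) \<le> 0" by (auto simp: t_def)
    have "(\<Sum>j\<in>insert a A. (s(a := t)) j *\<^sub>R ?e j) = t *\<^sub>R ?e a + (\<Sum>j\<in>A. (s(a := t)) j *\<^sub>R ?e j)"
      using insert.hyps by (subst sum.insert) auto
    also have "(\<Sum>j\<in>A. (s(a := t)) j *\<^sub>R ?e j) = y"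
      unfolding y_def using insert.hyps by (intro sum.cong) auto
    finally have eq: "(\<Sum>j\<in>insert a A. (s(a := t)) j *\<^sub>R ?e j) = t *\<^sub>R ?e a + y" .
    have "b (t *\<^sub>R ?e a + y) (t *\<^sub>R ?e a + y) = t * t * b (?e a) (?e a) + 2 * (t * b y (?e a)) + b y y"
      using B(3)[of "?e a" y] by (simp add: B(1) B(2) B(5) B(6) algebra_simps)
    also have "t * t = 1" by (simp add: t_def)
    also have "1 * b (?e a) (?e a) + 2 * (t * b y (?e a)) + b y y \<le> 1 + real (card A)"
      using bunit[of a] t(2) s(2)[folded y_def] by linarith
    finally have "b (t *\<^sub>R ?e a + y) (t *\<^sub>R ?e a + y) \<le> card (insert a A)" using insert.hyps by simp
    moreover have "\<forall>j. \<bar>(s(a := t)) j\<bar> = 1" using s(1) t(1) by simp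
    ultimately show ?case unfolding eq[symmetric] by blast
  qed
  obtain n where n: "\<bar>K\<bar> < real n" using reals_Archimedean2 by blast
  obtain m where m: "c (n, m) = 1" using one by blast
  obtain s where s: "\<forall>j. \<bar>s j\<bar> = 1"
    "b (\<Sum>j\<in>block (n, m). s j *\<^sub>R ?e j) (\<Sum>j\<in>block (n, m). s j *\<^sub>R ?e j) \<le> n"
    using signs[OF finite_block[of "(n, m)"]] by (auto simp: card_block)
  let ?x = "\<Sum>j\<in>block (n, m). s j *\<^sub>R ?e j"
  have "Poly_Mapping.lookup ?x j = s j" if "j \<in> block (n, m)" for j
  proof -
    have "Poly_Mapping.lookup ?x j = (\<Sum>k\<in>block (n, m). if k = j then s j else 0)"
      unfolding lookup_sum by (rule sum.cong) (auto simp: lookup_single when_def)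
    then show ?thesis using that by (simp add: sum.delta)
  qed
  then have "block_norm (n, m) ?x = n"
    using s(1) by (simp add: block_norm_def card_block)
  then have "real n \<le> mixed_norm c ?x" using mixed_norm_ge(2)[of "(n, m)" ?x] m by simp
  then have "(real n)\<^sup>2 \<le> (mixed_norm c ?x)\<^sup>2" by (intro power_mono) auto
  also have "\<dots> \<le> K * b ?x ?x" by (rule b(3))
  also have "\<dots> \<le> \<bar>K\<bar> * real n"
    using s(2) B(4)[of ?x] by (intro mult_mono) auto
  also have "\<dots> < real n * real n" using n by (intro mult_strict_right_mono) auto
  finally show False by (simp add: power2_eq_square)
qed

end

text \<open>The sets \<open>F n\<close> increase, so a point of \<open>C\<close> lies in all but
  finitely many of them, and the weights of all large blocks vanish there. At a point outside
  \<open>C\<close> every \<open>n\<close> has a block of size \<open>n\<close> with weight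
  1.\<close>

theorem fsigma_complete_ell2_class:
  assumes I: "I = B_norms \<or> I = P_inf"
  shows "fsigma_complete TYPE('z) (top_of_set I) (iso_class I ell2)"
  unfolding fsigma_complete_def
proof (intro conjI allI impI fsigma_ell2_class[OF I])
  fix Z :: "'z topology" and C
  assume Z: "polish_top Z \<and> Z dim_le 0 \<and> fsigma_in Z C"
  then have metr: "metrizable_space Z"
    by (auto simp: polish_top_def intro: completely_metrizable_imp_metrizable_space)
  obtain F where F: "\<And>n :: nat. closedin Z (F n)" "\<And>n. F n \<subseteq> F (Suc n)" "\<Union> (range F) = C"
    using Z unfolding fsigma_in_ascending by auto
  have "\<exists>\<phi> :: nat \<Rightarrow> 'z \<Rightarrow> real. (\<forall>m. continuous_map Z euclideanreal (\<phi> m)) \<and> (\<forall>m z. 0 \<le> \<phi> m z \<and> \<phi> m z \<le> 1) \<and>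
      (\<forall>m. \<forall>z\<in>F n. \<phi> m z = 0) \<and> (\<forall>z\<in>topspace Z. z \<notin> F n \<longrightarrow> (\<exists>m. \<phi> m z = 1))" for n
    by (rule zero_set_functions[OF metr F(1)[of n]]) blast
  then obtain \<phi> :: "nat \<Rightarrow> nat \<Rightarrow> 'z \<Rightarrow> real" where \<phi>: "\<And>n m. continuous_map Z euclideanreal (\<phi> n m)"
    "\<And>n m z. 0 \<le> \<phi> n m z \<and> \<phi> n m z \<le> 1" "\<And>n m z. z \<in> F n \<Longrightarrow> \<phi> n m z = 0"
    "\<And>n z. z \<in> topspace Z \<Longrightarrow> z \<notin> F n \<Longrightarrow> \<exists>m. \<phi> n m z = 1"
    by metis
  define c where "c z i = \<phi> (fst i) (snd i) z" for z i
  have c: "0 \<le> c z i \<and> c z i \<le> 1" for z i by (simp add: c_def \<phi>(2))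
  define f where "f z = (\<lambda>q. mixed_norm (c z) (rat_c00 q))" for z
  have fI: "f z \<in> I" for z
    unfolding f_def by (rule norm_in_I[OF I seminorm_mixed_norm[OF c] mixed_norm_eq_0[OF c]])
  have ext: "extension (f z) = mixed_norm (c z)" for z
    unfolding f_def by (rule restrict_pseudonorm(2)[OF seminorm_mixed_norm[OF c]])
  have "continuous_map Z euclideanreal (\<lambda>z. f z q)" for q
    unfolding f_def mixed_norm_eq_Max[OF c] c_def
    by (intro continuous_map_Max continuous_map_real_mult \<phi>(1)) auto
  then have "continuous_map Z euclidean f"
    unfolding euclidean_product_topology[symmetric] continuous_map_componentwise_UNIV by blast
  then have "continuous_map Z (top_of_set I) f"
    using fI by (simp add: continuous_map_in_subtopology image_subset_iff Pi_iff)
  moreover have "C = {z \<in> topspace Z. f z \<in> iso_class I ell2}"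
  proof (intro equalityI subsetI CollectI conjI)
    fix z assume z: "z \<in> C"
    then obtain N where N: "z \<in> F N" using F(3) by blast
    then show "z \<in> topspace Z" using closedin_subset[OF F(1)] by blast
    have "z \<in> F n" if "N \<le> n" for n
      using lift_Suc_mono_le[of F, OF F(2) that] N by blast
    then have "\<exists>C. hilbert_const C (mixed_norm (c z))"
      by (intro mixed_norm_hilbert[OF c, where N = N]) (simp add: c_def \<phi>(3))
    then show "f z \<in> iso_class I ell2"
      unfolding ell2_class_eq[OF I] using fI ext by simp
  next
    fix z assume z: "z \<in> {z \<in> topspace Z. f z \<in> iso_class I ell2}"
    then obtain K where K: "hilbert_const K (mixed_norm (c z))"
      unfolding ell2_class_eq[OF I] by (auto simp: ext)
    show "z \<in> C"
    proof (rule ccontr)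
      assume "z \<notin> C"
      then have "z \<notin> F n" for n using F(3) by blast
      then have "\<exists>m. c z (n, m) = 1" for n using \<phi>(4) z by (simp add: c_def)
      then show False using mixed_norm_not_hilbert[OF c _ K] by blast
    qed
  qed
  ultimately show "\<exists>f. continuous_map Z (top_of_set I) f \<and> C = {z \<in> topspace Z. f z \<in> iso_class I ell2}" by blast
qed

theorem theorem2p10:
  fixes I :: "(V \<Rightarrow> real) set"
  assumes "I = B_norms \<or> I = P_inf"
  shows "separable_infinite_dimensional_banach ell2 \<and>
    fsigma_in (top_of_set I) (iso_class I ell2) \<and>
    (\<forall>X :: 'a nspace. separable_infinite_dimensional_banach X \<and>
       fsigma_in (top_of_set I) (iso_class I X) \<longrightarrow> X \<simeq>\<^sub>l ell2) \<and>
    fsigma_complete TYPE('z) (top_of_set I) (iso_class I ell2)"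
  using ell2_separable_infinite_dimensional_banach fsigma_ell2_class[OF assms]
    fsigma_class_imp_ell2[OF assms] fsigma_complete_ell2_class[OF assms]
  by blast

end
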